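(* Let $M=\langle A,B\rangle\subset\mathbb{R}[t]^d$ be a module with two quasi-generators $A,B$. The output $\tilde A,\tilde B$ of the $\mu$-basis algorithm (described in the context) applied to $A,B$ is a $\mu$-basis of $M$, and we have $$k\cdot\deg\mathcal S_M=\deg M,$$ where $k=\deg\varphi_{\mathcal P}$ is the degree of the Plücker parametrization of $M$ and $\mathcal S_M\subset\mathbb{P}^{d-1}$ is the hypersurface associated with $M$.
   Context: Module with two quasi-generators: for $\mathbb{R}[t]$-linearly independent $A,B\in\mathbb{R}[t]^d$, put $M=\langle A,B\rangle=\{aA+bB\in\mathbb{R}[t]^d : a,b\in\mathbb{R}(t)\}$; a linearly independent pair $A,B$ with $\langle A,B\rangle=M$ is called a pair of quasi-generators of $M$. $A\wedge B=([i,j])_{i<j}$ with $[i,j]=A_iB_j-A_jB_i$, $\deg(A\wedge B)=\max_{i,j}\deg[i,j]$, and $q_{A,B}=\gcd(A\wedge B)$ is the gcd of all the $[i,j]$. For $A=\sum_{i=0}^n\alpha_it^i$ with $\alpha_i\in\mathbb{R}^d$, $\alpha_n\ne0$, put $\deg A=n$. The degree of $M$ is $\deg M=\min\{\deg(\tilde A\wedge\tilde B) : \tilde A,\tilde B\in\mathbb{R}[t]^d,\ \langle\tilde A,\tilde B\rangle=M\}$. Quasi-generators $\tilde A,\tilde B$ of $M$ are called a $\mu$-basis of $M$ if $\deg M=\deg\tilde A+\deg\tilde B$. $\mu$-basis algorithm. Input: quasi-generators $A,B$ of $M$. (1) Let $W_{A,B}$ be the $2\times d$ matrix with rows $A,B$.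 (2) Compute a Smith form $W_{A,B}=U\cdot S\cdot V$ with unimodular $U\in\mathbb{R}[t]^{2\times2}$, $V\in\mathbb{R}[t]^{d\times d}$ and $S=\begin{pmatrix}1&0&0&\cdots&0\\0&q_{A,B}&0&\cdots&0\end{pmatrix}$. (3) Let $W'$ be the $2\times d$ matrix consisting of the first two rows of $V$. (4) If the vector of leading terms (with respect to $t$) of the first row of $W'$ is $h$ times that of the second row, $h\in\mathbb{R}[t]$, replace $W'$ by $\begin{pmatrix}1&-h\\0&1\end{pmatrix}W'$. (5) If the vector of leading terms of the second row of $W'$ is $h$ times that of the first row, $h\in\mathbb{R}[t]$, replace $W'$ by $\begin{pmatrix}1&0\\-h&1\end{pmatrix}W'$. (6) If steps (4), (5) changed $W'$, go back to (4). Output: the rows $\tilde A,\tilde B$ of $W'$. (The vector of leading terms of a row of degree $m$ with leading coefficient vector $\rho\in\mathbb{R}^d$ is $\rho t^m$.) Parameters $t$ are understood as points $(t:s)\in\mathbb{P}^1$, and polynomials in $\mathbb{R}[t]$ as homogenized with respect to a new variable $s$. The Plücker parametrization is $\varphi_{\mathcal P}:\mathbb{P}^1\dashrightarrow\mathbb{P}^{d(d-1)/2-1}$, $t\mapsto([1,2]:[1,3]:\dots:[d-1,d])$ (the same for any choice of quasi-generators of $M$); $\deg\varphi_{\mathcal P}$ is the cardinality of the fibre of a generic point in its image. For a parameter $t_0$ let $L(M,t_0)=\{x\in\mathbb{R}^d : C(t_0)\cdot x=0\ \text{for all } C\in M\}$, where $C(t)\cdot x=\sum_i x_iC_i(t)$.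 The hypersurface associated with $M$ is $\mathcal S_M=\bigcup_t\mathbb{P}(L(M,t))\subset\mathbb{P}^{d-1}$. Its degree $\deg\mathcal S_M$ is its implicit degree, i.e. the number of intersections of a generic line with the hypersurface.
   Formalization: The Smith form uses S=diag(s,q/s), s the gcd of all entries of A,B, since diag(1,q) need not exist; the degree formula excludes M containing a nonzero constant vector but lying in no 3-dimensional constant subspace, where it is false; fibres and intersections are counted over C. *)

theory Defs
  imports
    "HOL-Computational_Algebra.Computational_Algebra"
    "HOL-Computational_Algebra.Field_as_Ring"
    "HOL-Library.While_Combinator"
    "Jordan_Normal_Form.Matrix"
    "Jordan_Normal_Form.Determinant"
begin

section \<open>Modules with two quasi-generators\<close>

definition indep_pair :: "nat \<Rightarrow> 'a::comm_ring_1 vec \<Rightarrow> 'a vec \<Rightarrow> bool" where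
  "indep_pair d A B \<longleftrightarrow> (\<forall>a b. a \<cdot>\<^sub>v A + b \<cdot>\<^sub>v B = 0\<^sub>v d \<longrightarrow> a = 0 \<and> b = 0)"

definition module2 :: "nat \<Rightarrow> real poly vec \<Rightarrow> real poly vec \<Rightarrow> real poly vec set" where
  "module2 d A B = {C \<in> carrier_vec d. \<exists>a b :: real poly fract.
     map_vec to_fract C = a \<cdot>\<^sub>v map_vec to_fract A + b \<cdot>\<^sub>v map_vec to_fract B}"

definition quasi_generators ::
  "nat \<Rightarrow> real poly vec set \<Rightarrow> real poly vec \<Rightarrow> real poly vec \<Rightarrow> bool" where
  "quasi_generators d M A B \<longleftrightarrow>
     A \<in> carrier_vec d \<and> B \<in> carrier_vec d \<and> indep_pair d A B \<and> module2 d A B = M"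

text \<open>
  The degree of a vector is the largest degree of a component. It is only meaningful for nonzero
  vectors (for the zero vector it is \<open>0\<close>, as for \<^const>\<open>degree\<close>).
\<close>

definition vdeg :: "'a::zero poly vec \<Rightarrow> nat" where
  "vdeg C = Max (degree ` set\<^sub>v C)"

definition brackets :: "'a::comm_ring_1 vec \<Rightarrow> 'a vec \<Rightarrow> 'a list" where
  "brackets A B = [A $ i * B $ j - A $ j * B $ i. i \<leftarrow> [0..<dim_vec A], j \<leftarrow> [Suc i..<dim_vec A]]"

definition wedge :: "'a::comm_ring_1 vec \<Rightarrow> 'a vec \<Rightarrow> 'a vec" where
  "wedge A B = vec_of_list (brackets A B)"

definition wedge_gcd :: "real poly vec \<Rightarrow> real poly vec \<Rightarrow> real poly" where
  "wedge_gcd A B = Gcd (set\<^sub>v (wedge A B))"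

definition module_degree :: "nat \<Rightarrow> real poly vec set \<Rightarrow> nat" where
  "module_degree d M = (LEAST n. \<exists>A B. A \<in> carrier_vec d \<and> B \<in> carrier_vec d \<and>
     module2 d A B = M \<and> n = vdeg (wedge A B))"

definition mu_basis :: "nat \<Rightarrow> real poly vec set \<Rightarrow> real poly vec \<Rightarrow> real poly vec \<Rightarrow> bool" where
  "mu_basis d M A B \<longleftrightarrow> quasi_generators d M A B \<and> module_degree d M = vdeg A + vdeg B"


section \<open>The \<open>\<mu>\<close>-basis algorithm\<close>

definition unimodular :: "nat \<Rightarrow> real poly mat \<Rightarrow> bool" where
  "unimodular n U \<longleftrightarrow> U \<in> carrier_mat n n \<and> is_unit (det U)"

text \<open>
  The invariant factors of the matrix with rows \<open>A\<close>, \<open>B\<close> are the gcd \<open>s\<close> of its entries and \<open>q / s\<close>,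
  where \<open>q\<close> is the gcd of its \<open>2 \<times> 2\<close> minors. For \<open>s = 1\<close> this is the diagonal \<open>1, q\<close>; if the
  entries have a common factor, no factorization with the diagonal \<open>1, q\<close> exists.
\<close>

definition smith_diag :: "nat \<Rightarrow> real poly vec \<Rightarrow> real poly vec \<Rightarrow> real poly mat" where
  "smith_diag d A B = (let s = Gcd (set\<^sub>v A \<union> set\<^sub>v B) in
     mat 2 d (\<lambda>(i, j). if i = 0 \<and> j = 0 then s
                       else if i = 1 \<and> j = 1 then wedge_gcd A B div s
                       else 0))"

definition smith_form ::
  "nat \<Rightarrow> real poly vec \<Rightarrow> real poly vec \<Rightarrow> real poly mat \<Rightarrow> real poly mat \<Rightarrow> bool" where
  "smith_form d A B U V \<longleftrightarrow> unimodular 2 U \<and> unimodular d V \<and>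
     mat_of_rows d [A, B] = U * smith_diag d A B * V"

definition leading_terms :: "real poly vec \<Rightarrow> real poly vec" where
  "leading_terms C = map_vec (\<lambda>p. monom (coeff p (vdeg C)) (vdeg C)) C"

text \<open>
  A matrix with two rows is represented by the pair of its rows. The factor \<open>h\<close> below is
  unique, as the rows occurring in the algorithm are nonzero.
\<close>

definition reduce_first :: "real poly vec \<times> real poly vec \<Rightarrow> real poly vec \<times> real poly vec" where
  "reduce_first = (\<lambda>(P, Q).
     if \<exists>h. leading_terms P = h \<cdot>\<^sub>v leading_terms Q
     then (P - (SOME h. leading_terms P = h \<cdot>\<^sub>v leading_terms Q) \<cdot>\<^sub>v Q, Q)
     else (P, Q))"

definition reduce_second :: "real poly vec \<times> real poly vec \<Rightarrow> real poly vec \<times> real poly vec" where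
  "reduce_second = (\<lambda>(P, Q).
     if \<exists>h. leading_terms Q = h \<cdot>\<^sub>v leading_terms P
     then (P, Q - (SOME h. leading_terms Q = h \<cdot>\<^sub>v leading_terms P) \<cdot>\<^sub>v P)
     else (P, Q))"

definition mu_loop ::
  "real poly vec \<times> real poly vec \<Rightarrow> (real poly vec \<times> real poly vec) option" where
  "mu_loop = while_option (\<lambda>W. reduce_second (reduce_first W) \<noteq> W)
                          (\<lambda>W. reduce_second (reduce_first W))"

text \<open>
  The set of all outcomes of the algorithm: a Smith form is not unique, so there is one outcome
  for each choice of it. A nonterminating run has the outcome \<^const>\<open>None\<close>.
\<close>

definition mu_basis_algorithm ::
  "nat \<Rightarrow> real poly vec \<Rightarrow> real poly vec \<Rightarrow> (real poly vec \<times> real poly vec) option set" where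
  "mu_basis_algorithm d A B = {mu_loop (row V 0, row V 1) |U V. smith_form d A B U V}"


section \<open>Homogeneous evaluation and projective points\<close>

text \<open>
  Fibres and intersections are counted over the complex numbers: over the reals neither the
  cardinality of a generic fibre nor the number of intersections with a generic line gives the
  degree. Every parameter \<open>(t : s)\<close> of the complex projective line is given by its unique
  representative of the form \<open>(z, 1)\<close> or \<open>(1, 0)\<close>.
\<close>

definition params :: "(complex \<times> complex) set" where
  "params = insert (1, 0) {(z, 1) |z. True}"

text \<open>All components of a vector are homogenized to the degree of the vector.\<close>

definition heval :: "real poly vec \<Rightarrow> complex \<times> complex \<Rightarrow> complex vec" where
  "heval C = (\<lambda>(t, s). map_vec
     (\<lambda>p. \<Sum>i\<le>vdeg C. complex_of_real (coeff p i) * t ^ i * s ^ (vdeg C - i)) C)"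

text \<open>A projective point is the one-dimensional subspace spanned by a nonzero vector.\<close>

definition proj_pt :: "complex vec \<Rightarrow> complex vec set" where
  "proj_pt v = {c \<cdot>\<^sub>v v |c. True}"

definition proj :: "nat \<Rightarrow> complex vec set \<Rightarrow> complex vec set set" where
  "proj d L = proj_pt ` (L - {0\<^sub>v d})"


section \<open>The degree of the Pluecker parametrization\<close>

text \<open>
  The map is the rational map \<open>t \<mapsto> proj_pt (heval (wedge A B) t)\<close>, undefined at the finitely many
  parameters where the vector vanishes. The generic point of its image is the image of all but
  finitely many parameters. If the map is constant, its generic fibre is infinite and the degree
  is \<open>0\<close>; the module then has degree \<open>0\<close>, and the associated set has codimension two.
\<close>

definition pluecker_fibre ::
  "real poly vec \<Rightarrow> real poly vec \<Rightarrow> complex vec set \<Rightarrow> (complex \<times> complex) set" where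
  "pluecker_fibre A B p = {t \<in> params. heval (wedge A B) t \<noteq> 0\<^sub>v (dim_vec (wedge A B)) \<and>
     proj_pt (heval (wedge A B) t) = p}"

definition pluecker_degree :: "real poly vec \<Rightarrow> real poly vec \<Rightarrow> nat" where
  "pluecker_degree A B = (THE k. finite {t \<in> params.
     heval (wedge A B) t \<noteq> 0\<^sub>v (dim_vec (wedge A B)) \<and>
     card (pluecker_fibre A B (proj_pt (heval (wedge A B) t))) \<noteq> k})"


section \<open>The associated hypersurface and its implicit degree\<close>

definition ruling :: "nat \<Rightarrow> real poly vec set \<Rightarrow> complex \<times> complex \<Rightarrow> complex vec set" where
  "ruling d M t = {x \<in> carrier_vec d. \<forall>C\<in>M. heval C t \<bullet> x = 0}"

definition hypersurface :: "nat \<Rightarrow> real poly vec set \<Rightarrow> complex vec set set" where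
  "hypersurface d M = (\<Union>t\<in>params. proj d (ruling d M t))"

text \<open>Polynomial functions in the \<open>2d\<close> coordinates of a pair of vectors.\<close>

inductive polynomial_fun2 :: "nat \<Rightarrow> (complex vec \<Rightarrow> complex vec \<Rightarrow> complex) \<Rightarrow> bool" for d where
  "polynomial_fun2 d (\<lambda>x y. c)"
| "i < d \<Longrightarrow> polynomial_fun2 d (\<lambda>x y. x $ i)"
| "i < d \<Longrightarrow> polynomial_fun2 d (\<lambda>x y. y $ i)"
| "polynomial_fun2 d f \<Longrightarrow> polynomial_fun2 d g \<Longrightarrow> polynomial_fun2 d (\<lambda>x y. f x y + g x y)"
| "polynomial_fun2 d f \<Longrightarrow> polynomial_fun2 d g \<Longrightarrow> polynomial_fun2 d (\<lambda>x y. f x y * g x y)"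

definition line_through :: "nat \<Rightarrow> complex vec \<Rightarrow> complex vec \<Rightarrow> complex vec set set" where
  "line_through d x y = proj d {a \<cdot>\<^sub>v x + b \<cdot>\<^sub>v y |a b. True}"

text \<open>A property holds for a generic line if it holds on a nonempty Zariski-open set of lines.\<close>

definition generic_line :: "nat \<Rightarrow> (complex vec set set \<Rightarrow> bool) \<Rightarrow> bool" where
  "generic_line d P \<longleftrightarrow> (\<exists>F. polynomial_fun2 d F \<and>
     (\<exists>x \<in> carrier_vec d. \<exists>y \<in> carrier_vec d. F x y \<noteq> 0) \<and>
     (\<forall>x \<in> carrier_vec d. \<forall>y \<in> carrier_vec d.
        F x y \<noteq> 0 \<and> indep_pair d x y \<longrightarrow> P (line_through d x y)))"

definition implicit_degree :: "nat \<Rightarrow> complex vec set set \<Rightarrow> nat" where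
  "implicit_degree d X = (THE n. generic_line d (\<lambda>l. finite (l \<inter> X) \<and> card (l \<inter> X) = n))"

text \<open>
  In the following case the set \<^const>\<open>hypersurface\<close> is a hyperplane, so of degree one, although
  the Pluecker curve is not a line: \<open>M\<close> contains a nonzero constant vector, and \<open>M\<close> does not lie
  in a three-dimensional constant subspace. Then a generic point of the hyperplane lies on several
  different rulings. Example: \<open>A = (1, 0, 0, 0)\<close>, \<open>B = (0, 1, t, t^2)\<close>, where the Pluecker
  parametrization is injective but the module has degree two.
\<close>

definition const_vec :: "real vec \<Rightarrow> real poly vec" where
  "const_vec = map_vec (\<lambda>c. [:c:])"

definition degenerate_hyperplane :: "nat \<Rightarrow> real poly vec set \<Rightarrow> bool" where
  "degenerate_hyperplane d M \<longleftrightarrow>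
     (\<exists>c \<in> carrier_vec d. c \<noteq> 0\<^sub>v d \<and> const_vec c \<in> M) \<and>
     \<not> (\<exists>u \<in> carrier_vec d. \<exists>v \<in> carrier_vec d. \<exists>w \<in> carrier_vec d. \<forall>C \<in> M. \<exists>f g h.
          C = f \<cdot>\<^sub>v const_vec u + g \<cdot>\<^sub>v const_vec v + h \<cdot>\<^sub>v const_vec w)"

end

theory Submission
  imports Defs "HOL-Analysis.Continuum_Not_Denumerable" "Jordan_Normal_Form.Char_Poly"
    "Jordan_Normal_Form.Column_Operations"
begin

text \<open>
  \<^emph>\<open>The algorithm.\<close> The first two rows of the unimodular factor of a Smith form have dual vectors,
  so they generate \<open>M\<close> over the polynomials. Row operations preserve this, and cancelling
  proportional leading terms lowers a degree; when it stops, the leading coefficient vectors of the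
  rows \<open>P\<close>, \<open>Q\<close> are independent and nothing cancels at the top of \<open>P \<and> Q\<close>. All other
  quasi-generators have a wedge product that is a polynomial multiple of \<open>P \<and> Q\<close>.

  \<^emph>\<open>The degree formula.\<close> The line spanned by \<open>x\<close>, \<open>y\<close> meets the ruling of \<open>t\<close> if and only if
  \<open>R(t) = (P\<cdot>x)(Q\<cdot>y) - (P\<cdot>y)(Q\<cdot>x)\<close> vanishes, and \<open>R\<close> has degree \<open>n = deg M\<close>. For a generic line
  the \<open>n\<close> roots are simple. They form classes of \<open>k\<close> roots with the same Pluecker point, which give
  the same point of the line, so the claim is that different classes give different points. This is an
  open condition, namely the linear independence of certain polynomials, so one line suffices. It is
  found by projecting to the plane from generic points. Two planes spanned by \<open>P\<close>, \<open>Q\<close> at different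
  parameters are identified by a projection only if they span a space of dimension three; for
  parameters in a countable set \<open>T\<close> there are only countably many such spaces to avoid. In the plane
  the fibres of the projected curve have a generic cardinality by Euclid's algorithm over the function
  field, which is read off at a point of \<open>T\<close>. Nondegeneracy is used through the fact that pairwise
  meeting lines are concurrent or coplanar.
\<close>

section \<open>Dual vectors and avoidance of hyperplanes\<close>

text \<open>Projections create coincidences. For \<open>d = 4\<close> the hyperplanes spanned by
  pairs of meeting planes may sweep out the whole space, so no centre avoids them all; only
  countably many pairs can be kept apart. A count makes this sufficient. Equality of Pluecker
  points, called \<open>E\<close>, implies coincidence after every projection, and in the plane both
  relations have classes of constant size outside a finite set of parameters. If they agree at one
  parameter of \<open>T\<close> outside the exceptional sets, the sizes are equal, hence the
  relations agree at all but finitely many parameters, and a line is chosen whose roots avoid those.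
  \<open>T\<close> has to be infinite because these exceptional sets are known only after the
  projection.

  The points on a line are counted from two sides. Roots in one class give the same point, which
  bounds the number of points by \<open>D = n / k\<close>. That there are at least \<open>D\<close>
  points is the open half: forms of degree \<open>D - 1\<close> in two variables have dimension
  \<open>D\<close>, and only the zero form vanishes on all the points exactly when there are at
  least \<open>D\<close> of them.\<close>

definition dotp :: "nat \<Rightarrow> (nat \<Rightarrow> 'a::comm_semiring_0) \<Rightarrow> (nat \<Rightarrow> 'a) \<Rightarrow> 'a" where
  "dotp d f g = (\<Sum>i<d. f i * g i)"

lemma dotp_commute: "dotp d f g = dotp d g f"
  by (simp add: dotp_def mult.commute)

lemma dotp_lincomb_left:
  "dotp d (\<lambda>i. a * f i + b * g i) h = a * dotp d f h + b * dotp d g h"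
  by (simp add: dotp_def algebra_simps sum.distrib sum_distrib_left)

lemma dotp_lincomb_right:
  "dotp d h (\<lambda>i. a * f i + b * g i) = a * dotp d h f + b * dotp d h g"
  by (simp add: dotp_def algebra_simps sum.distrib sum_distrib_left)

definition lin_indep :: "nat \<Rightarrow> nat \<Rightarrow> (nat \<Rightarrow> nat \<Rightarrow> 'a::comm_semiring_0) \<Rightarrow> bool" where
  "lin_indep r d f \<longleftrightarrow> (\<forall>c. (\<forall>i<d. (\<Sum>j<r. c j * f j i) = 0) \<longrightarrow> (\<forall>j<r. c j = 0))"

lemma lin_indepD: "lin_indep r d f \<Longrightarrow> (\<And>i. i < d \<Longrightarrow> (\<Sum>j<r. c j * f j i) = 0) \<Longrightarrow> j < r \<Longrightarrow> c j = 0"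
  unfolding lin_indep_def by blast

lemma lin_indep_Suc:
  assumes "lin_indep (Suc r) d f"
  shows "lin_indep r d f"
  unfolding lin_indep_def
proof (intro allI impI)
  fix c j assume c: "\<forall>i<d. (\<Sum>j<r. c j * f j i) = 0" and j: "j < r"
  have "(c(r := 0)) j = 0"
    by (rule lin_indepD[OF assms, of "c(r := 0)"]) (use c j in auto)
  then show "c j = 0" using j by simp
qed

text \<open>Induction on \<open>r\<close>. At a coordinate \<open>m\<close> where \<open>f r\<close>
  differs from its expansion by the previous dual vectors, the unit functional is corrected to
  vanish on the earlier \<open>f i\<close>; the earlier \<open>v j\<close> are then corrected to
  vanish on \<open>f r\<close>.\<close>

lemma dual_vectors:
  fixes f :: "nat \<Rightarrow> nat \<Rightarrow> 'a::field"
  assumes "lin_indep r d f"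
  shows "\<exists>v. \<forall>i<r. \<forall>j<r. dotp d (f i) (v j) = (if i = j then 1 else 0)"
  using assms
proof (induction r)
  case 0
  then show ?case by simp
next
  case (Suc r)
  obtain v where v: "\<And>i j. i < r \<Longrightarrow> j < r \<Longrightarrow> dotp d (f i) (v j) = (if i = j then 1 else 0)"
    using Suc.IH[OF lin_indep_Suc[OF Suc.prems]] by blast
  define c where "c j = dotp d (f r) (v j)" for j
  have "\<exists>m<d. f r m - (\<Sum>j<r. c j * f j m) \<noteq> 0"
  proof (rule ccontr)
    assume neg: "\<not> ?thesis"
    have "(\<lambda>j. if j = r then 1 else - c j) r = (0::'a)"
      by (rule lin_indepD[OF Suc.prems, of "\<lambda>j. if j = r then 1 else - c j"])
        (use neg in \<open>auto simp: sum_negf\<close>)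
    then show False by simp
  qed
  then obtain m where m: "m < d" and mne: "f r m - (\<Sum>j<r. c j * f j m) \<noteq> 0" (is "?\<delta> \<noteq> 0")
    by blast
  define w where "w i = ((if i = m then 1 else 0) - (\<Sum>j<r. f j m * v j i)) / ?\<delta>" for i
  have dw: "dotp d g w = (g m - (\<Sum>j<r. f j m * dotp d g (v j))) / ?\<delta>" for g
  proof -
    have "dotp d g w = (\<Sum>i<d. g i * (if i = m then 1 else 0) - (\<Sum>j<r. f j m * (g i * v j i))) / ?\<delta>"
      unfolding dotp_def w_def sum_divide_distrib
      by (intro sum.cong refl) (simp add: field_simps sum_distrib_left)
    also have "(\<Sum>i<d. g i * (if i = m then 1 else 0) - (\<Sum>j<r. f j m * (g i * v j i)))
        = g m - (\<Sum>i<d. \<Sum>j<r. f j m * (g i * v j i))"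
      using m by (simp add: sum_subtractf if_distrib[of "\<lambda>x. _ * x"] sum.delta cong: if_cong)
    also have "(\<Sum>i<d. \<Sum>j<r. f j m * (g i * v j i)) = (\<Sum>j<r. f j m * dotp d g (v j))"
      unfolding dotp_def sum_distrib_left by (rule sum.swap)
    finally show ?thesis .
  qed
  have wr: "dotp d (f r) w = 1"
    unfolding dw c_def[symmetric] using mne by (simp add: mult.commute)
  have wi: "dotp d (f i) w = 0" if "i < r" for i
  proof -
    have "(\<Sum>j<r. f j m * dotp d (f i) (v j)) = (\<Sum>j<r. if j = i then f j m else 0)"
      by (rule sum.cong) (use v that in auto)
    then show ?thesis unfolding dw using that by simp
  qed
  define v' where "v' j = (if j = r then w else (\<lambda>i. 1 * v j i + (- c j) * w i))" for j
  have "dotp d (f i) (v' j) = (if i = j then 1 else 0)" if "i < Suc r" "j < Suc r" for i j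
  proof (cases "j = r")
    case True
    then show ?thesis using that wr wi[of i] by (cases "i = r") (auto simp: v'_def)
  next
    case False
    then have j: "j < r" using that by simp
    have "dotp d (f i) (v' j) = dotp d (f i) (v j) - c j * dotp d (f i) w"
      using False unfolding v'_def by (simp only: if_False dotp_lincomb_right) simp
    then show ?thesis using that wr wi[of i] v[of i j] j by (cases "i = r") (auto simp: c_def)
  qed
  then show ?case by blast
qed

lemma det_nonzero_lin_indep:
  fixes A :: "nat \<Rightarrow> nat \<Rightarrow> 'a::field"
  assumes "det (mat r r (\<lambda>(i, j). A i j)) \<noteq> 0"
  shows "lin_indep r r A"
  unfolding lin_indep_def
proof (rule allI, rule impI)
  fix c assume c: "\<forall>i<r. (\<Sum>j<r. c j * A j i) = 0"
  let ?M = "mat r r (\<lambda>(i, j). A i j)"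
  have "transpose_mat ?M *\<^sub>v vec r c = 0\<^sub>v r"
    using c by (intro eq_vecI) (auto simp: scalar_prod_def atLeast0LessThan mult.commute)
  moreover have "det (transpose_mat ?M) \<noteq> 0" using assms det_transpose[of ?M r] by simp
  ultimately have "vec r c = 0\<^sub>v r"
    using det_0_iff_vec_prod_zero[of "transpose_mat ?M" r]
    by (metis mat_carrier transpose_carrier_mat vec_carrier)
  then show "\<forall>j<r. c j = 0" by (metis index_vec index_zero_vec(1))
qed

text \<open>Compressing the vectors with fixed test vectors turns independence into the non-vanishing of
  one determinant, that is, into an open condition.\<close>

lemma lin_indep_by_det:
  fixes f :: "nat \<Rightarrow> nat \<Rightarrow> 'a::field"
  assumes "det (mat r r (\<lambda>(i, j). dotp d (f i) (v j))) \<noteq> 0"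
  shows "lin_indep r d f"
  unfolding lin_indep_def
proof (rule allI, rule impI)
  fix c assume c: "\<forall>i<d. (\<Sum>j<r. c j * f j i) = 0"
  have "(\<Sum>j<r. c j * dotp d (f j) (v i)) = 0" for i
  proof -
    have "(\<Sum>j<r. c j * dotp d (f j) (v i)) = (\<Sum>k<d. (\<Sum>j<r. c j * f j k) * v i k)"
      unfolding dotp_def sum_distrib_left sum_distrib_right
      by (subst sum.swap) (simp add: mult.assoc)
    then show ?thesis using c by simp
  qed
  then show "\<forall>j<r. c j = 0"
    using det_nonzero_lin_indep[OF assms] unfolding lin_indep_def by simp
qed

lemma det_dual_vectors:
  assumes "\<forall>i<r. \<forall>j<r. dotp d (f i) (v j) = (if i = j then 1 else 0)"
  shows "det (mat r r (\<lambda>(i, j). dotp d (f i) (v j))) = (1::'a::field)"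
proof -
  have "mat r r (\<lambda>(i, j). dotp d (f i) (v j)) = 1\<^sub>m r"
    using assms by (intro eq_matI) auto
  then show ?thesis by simp
qed

lemma annihilator_exists:
  fixes f :: "nat \<Rightarrow> nat \<Rightarrow> 'a::field"
  assumes "\<not> lin_indep d d f"
  shows "\<exists>h. (\<exists>i<d. h i \<noteq> 0) \<and> (\<forall>j<d. dotp d (f j) h = 0)"
proof -
  let ?M = "mat d d (\<lambda>(i, j). f i j)"
  have "det ?M = 0" using det_nonzero_lin_indep assms by blast
  then obtain v where v: "v \<in> carrier_vec d" "v \<noteq> 0\<^sub>v d" "?M *\<^sub>v v = 0\<^sub>v d"
    using det_0_iff_vec_prod_zero[of ?M d] by auto
  have "dotp d (f j) (($) v) = 0" if "j < d" for j
  proof -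
    have "(?M *\<^sub>v v) $ j = 0" using v that by simp
    then show ?thesis using that v(1) by (simp add: scalar_prod_def dotp_def atLeast0LessThan)
  qed
  moreover have "\<exists>i<d. v $ i \<noteq> 0" using v(1,2) by (metis eq_vecI carrier_vecD index_zero_vec)
  ultimately show ?thesis by blast
qed

text \<open>Padding with zero vectors turns fewer than \<open>d\<close> vectors into a singular
  square system.\<close>

lemma annihilator_less:
  fixes f :: "nat \<Rightarrow> nat \<Rightarrow> 'a::field"
  assumes "r < d \<or> (r = d \<and> \<not> lin_indep r d f)"
  shows "\<exists>h. (\<exists>i<d. h i \<noteq> 0) \<and> (\<forall>j<r. dotp d (f j) h = 0)"
proof -
  define g where "g j = (if j < r then f j else (\<lambda>_. 0))" for j
  have "\<not> lin_indep d d g"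
  proof (cases "r < d")
    case True
    let ?c = "\<lambda>j. if j = r then (1::'a) else 0"
    have "(\<Sum>j<d. ?c j * g j i) = 0" for i
      by (rule sum.neutral) (auto simp: g_def)
    with lin_indepD[of d d g ?c r] True show ?thesis by auto
  next
    case False
    then have "r = d" "\<not> lin_indep r d f" using assms by auto
    moreover have "lin_indep d d g \<longleftrightarrow> lin_indep d d f" if "r = d"
      unfolding lin_indep_def g_def using that by simp
    ultimately show ?thesis by simp
  qed
  from annihilator_exists[OF this] obtain h where
    h: "\<exists>i<d. h i \<noteq> 0" "\<And>j. j < d \<Longrightarrow> dotp d (g j) h = 0" by blast
  have "dotp d (f j) h = 0" if "j < r" for j
    using h(2)[of j] that assms by (auto simp: g_def)
  then show ?thesis using h(1) by blast
qed

text \<open>Each pair excludes at most the value \<open>- a / b\<close> of \<open>c\<close>, and the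
  complex numbers are uncountable. For \<open>b = 0\<close> the convention
  \<open>- a / 0 = 0\<close> merely discards one more value.\<close>

lemma avoid_countable_lines:
  assumes "countable S" and "\<And>a b. (a, b) \<in> S \<Longrightarrow> a \<noteq> 0 \<or> b \<noteq> (0::complex)"
  shows "\<exists>c. \<forall>(a, b)\<in>S. a + c * b \<noteq> 0"
proof -
  have "countable ((\<lambda>(a, b). - a / b) ` S)" using assms(1) by simp
  then obtain c where c: "c \<notin> (\<lambda>(a, b). - a / b) ` S" using uncountable_UNIV_complex
    by (metis (no_types) UNIV_I countable_subset subsetI)
  have "a + c * b \<noteq> 0" if "(a, b) \<in> S" for a b
  proof
    assume *: "a + c * b = 0"
    then have "b \<noteq> 0" using assms(2)[OF that] by auto
    then have "c = - a / b" using * by (simp add: field_simps add_eq_0_iff)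
    then show False using c that by force
  qed
  then show ?thesis by blast
qed

text \<open>A hyperplane contains only finitely many points of the moment curve.\<close>

lemma avoid_countable_hyperplanes:
  fixes S :: "(nat \<Rightarrow> complex) set"
  assumes "countable S" and "\<And>h. h \<in> S \<Longrightarrow> \<exists>i<d. h i \<noteq> 0"
  shows "\<exists>e. \<forall>h\<in>S. dotp d h e \<noteq> 0"
proof -
  define p where "p h = (\<Sum>i<d. monom (h i) i)" for h :: "nat \<Rightarrow> complex"
  have pn: "p h \<noteq> 0" if "h \<in> S" for h
  proof -
    obtain i where i: "i < d" "h i \<noteq> 0" using assms(2) \<open>h \<in> S\<close> by blast
    have "coeff (p h) i = h i" using i by (simp add: p_def coeff_sum sum.delta)
    then show ?thesis using i by auto
  qed
  have "countable (\<Union>h\<in>S. {c. poly (p h) c = 0})"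
    using assms(1) by (intro countable_UN) (auto intro!: countable_finite poly_roots_finite pn)
  then obtain c where c: "c \<notin> (\<Union>h\<in>S. {c. poly (p h) c = 0})" using uncountable_UNIV_complex
    by (metis (no_types) UNIV_I countable_subset subsetI)
  have "dotp d h (\<lambda>i. c ^ i) = poly (p h) c" for h
    by (simp add: dotp_def p_def poly_sum poly_monom)
  then show ?thesis using c by (intro exI[of _ "\<lambda>i. c ^ i"]) auto
qed

section \<open>Polynomial functions and families of polynomials\<close>

text \<open>Stated for functions instead of polynomials, so that sums, products and determinants are
  handled by introduction rules.\<close>

definition polyfun :: "(complex \<Rightarrow> complex) \<Rightarrow> bool" where
  "polyfun f \<longleftrightarrow> (\<exists>p. \<forall>z. f z = poly p z)"

lemma polyfun_poly [intro]: "polyfun (poly p)"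
  unfolding polyfun_def by blast

lemma polyfun_const [intro]: "polyfun (\<lambda>_. c)"
  unfolding polyfun_def by (rule exI[of _ "[:c:]"]) simp

lemma polyfun_add [intro]: "polyfun f \<Longrightarrow> polyfun g \<Longrightarrow> polyfun (\<lambda>z. f z + g z)"
  unfolding polyfun_def by (metis poly_add)

lemma polyfun_mult [intro]: "polyfun f \<Longrightarrow> polyfun g \<Longrightarrow> polyfun (\<lambda>z. f z * g z)"
  unfolding polyfun_def by (metis poly_mult)

lemma polyfun_diff [intro]: "polyfun f \<Longrightarrow> polyfun g \<Longrightarrow> polyfun (\<lambda>z. f z - g z)"
  unfolding polyfun_def by (metis poly_diff)

lemma polyfun_sum [intro]: "(\<And>i. i \<in> I \<Longrightarrow> polyfun (f i)) \<Longrightarrow> polyfun (\<lambda>z. \<Sum>i\<in>I. f i z)"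
  by (induction I rule: infinite_finite_induct) auto

lemma polyfun_prod [intro]: "(\<And>i. i \<in> I \<Longrightarrow> polyfun (f i)) \<Longrightarrow> polyfun (\<lambda>z. \<Prod>i\<in>I. f i z)"
  by (induction I rule: infinite_finite_induct) auto

lemma det_mat_leibniz:
  "det (mat r r (\<lambda>(i, j). f i j)) = (\<Sum>p | p permutes {0..<r}. signof p * (\<Prod>i = 0..<r. f i (p i)))"
  unfolding det_def'[OF mat_carrier]
  by (intro sum.cong prod.cong refl arg_cong2[of _ _ _ _ "(*)"]) (auto simp: permutes_in_image)

lemma polyfun_det:
  assumes "\<And>i j. i < r \<Longrightarrow> j < r \<Longrightarrow> polyfun (\<lambda>z. A z i j)"
  shows "polyfun (\<lambda>z. det (mat r r (\<lambda>(i, j). A z i j)))"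
  unfolding det_mat_leibniz
  by (intro polyfun_sum polyfun_mult polyfun_const polyfun_prod assms)
    (auto simp: permutes_in_image)

lemma polyfun_finite_zeros:
  assumes "polyfun f" "f z0 \<noteq> 0"
  shows "finite {z. f z = 0}"
proof -
  obtain p where p: "\<And>z. f z = poly p z" using assms(1) unfolding polyfun_def by blast
  then have "p \<noteq> 0" using assms(2) by auto
  then show ?thesis using poly_roots_finite[of p] p by simp
qed

text \<open>With the dual vectors at \<open>z0\<close> as test vectors, the compressed determinant
  is a polynomial in \<open>z\<close> with the value 1 at \<open>z0\<close>; dependence can occur
  only at its zeros.\<close>

lemma lin_dep_finite:
  fixes f :: "complex \<Rightarrow> nat \<Rightarrow> nat \<Rightarrow> complex"
  assumes "\<And>i j. i < r \<Longrightarrow> j < d \<Longrightarrow> polyfun (\<lambda>z. f z i j)" and "lin_indep r d (f z0)"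
  shows "finite {z. \<not> lin_indep r d (f z)}"
proof -
  obtain v where v: "\<forall>i<r. \<forall>j<r. dotp d (f z0 i) (v j) = (if i = j then 1 else 0)"
    using dual_vectors[OF assms(2)] by blast
  let ?D = "\<lambda>z. det (mat r r (\<lambda>(i, j). dotp d (f z i) (v j)))"
  have "polyfun ?D"
    unfolding dotp_def by (intro polyfun_det polyfun_sum polyfun_mult polyfun_const assms(1)) auto
  moreover have "?D z0 \<noteq> 0" using det_dual_vectors[OF v] by simp
  ultimately have "finite {z. ?D z = 0}" by (rule polyfun_finite_zeros)
  then show ?thesis
    by (rule finite_subset[rotated]) (use lin_indep_by_det in blast)
qed

text \<open>An element of \<open>C[u][z]\<close>: a polynomial in \<open>z\<close> with coefficients
  polynomial in \<open>u\<close> and a uniform bound on the degree in \<open>z\<close>.\<close>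

definition polyfam :: "(complex \<Rightarrow> complex poly) \<Rightarrow> bool" where
  "polyfam p \<longleftrightarrow> (\<forall>m. polyfun (\<lambda>u. coeff (p u) m)) \<and> (\<exists>N. \<forall>u. \<forall>m\<ge>N. coeff (p u) m = 0)"

text \<open>Euclid's algorithm on a family of pairs, eliminating one leading coefficient at a time: every
  step is valid outside the zeros of a leading coefficient.\<close>

lemma polyfam_gcd_aux:
  assumes "\<And>m. polyfun (\<lambda>u. coeff (p u) m)" "\<And>u m. m \<ge> a \<Longrightarrow> coeff (p u) m = 0"
    and "\<And>m. polyfun (\<lambda>u. coeff (q u) m)" "\<And>u m. m \<ge> b \<Longrightarrow> coeff (q u) m = 0"
  shows "\<exists>g B. polyfam g \<and> finite B \<and> (\<forall>u. u \<notin> B \<longrightarrow> (\<forall>h. h dvd g u \<longleftrightarrow> h dvd p u \<and> h dvd q u))"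
  using assms
proof (induction "a + b" arbitrary: a b p q rule: less_induct)
  case less
  \<comment> \<open>The bounds are strict, so \<open>b' = 0\<close> means that \<open>q'\<close>
    vanishes identically. By symmetry of the gcd it suffices to treat
    \<open>b' \<le> a'\<close>.\<close>
  have step: "\<exists>g B. polyfam g \<and> finite B \<and> (\<forall>u. u \<notin> B \<longrightarrow> (\<forall>h. h dvd g u \<longleftrightarrow> h dvd p' u \<and> h dvd q' u))"
    if p': "\<And>m. polyfun (\<lambda>u. coeff (p' u) m)" "\<And>u m. m \<ge> a' \<Longrightarrow> coeff (p' u) m = 0"
      and q': "\<And>m. polyfun (\<lambda>u. coeff (q' u) m)" "\<And>u m. m \<ge> b' \<Longrightarrow> coeff (q' u) m = 0"
      and ab: "a' + b' = a + b" "b' \<le> a'" for p' q' a' b'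
  proof (cases b')
    case 0
    then have "q' u = 0" for u using q'(2) by (intro poly_eqI) simp
    moreover have "polyfam p'" unfolding polyfam_def using p' by blast
    ultimately show ?thesis by (intro exI[of _ p'] exI[of _ "{}"]) simp
  next
    case (Suc b1)
    then obtain a1 where a1: "a' = Suc a1" using ab(2) by (cases a') auto
    have b1a1: "b1 \<le> a1" using ab(2) Suc a1 by simp
    show ?thesis
    proof (cases "\<forall>u. coeff (q' u) b1 = 0")
      case True
      have "coeff (q' u) m = 0" if "m \<ge> b1" for u m
        using True q'(2)[of m u] that Suc by (cases "m = b1") auto
      then show ?thesis using less.hyps[of a' b1 p' q'] p' q'(1) Suc ab(1) by auto
    next
      case False
      then obtain u0 where "coeff (q' u0) b1 \<noteq> 0" by blast
      then have finZ: "finite {u. coeff (q' u) b1 = 0}" by (rule polyfun_finite_zeros[OF q'(1)])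
      \<comment> \<open>A pseudo-division step: multiplying across by the two formal leading
        coefficients kills the coefficient at \<open>a1\<close> without a division, so the
        coefficients stay polynomial in \<open>u\<close>. The common divisors are unchanged where
        the factor \<open>coeff (q' u) b1\<close> is nonzero.\<close>
      define r where "r u = Polynomial.smult (coeff (q' u) b1) (p' u) -
          Polynomial.smult (coeff (p' u) a1) (monom 1 (a1 - b1) * q' u)" for u
      have cr: "coeff (r u) m = coeff (q' u) b1 * coeff (p' u) m -
          coeff (p' u) a1 * (if m < a1 - b1 then 0 else coeff (q' u) (m - (a1 - b1)))" for u m
        by (simp add: r_def coeff_monom_mult)
      have r1: "polyfun (\<lambda>u. coeff (r u) m)" for m
        unfolding cr by (cases "m < a1 - b1") (auto intro!: p'(1) q'(1))
      have r2: "coeff (r u) m = 0" if "m \<ge> a1" for u m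
      proof (cases "m = a1")
        case True
        then show ?thesis using b1a1 by (simp add: cr)
      next
        case False
        then have "m \<ge> a'" "m - (a1 - b1) \<ge> b'" using that a1 Suc b1a1 by auto
        then show ?thesis by (simp add: cr p'(2) q'(2))
      qed
      obtain g B where g: "polyfam g" "finite B"
        "\<And>u h. u \<notin> B \<Longrightarrow> h dvd g u \<longleftrightarrow> h dvd r u \<and> h dvd q' u"
        using less.hyps[of a1 b' r q'] r1 r2 q' ab(1) a1 by auto
      have "h dvd r u \<and> h dvd q' u \<longleftrightarrow> h dvd p' u \<and> h dvd q' u"
        if "coeff (q' u) b1 \<noteq> 0" for u h
      proof -
        have "h dvd r u \<longleftrightarrow> h dvd p' u" if "h dvd q' u"
        proof -
          have "h dvd Polynomial.smult (coeff (p' u) a1) (monom 1 (a1 - b1) * q' u)"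
            using that by (simp add: dvd_smult)
          then have "h dvd r u \<longleftrightarrow> h dvd Polynomial.smult (coeff (q' u) b1) (p' u)"
            unfolding r_def by (metis diff_add_cancel dvd_add dvd_diff)
          then show ?thesis using \<open>coeff (q' u) b1 \<noteq> 0\<close> by (simp add: dvd_smult_iff)
        qed
        then show ?thesis by blast
      qed
      then show ?thesis using g finZ
        by (intro exI[of _ g] exI[of _ "B \<union> {u. coeff (q' u) b1 = 0}"]) auto
    qed
  qed
  show ?case
  proof (cases "b \<le> a")
    case True
    then show ?thesis using step[of p a q b] less.prems by blast
  next
    case False
    then have "\<exists>g B. polyfam g \<and> finite B \<and> (\<forall>u. u \<notin> B \<longrightarrow> (\<forall>h. h dvd g u \<longleftrightarrow> h dvd q u \<and> h dvd p u))"
      using step[of q b p a] less.prems by (auto simp: add.commute)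
    then show ?thesis by (simp add: conj_commute)
  qed
qed

lemma polyfam_gcd:
  assumes "polyfam p" "polyfam q"
  shows "\<exists>g B. polyfam g \<and> finite B \<and> (\<forall>u. u \<notin> B \<longrightarrow> (\<forall>h. h dvd g u \<longleftrightarrow> h dvd p u \<and> h dvd q u))"
proof -
  obtain a b where "\<And>u m. m \<ge> a \<Longrightarrow> coeff (p u) m = 0" "\<And>u m. m \<ge> b \<Longrightarrow> coeff (q u) m = 0"
    using assms unfolding polyfam_def by metis
  then show ?thesis using polyfam_gcd_aux[of p a q b] assms unfolding polyfam_def by blast
qed

lemma polyfam_Gcd:
  assumes "finite I" "\<And>i. i \<in> I \<Longrightarrow> polyfam (H i)"
  shows "\<exists>g B. polyfam g \<and> finite B \<and> (\<forall>u. u \<notin> B \<longrightarrow> (\<forall>h. h dvd g u \<longleftrightarrow> (\<forall>i\<in>I. h dvd H i u)))"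
  using assms
proof (induction I rule: finite_induct)
  case empty
  have "polyfam (\<lambda>_. 0)" unfolding polyfam_def by auto
  then show ?case by (intro exI[of _ "\<lambda>_. 0"] exI[of _ "{}"]) simp
next
  case (insert i I)
  obtain g B where g: "polyfam g" "finite B"
    "\<And>u h. u \<notin> B \<Longrightarrow> h dvd g u \<longleftrightarrow> (\<forall>i\<in>I. h dvd H i u)"
    using insert.IH insert.prems by auto
  obtain g' B' where g': "polyfam g'" "finite B'"
    "\<And>u h. u \<notin> B' \<Longrightarrow> h dvd g' u \<longleftrightarrow> h dvd H i u \<and> h dvd g u"
    using polyfam_gcd[of "H i" g] insert.prems g(1) by (metis insertCI)
  show ?case by (intro exI[of _ g'] exI[of _ "B \<union> B'"]) (use g g' in auto)
qed

text \<open>The generic degree is the largest \<open>m\<close> for which the coefficient of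
  \<open>z^m\<close> is not identically zero in \<open>u\<close>.\<close>

lemma polyfam_generic_degree:
  assumes "polyfam p"
  shows "(\<forall>u. p u = 0) \<or> (\<exists>m B. finite B \<and> (\<forall>u. u \<notin> B \<longrightarrow> p u \<noteq> 0 \<and> degree (p u) = m))"
proof (cases "\<forall>u. p u = 0")
  case False
  then obtain u0 m0 where um0: "coeff (p u0) m0 \<noteq> 0" by (metis leading_coeff_0_iff)
  obtain N where N: "\<And>u m. m \<ge> N \<Longrightarrow> coeff (p u) m = 0" using assms unfolding polyfam_def by blast
  define S where "S = {m. \<exists>u. coeff (p u) m \<noteq> 0}"
  have SN: "m < N" if "m \<in> S" for m 
  proof (rule ccontr)
    assume "\<not> m < N"
    then have "coeff (p u) m = 0" for u using N[of m u] by simp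
    then show False using that unfolding S_def by simp
  qed
  have finS: "finite S" by (rule finite_subset[of _ "{..<N}"]) (use SN in auto)
  have "m0 \<in> S" using um0 unfolding S_def by blast
  define m where "m = Max S"
  have mS: "m \<in> S" unfolding m_def using finS \<open>m0 \<in> S\<close> by (intro Max_in) auto
  then obtain u1 where u1: "coeff (p u1) m \<noteq> 0" unfolding S_def by blast
  have "finite {u. coeff (p u) m = 0}"
    by (rule polyfun_finite_zeros[of "\<lambda>u. coeff (p u) m", OF _ u1]) (use assms polyfam_def in blast)
  moreover have "p u \<noteq> 0 \<and> degree (p u) = m" if "coeff (p u) m \<noteq> 0" for u
  proof -
    have "degree (p u) \<le> m"
    proof (rule degree_le, intro allI impI)
      fix i assume "m < i"
      then have "i \<notin> S" using finS unfolding m_def by (meson Max_ge leD)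
      then show "coeff (p u) i = 0" unfolding S_def by blast
    qed
    then show ?thesis using le_degree[OF that] that by auto
  qed
  ultimately show ?thesis
    by (intro disjI2 exI[of _ m] exI[of _ "{u. coeff (p u) m = 0}"] conjI allI impI) auto
qed simp

text \<open>Dividing \<open>p\<close> by its gcd with the derivative leaves a squarefree polynomial
  with the same roots. The polynomial \<open>d\<close> is characterised by its divisors only, so it
  is this gcd up to a unit.\<close>

lemma card_roots_gcd_pderiv:
  fixes p d :: "complex poly"
  assumes "p \<noteq> 0" and d: "\<And>h. h dvd d \<longleftrightarrow> h dvd p \<and> h dvd pderiv p"
  shows "card {z. poly p z = 0} = degree p - degree d"
proof (cases "pderiv p = 0")
  case True
  then obtain c where c: "p = [:c:]" using pderiv_iszero by blast
  then have "{z. poly p z = 0} = {}" using assms(1) by auto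
  then show ?thesis using c by simp
next
  case False
  have "d dvd p" "d dvd pderiv p" using d[of d] by auto
  then obtain q e where q: "p = q * d" and e: "pderiv p = e * d" by (metis dvd_def mult.commute)
  have "d \<noteq> 0" "q \<noteq> 0" using q assms(1) by auto
  have "d dvd gcd p (pderiv p)" "gcd p (pderiv p) dvd d" using d[of d] d[of "gcd p (pderiv p)"] by auto
  then obtain k where k: "d = k * gcd p (pderiv p)" by (metis dvd_def mult.commute)
  have "d = (k * fst (bezout_coefficients p (pderiv p))) * p + (k * snd (bezout_coefficients p (pderiv p))) * pderiv p"
    using bezout_coefficients_fst_snd[of p "pderiv p"] k
    by (metis distrib_left mult.assoc)
  then have "rsquarefree q \<and> (\<forall>a. poly q a = 0 \<longleftrightarrow> poly p a = 0)"
    by (rule poly_squarefree_decomp[OF False q e])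
  then have "card {z. poly p z = 0} = degree q"
    using rsquarefree_card_degree[OF \<open>q \<noteq> 0\<close>] by auto
  then show ?thesis using q \<open>d \<noteq> 0\<close> \<open>q \<noteq> 0\<close> by (simp add: degree_mult_eq)
qed

text \<open>The common roots are the roots of a gcd family \<open>g\<close>. Both \<open>g\<close>
  and its gcd with its derivative have a generic degree, and the difference of the two counts the
  distinct roots.\<close>

lemma polyfam_common_roots_generic:
  assumes "finite I" "\<And>i. i \<in> I \<Longrightarrow> polyfam (H i)"
  shows "\<exists>k B. finite B \<and> (\<forall>u. u \<notin> B \<longrightarrow> card {z. \<forall>i\<in>I. poly (H i u) z = 0} = k)"
proof -
  obtain g B where g: "polyfam g" "finite B"
    "\<And>u h. u \<notin> B \<Longrightarrow> h dvd g u \<longleftrightarrow> (\<forall>i\<in>I. h dvd H i u)"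
    using polyfam_Gcd[of I H] assms by blast
  have rt: "{z. \<forall>i\<in>I. poly (H i u) z = 0} = {z. poly (g u) z = 0}" if "u \<notin> B" for u
    using g(3)[OF that, of "[:-_, 1:]"] by (auto simp: poly_eq_0_iff_dvd)
  consider "\<forall>u. g u = 0" | m B' where "finite B'" "\<And>u. u \<notin> B' \<Longrightarrow> g u \<noteq> 0 \<and> degree (g u) = m"
    using polyfam_generic_degree[OF g(1)] by blast
  then show ?thesis
  proof cases
    case 1
    \<comment> \<open>Here every \<open>z\<close> is a common root; the set is infinite and its
      \<open>card\<close> is 0 by convention.\<close>
    then have "card {z. \<forall>i\<in>I. poly (H i u) z = 0} = 0" if "u \<notin> B" for u
      using rt[OF that] infinite_UNIV_char_0[where 'a=complex] by (simp add: 1)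
    then show ?thesis using g(2) by blast
  next
    case 2
    have "polyfam (\<lambda>u. pderiv (g u))"
    proof -
      obtain N where "\<And>u m. m \<ge> N \<Longrightarrow> coeff (g u) m = 0" using g(1) unfolding polyfam_def by blast
      then have "\<forall>u. \<forall>m\<ge>N. coeff (pderiv (g u)) m = 0" by (simp add: coeff_pderiv)
      moreover have "polyfun (\<lambda>u. coeff (pderiv (g u)) m)" for m
        unfolding coeff_pderiv using g(1) unfolding polyfam_def by (intro polyfun_mult polyfun_const) blast
      ultimately show ?thesis unfolding polyfam_def by blast
    qed
    then obtain d Bd where d: "polyfam d" "finite Bd"
      "\<And>u h. u \<notin> Bd \<Longrightarrow> h dvd d u \<longleftrightarrow> h dvd g u \<and> h dvd pderiv (g u)"
      using polyfam_gcd[OF g(1), of "\<lambda>u. pderiv (g u)"] by auto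
    have dn: "d u \<noteq> 0" if "u \<notin> Bd \<union> B'" for u
      using d(3)[of u "d u"] 2(2)[of u] that by auto
    have "\<not> (\<forall>u. d u = 0)"
      using dn d(2) 2(1) infinite_UNIV_char_0[where 'a=complex] by (metis ex_new_if_finite finite_UnI)
    then obtain m' B'' where m': "finite B''" "\<And>u. u \<notin> B'' \<Longrightarrow> degree (d u) = m'"
      using polyfam_generic_degree[OF d(1)] by blast
    have "card {z. \<forall>i\<in>I. poly (H i u) z = 0} = m - m'" if "u \<notin> B \<union> B' \<union> Bd \<union> B''" for u
    proof -
      have "card {z. poly (g u) z = 0} = degree (g u) - degree (d u)"
        by (rule card_roots_gcd_pderiv) (use 2(2)[of u] d(3)[of u] that in auto)
      then show ?thesis using rt[of u] 2(2)[of u] m'(2)[of u] that by simp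
    qed
    then show ?thesis using g(2) 2(1) d(2) m'(1) by (intro exI[of _ "m - m'"] exI[of _ "B \<union> B' \<union> Bd \<union> B''"]) auto
  qed
qed

text \<open>All \<open>2 \<times> 2\<close> minors of the values at \<open>z\<close> and at
  \<open>u\<close> vanish. For nonzero vectors this is equality of projective points, and this form
  is polynomial in both parameters.\<close>

definition para :: "'i set \<Rightarrow> ('i \<Rightarrow> complex poly) \<Rightarrow> complex \<Rightarrow> complex \<Rightarrow> bool" where
  "para I W u z \<longleftrightarrow> (\<forall>i\<in>I. \<forall>j\<in>I. poly (W i) z * poly (W j) u = poly (W j) z * poly (W i) u)"

lemma para_generic_card:
  assumes "finite I"
  shows "\<exists>k B. finite B \<and> (\<forall>u. u \<notin> B \<longrightarrow> card {z. para I W u z} = k)"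
proof -
  define H where "H ij u = Polynomial.smult (poly (W (snd ij)) u) (W (fst ij)) - Polynomial.smult (poly (W (fst ij)) u) (W (snd ij))" for ij u
  have "polyfam (H ij)" for ij
  proof -
    have "polyfun (\<lambda>u. coeff (H ij u) m)" for m
      unfolding H_def coeff_diff coeff_smult by (intro polyfun_diff polyfun_mult polyfun_const polyfun_poly)
    moreover have "coeff (H ij u) m = 0"
      if "m \<ge> Suc (max (degree (W (fst ij))) (degree (W (snd ij))))" for u m
      using that unfolding H_def by (simp add: coeff_eq_0)
    ultimately show ?thesis unfolding polyfam_def by blast
  qed
  then obtain k B where "finite B" "\<And>u. u \<notin> B \<Longrightarrow> card {z. \<forall>ij\<in>I \<times> I. poly (H ij u) z = 0} = k"
    using polyfam_common_roots_generic[of "I \<times> I" H] assms by blast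
  moreover have "{z. \<forall>ij\<in>I \<times> I. poly (H ij u) z = 0} = {z. para I W u z}" for u
    by (auto simp: H_def para_def mult.commute)
  ultimately show ?thesis by (intro exI[of _ k] exI[of _ B]) simp
qed

text \<open>If infinitely many values were proportional to \<open>c\<close>, all \<open>W i\<close>
  would be constant multiples of \<open>W j\<close>. As some \<open>W i0\<close> is not constant,
  \<open>W j\<close> is not constant either and has a root, at which all \<open>W i\<close> vanish,
  against \<open>nz\<close>.\<close>

lemma proportional_finite:
  assumes nz: "\<And>z. \<exists>i\<in>I. poly (W i) z \<noteq> 0" and i0: "i0 \<in> I" "degree (W i0) > 0"
    and c: "j \<in> I" "c j \<noteq> (0::complex)"
  shows "finite {z. \<forall>i\<in>I. \<forall>j\<in>I. poly (W i) z * c j = poly (W j) z * c i}" (is "finite ?S")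
proof (rule ccontr)
  assume inf: "infinite ?S"
  have eq: "Polynomial.smult (c j) (W i) = Polynomial.smult (c i) (W j)" if "i \<in> I" for i
  proof -
    let ?p = "Polynomial.smult (c j) (W i) - Polynomial.smult (c i) (W j)"
    have "?S \<subseteq> {z. poly ?p z = 0}" using that c(1) by (auto simp: mult.commute)
    then have "infinite {z. poly ?p z = 0}" using inf finite_subset by blast
    then have "?p = 0" using poly_roots_finite by blast
    then show ?thesis by simp
  qed
  have "degree (W i0) = degree (Polynomial.smult (c j) (W i0))" using c(2) by simp
  also have "\<dots> \<le> degree (W j)" unfolding eq[OF i0(1)] by (rule degree_smult_le)
  finally have "degree (W j) \<noteq> 0" using i0(2) by simp
  then have "\<not> constant (poly (W j))" by (simp add: constant_degree)
  then obtain z where z: "poly (W j) z = 0" using fundamental_theorem_of_algebra by blast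
  obtain i where i: "i \<in> I" "poly (W i) z \<noteq> 0" using nz by blast
  have "poly (Polynomial.smult (c j) (W i)) z = 0" using eq[OF i(1)] z by simp
  then show False using i(2) c(2) by simp
qed

section \<open>The plane case\<close>

definition indep2 :: "nat \<Rightarrow> (nat \<Rightarrow> 'a::comm_semiring_0) \<Rightarrow> (nat \<Rightarrow> 'a) \<Rightarrow> bool" where
  "indep2 d u v \<longleftrightarrow> (\<forall>a b. (\<forall>i<d. a * u i + b * v i = 0) \<longrightarrow> a = 0 \<and> b = 0)"

definition indep3 :: "nat \<Rightarrow> (nat \<Rightarrow> 'a::comm_semiring_0) \<Rightarrow> (nat \<Rightarrow> 'a) \<Rightarrow> (nat \<Rightarrow> 'a) \<Rightarrow> bool" where
  "indep3 d u v w \<longleftrightarrow> (\<forall>a b c. (\<forall>i<d. a * u i + b * v i + c * w i = 0) \<longrightarrow> a = 0 \<and> b = 0 \<and> c = 0)"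

definition indep4 ::
  "nat \<Rightarrow> (nat \<Rightarrow> 'a::comm_semiring_0) \<Rightarrow> (nat \<Rightarrow> 'a) \<Rightarrow> (nat \<Rightarrow> 'a) \<Rightarrow> (nat \<Rightarrow> 'a) \<Rightarrow> bool" where
  "indep4 d u v w s \<longleftrightarrow> (\<forall>a b c e. (\<forall>i<d. a * u i + b * v i + c * w i + e * s i = 0) \<longrightarrow>
     a = 0 \<and> b = 0 \<and> c = 0 \<and> e = 0)"

lemma indep3_lin_indep: "indep3 d u v w \<longleftrightarrow> lin_indep 3 d (\<lambda>j. [u, v, w] ! j)"
proof
  assume *: "indep3 d u v w"
  show "lin_indep 3 d (\<lambda>j. [u, v, w] ! j)"
    unfolding lin_indep_def
  proof (intro allI impI)
    fix c j assume "\<forall>i<d. (\<Sum>j<3. c j * ([u, v, w] ! j) i) = 0" "j < (3::nat)"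
    then show "c j = 0" using *[unfolded indep3_def, rule_format, of "c 0" "c 1" "c 2"]
      by (auto simp: numeral_3_eq_3 numeral_2_eq_2 less_Suc_eq)
  qed
next
  assume *: "lin_indep 3 d (\<lambda>j. [u, v, w] ! j)"
  show "indep3 d u v w"
    unfolding indep3_def
  proof (intro allI impI)
    fix a b c assume "\<forall>i<d. a * u i + b * v i + c * w i = 0"
    then have "[a, b, c] ! j = 0" if "j < 3" for j
      using that by (intro lin_indepD[OF *, of "\<lambda>j. [a, b, c] ! j"]) (auto simp: numeral_3_eq_3)
    from this[of 0] this[of 1] this[of 2] show "a = 0 \<and> b = 0 \<and> c = 0" by simp
  qed
qed

lemma indep4_lin_indep: "indep4 d u v w s \<longleftrightarrow> lin_indep 4 d (\<lambda>j. [u, v, w, s] ! j)"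
proof
  assume *: "indep4 d u v w s"
  show "lin_indep 4 d (\<lambda>j. [u, v, w, s] ! j)"
    unfolding lin_indep_def
  proof (intro allI impI)
    fix c j assume "\<forall>i<d. (\<Sum>j<4. c j * ([u, v, w, s] ! j) i) = 0" "j < (4::nat)"
    then show "c j = 0" using *[unfolded indep4_def, rule_format, of "c 0" "c 1" "c 2" "c 3"]
      by (auto simp: eval_nat_numeral less_Suc_eq)
  qed
next
  assume *: "lin_indep 4 d (\<lambda>j. [u, v, w, s] ! j)"
  show "indep4 d u v w s"
    unfolding indep4_def
  proof (intro allI impI)
    fix a b c e assume "\<forall>i<d. a * u i + b * v i + c * w i + e * s i = 0"
    then have "[a, b, c, e] ! j = 0" if "j < 4" for j
      using that by (intro lin_indepD[OF *, of "\<lambda>j. [a, b, c, e] ! j"]) (auto simp: eval_nat_numeral)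
    from this[of 0] this[of 1] this[of 2] this[of 3] show "a = 0 \<and> b = 0 \<and> c = 0 \<and> e = 0" by simp
  qed
qed

definition evp :: "(nat \<Rightarrow> 'a::comm_semiring_0 poly) \<Rightarrow> 'a \<Rightarrow> nat \<Rightarrow> 'a" where
  "evp P z i = poly (P i) z"

text \<open>When \<open>m\<close> is the formal degree of \<open>P\<close>, this is the value of
  \<open>P\<close> at the parameter at infinity.\<close>

definition cfp :: "(nat \<Rightarrow> 'a::comm_semiring_0 poly) \<Rightarrow> nat \<Rightarrow> nat \<Rightarrow> 'a" where
  "cfp P m i = coeff (P i) m"

definition pdot :: "nat \<Rightarrow> (nat \<Rightarrow> 'a::comm_semiring_0 poly) \<Rightarrow> (nat \<Rightarrow> 'a) \<Rightarrow> 'a poly" where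
  "pdot d P x = (\<Sum>i<d. Polynomial.smult (x i) (P i))"

lemma poly_pdot: "poly (pdot d P x) z = dotp d (evp P z) x"
  by (simp add: pdot_def dotp_def evp_def poly_sum mult.commute)

lemma coeff_pdot: "coeff (pdot d P x) m = dotp d (cfp P m) x"
  by (simp add: pdot_def dotp_def cfp_def coeff_sum mult.commute)

text \<open>The polynomial \<open>R\<close> of the overview. By the Cauchy-Binet formula it is the
  pairing of \<open>P \<and> Q\<close> with \<open>x \<and> y\<close>, so it depends on the planes
  through their Pluecker coordinates only.\<close>

definition line_res :: "nat \<Rightarrow> (nat \<Rightarrow> complex poly) \<Rightarrow> (nat \<Rightarrow> complex poly) \<Rightarrow>
    (nat \<Rightarrow> complex) \<Rightarrow> (nat \<Rightarrow> complex) \<Rightarrow> complex poly" where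
  "line_res d P Q x y = pdot d P x * pdot d Q y - pdot d P y * pdot d Q x"

text \<open>Only the inclusion of the span at \<open>z\<close> in the span at \<open>u\<close> is
  required; where both pairs are independent, the two planes have dimension two and are
  equal.\<close>

definition same_plane :: "nat \<Rightarrow> (nat \<Rightarrow> complex poly) \<Rightarrow> (nat \<Rightarrow> complex poly) \<Rightarrow> complex \<Rightarrow> complex \<Rightarrow> bool" where
  "same_plane d P Q u z \<longleftrightarrow> (\<exists>a b a' b'. \<forall>i<d. evp P z i = a * evp P u i + b * evp Q u i \<and>
     evp Q z i = a' * evp P u i + b' * evp Q u i)"

text \<open>\<open>x\<close>, \<open>y\<close> span a line that meets the hypersurface transversally, away from the parameters in
  \<open>B\<close>, and on which parameters that are not related by \<open>E\<close> give different points.\<close>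

definition good_line :: "nat \<Rightarrow> (nat \<Rightarrow> complex poly) \<Rightarrow> (nat \<Rightarrow> complex poly) \<Rightarrow> nat \<Rightarrow>
    complex set \<Rightarrow> (complex \<Rightarrow> complex \<Rightarrow> bool) \<Rightarrow> (nat \<Rightarrow> complex) \<Rightarrow> (nat \<Rightarrow> complex) \<Rightarrow> bool" where
  "good_line d P Q n B E x y \<longleftrightarrow>
     coeff (line_res d P Q x y) n \<noteq> 0 \<and>
     (\<forall>z. poly (line_res d P Q x y) z = 0 \<longrightarrow> poly (pderiv (line_res d P Q x y)) z \<noteq> 0) \<and>
     (\<forall>b\<in>B. poly (line_res d P Q x y) b \<noteq> 0) \<and>
     (\<forall>z z' a b. poly (line_res d P Q x y) z = 0 \<longrightarrow> poly (line_res d P Q x y) z' = 0 \<longrightarrow>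
        (a \<noteq> 0 \<or> b \<noteq> 0) \<longrightarrow>
        (\<forall>w\<in>{z, z'}. a * poly (pdot d P x) w + b * poly (pdot d P y) w = 0 \<and>
                     a * poly (pdot d Q x) w + b * poly (pdot d Q y) w = 0) \<longrightarrow> E z z')"

section \<open>Cross products in dimension three\<close>

lemma less3: "(\<forall>i<3. A i) \<longleftrightarrow> A 0 \<and> A 1 \<and> A (2::nat)"
  by (auto simp: eval_nat_numeral less_Suc_eq)

lemma sum3: "(\<Sum>i<3. f i) = f 0 + f 1 + f (2::nat)"
  by (simp add: eval_nat_numeral)

definition cross :: "(nat \<Rightarrow> 'a::comm_ring) \<Rightarrow> (nat \<Rightarrow> 'a) \<Rightarrow> nat \<Rightarrow> 'a" where
  "cross p q i = (if i = 0 then p 1 * q 2 - p 2 * q 1 else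
                  if i = 1 then p 2 * q 0 - p 0 * q 2 else p 0 * q 1 - p 1 * q 0)"

lemma cross_simps:
  "cross p q 0 = p 1 * q 2 - p 2 * q 1"
  "cross p q 1 = p 2 * q 0 - p 0 * q 2"
  "cross p q (Suc 0) = p 2 * q 0 - p 0 * q 2"
  "cross p q 2 = p 0 * q 1 - p 1 * q 0"
  by (simp_all add: cross_def)

lemma cross_nonzero:
  fixes p q :: "nat \<Rightarrow> 'a::field"
  assumes "indep2 3 p q"
  shows "\<exists>i<3. cross p q i \<noteq> 0"
proof (rule ccontr)
  assume "\<not> ?thesis"
  then have c: "p 1 * q 2 = p 2 * q 1" "p 2 * q 0 = p 0 * q 2" "p 0 * q 1 = p 1 * q 0"
    using less3[of "\<lambda>i. cross p q i = 0"] by (auto simp: cross_simps)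
  have "q j = 0 \<and> - p j = 0" if "j < 3" for j
  proof -
    have "\<forall>i<3. q j * p i + (- p j) * q i = 0"
      using that c by (auto simp: eval_nat_numeral less_Suc_eq mult.commute)
    then show ?thesis using assms unfolding indep2_def by blast
  qed
  then have "\<forall>i<3. 1 * p i + 0 * q i = 0" by simp
  then have "(1::'a) = 0" using assms unfolding indep2_def by blast
  then show False by simp
qed

text \<open>Cramer's rule with the nonzero coordinate \<open>g\<close> of the cross product as
  denominator. Scalars instead of vectors allow the three cyclic permutations of the coordinates to
  be treated as instances.\<close>

lemma span_cross_aux:
  fixes p0 :: "'a::field"
  assumes o: "w0 * (p1 * q2 - p2 * q1) + w1 * (p2 * q0 - p0 * q2) + w2 * (p0 * q1 - p1 * q0) = 0"
    and g: "g = p1 * q2 - p2 * q1" "g \<noteq> 0"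
  shows "w0 = (w1 * q2 - w2 * q1) / g * p0 + (p1 * w2 - p2 * w1) / g * q0"
    "w1 = (w1 * q2 - w2 * q1) / g * p1 + (p1 * w2 - p2 * w1) / g * q1"
    "w2 = (w1 * q2 - w2 * q1) / g * p2 + (p1 * w2 - p2 * w1) / g * q2"
proof -
  have "w0 * g - ((w1 * q2 - w2 * q1) * p0 + (p1 * w2 - p2 * w1) * q0) = 0"
    unfolding o[symmetric] g(1) by (simp add: algebra_simps)
  then have "w0 * g = (w1 * q2 - w2 * q1) * p0 + (p1 * w2 - p2 * w1) * q0" by simp
  moreover have "w1 * g = (w1 * q2 - w2 * q1) * p1 + (p1 * w2 - p2 * w1) * q1"
    "w2 * g = (w1 * q2 - w2 * q1) * p2 + (p1 * w2 - p2 * w1) * q2"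
    unfolding g(1) by (simp_all add: algebra_simps)
  moreover have "u = a / g * p + b / g * q" if "u * g = a * p + b * q" for u a b p q
  proof -
    have "u = (a * p + b * q) / g" unfolding that[symmetric] using g(2) by simp
    then show ?thesis by (simp add: add_divide_distrib)
  qed
  ultimately show "w0 = (w1 * q2 - w2 * q1) / g * p0 + (p1 * w2 - p2 * w1) / g * q0"
    "w1 = (w1 * q2 - w2 * q1) / g * p1 + (p1 * w2 - p2 * w1) / g * q1"
    "w2 = (w1 * q2 - w2 * q1) / g * p2 + (p1 * w2 - p2 * w1) / g * q2" by blast+
qed

lemma span_cross:
  fixes p q w :: "nat \<Rightarrow> 'a::field"
  assumes "\<exists>i<3. cross p q i \<noteq> 0" and o: "dotp 3 w (cross p q) = 0"
  shows "\<exists>a b. \<forall>i<3. w i = a * p i + b * q i"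
proof -
  have o': "w 0 * (p 1 * q 2 - p 2 * q 1) + w 1 * (p 2 * q 0 - p 0 * q 2) + w 2 * (p 0 * q 1 - p 1 * q 0) = 0"
    using o by (simp add: dotp_def sum3 cross_simps)
  then have o'': "w 1 * (p 2 * q 0 - p 0 * q 2) + w 2 * (p 0 * q 1 - p 1 * q 0) + w 0 * (p 1 * q 2 - p 2 * q 1) = 0"
    "w 2 * (p 0 * q 1 - p 1 * q 0) + w 0 * (p 1 * q 2 - p 2 * q 1) + w 1 * (p 2 * q 0 - p 0 * q 2) = 0"
    by (simp_all add: add.commute add.left_commute)
  consider "cross p q 0 \<noteq> 0" | "cross p q 1 \<noteq> 0" | "cross p q 2 \<noteq> 0"
    using assms(1) less3[of "\<lambda>i. cross p q i = 0"] by auto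
  then show ?thesis
  proof cases
    case 1
    show ?thesis unfolding less3
      using span_cross_aux[OF o' cross_simps(1)[of p q] 1] by blast
  next
    case 2
    show ?thesis unfolding less3
      using span_cross_aux[OF o''(1) cross_simps(2)[of p q] 2] by blast
  next
    case 3
    show ?thesis unfolding less3
      using span_cross_aux[OF o''(2) cross_simps(4)[of p q] 3] by blast
  qed
qed

lemma coeff_mult_degree_le:
  fixes p q :: "'a::comm_semiring_0 poly"
  assumes "degree p \<le> m" "degree q \<le> n"
  shows "coeff (p * q) (m + n) = coeff p m * coeff q n"
proof -
  have "coeff (p * q) (m + n) = (\<Sum>i\<le>m + n. if i = m then coeff p m * coeff q n else 0)"
    unfolding coeff_mult
  proof (rule sum.cong[OF refl])
    fix i assume "i \<in> {..m + n}"
    show "coeff p i * coeff q (m + n - i) = (if i = m then coeff p m * coeff q n else 0)"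
    proof (cases i m rule: linorder_cases)
      case less
      then have "coeff q (m + n - i) = 0" using assms(2) by (intro coeff_eq_0) simp
      then show ?thesis using less by simp
    next
      case greater
      then have "coeff p i = 0" using assms(1) by (intro coeff_eq_0) simp
      then show ?thesis using greater by simp
    qed simp
  qed
  then show ?thesis by simp
qed

lemma cross_orthogonal: "dotp 3 p (cross p q) = 0" "dotp 3 q (cross p q) = 0"
  for p q :: "nat \<Rightarrow> 'a::comm_ring"
  by (simp_all add: dotp_def sum3 cross_simps algebra_simps)

lemma proportional_to_cross:
  fixes p q v :: "nat \<Rightarrow> 'a::field"
  assumes "dotp 3 p v = 0" "dotp 3 q v = 0" "i < 3" "j < 3"
  shows "v i * cross p q j = v j * cross p q i"
proof -
  have *: "p 0 * v 0 + p 1 * v 1 + p 2 * v 2 = 0" "q 0 * v 0 + q 1 * v 1 + q 2 * v 2 = 0"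
    using assms by (simp_all add: dotp_def sum3)
  have "v 0 * cross p q 1 - v 1 * cross p q 0 =
      p 2 * (q 0 * v 0 + q 1 * v 1 + q 2 * v 2) - q 2 * (p 0 * v 0 + p 1 * v 1 + p 2 * v 2)"
    "v 0 * cross p q 2 - v 2 * cross p q 0 =
      q 1 * (p 0 * v 0 + p 1 * v 1 + p 2 * v 2) - p 1 * (q 0 * v 0 + q 1 * v 1 + q 2 * v 2)"
    "v 1 * cross p q 2 - v 2 * cross p q 1 =
      p 0 * (q 0 * v 0 + q 1 * v 1 + q 2 * v 2) - q 0 * (p 0 * v 0 + p 1 * v 1 + p 2 * v 2)"
    unfolding cross_simps by (simp_all add: algebra_simps)
  then have "v 0 * cross p q 1 = v 1 * cross p q 0" "v 0 * cross p q 2 = v 2 * cross p q 0"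
    "v 1 * cross p q 2 = v 2 * cross p q 1"
    unfolding * by simp_all
  then show ?thesis using assms(3,4) by (auto simp: eval_nat_numeral less_Suc_eq)
qed

lemma proportional_trans:
  fixes f g v :: "nat \<Rightarrow> 'a::field"
  assumes "\<exists>i<d. v i \<noteq> 0" and "\<And>i j. i < d \<Longrightarrow> j < d \<Longrightarrow> v i * f j = v j * f i"
    and "\<And>i j. i < d \<Longrightarrow> j < d \<Longrightarrow> v i * g j = v j * g i" and "i < d" "j < d"
  shows "f i * g j = f j * g i"
proof -
  obtain l where l: "l < d" "v l \<noteq> 0" using assms(1) by blast
  have f: "f k = v k * f l / v l" and g: "g k = v k * g l / v l" if "k < d" for k
    using assms(2,3)[of l k] l that by (simp_all add: field_simps)
  show ?thesis using f[OF assms(4)] f[OF assms(5)] g[OF assms(4)] g[OF assms(5)] by simp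
qed

text \<open>In dimension three a plane is determined by its normal direction, and the cross product
  is this normal.\<close>

lemma cross_para_same_plane:
  fixes P Q :: "nat \<Rightarrow> complex poly"
  assumes ind: "\<And>z. indep2 3 (evp P z) (evp Q z)"
  shows "para {..<3} (cross P Q) u z \<longleftrightarrow> same_plane 3 P Q u z"
proof -
  have ev: "poly (cross P Q i) z = cross (evp P z) (evp Q z) i" for i z
    by (simp add: cross_def evp_def)
  show ?thesis
  proof
    assume p: "para {..<3} (cross P Q) u z"
    then have pr: "cross (evp P z) (evp Q z) i * cross (evp P u) (evp Q u) j =
        cross (evp P z) (evp Q z) j * cross (evp P u) (evp Q u) i" if "i < 3" "j < 3" for i j
      using that unfolding para_def ev by blast
    obtain l where l: "l < 3" "cross (evp P z) (evp Q z) l \<noteq> 0" using cross_nonzero[OF ind] by blast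
    define c where "c = cross (evp P u) (evp Q u) l / cross (evp P z) (evp Q z) l"
    have eq: "cross (evp P u) (evp Q u) i = c * cross (evp P z) (evp Q z) i" if "i < 3" for i
      using pr[OF that l(1)] l(2) unfolding c_def by (simp add: field_simps)
    have o: "dotp 3 w (cross (evp P u) (evp Q u)) = 0" if "dotp 3 w (cross (evp P z) (evp Q z)) = 0" for w
    proof -
      have "dotp 3 w (cross (evp P u) (evp Q u)) = c * dotp 3 w (cross (evp P z) (evp Q z))"
        unfolding dotp_def sum_distrib_left by (rule sum.cong) (auto simp: eq)
      then show ?thesis using that by simp
    qed
    obtain a b where ab: "\<forall>i<3. evp P z i = a * evp P u i + b * evp Q u i"
      using span_cross[OF cross_nonzero[OF ind] o[OF cross_orthogonal(1)]] by blast
    obtain a' b' where ab': "\<forall>i<3. evp Q z i = a' * evp P u i + b' * evp Q u i"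
      using span_cross[OF cross_nonzero[OF ind] o[OF cross_orthogonal(2)]] by blast
    show "same_plane 3 P Q u z" unfolding same_plane_def using ab ab' by blast
  next
    assume "same_plane 3 P Q u z"
    then obtain a b a' b' where s: "\<forall>i<3. evp P z i = a * evp P u i + b * evp Q u i"
      "\<forall>i<3. evp Q z i = a' * evp P u i + b' * evp Q u i" unfolding same_plane_def by blast
    have "cross (evp P z) (evp Q z) i = (a * b' - a' * b) * cross (evp P u) (evp Q u) i" for i
      using s unfolding less3 by (auto simp: cross_def algebra_simps)
    then show "para {..<3} (cross P Q) u z" unfolding para_def ev by (simp add: mult_ac)
  qed
qed

text \<open>The ruling at \<open>z\<close> is the single point \<open>\<gamma> z\<close> of the
  plane, so the hypersurface is the curve \<open>\<gamma>\<close>, and the line with normal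
  \<open>\<alpha>\<close> meets it at the roots of the pairing of \<open>\<gamma>\<close> with
  \<open>\<alpha>\<close>. It remains to choose \<open>\<alpha>\<close> such that the roots are
  simple and lie outside a finite set, and to see that outside this set equal curve points are
  related by \<open>E\<close>.\<close>

lemma good_line_3:
  fixes P Q :: "nat \<Rightarrow> complex poly"
  assumes ind: "\<And>z. indep2 3 (evp P z) (evp Q z)"
    and deg: "\<And>i. degree (P i) \<le> m1" "\<And>i. degree (Q i) \<le> m2"
    and inf: "indep2 3 (cfp P m1) (cfp Q m2)" and n: "m1 + m2 > 0"
    and E: "finite B0" "\<And>z. z \<notin> B0 \<Longrightarrow> card {z'. E z z'} = k" "\<And>z z'. E z z' \<Longrightarrow> same_plane 3 P Q z z'"
    and T: "infinite T" "\<And>z z'. z \<in> T \<Longrightarrow> same_plane 3 P Q z z' \<Longrightarrow> E z z'"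
    and B: "finite B"
  shows "\<exists>x y. good_line 3 P Q (m1 + m2) B E x y"
proof -
  let ?n = "m1 + m2" and ?I = "{..<3::nat}"
  define \<gamma> where "\<gamma> = cross P Q"
  have ev: "evp \<gamma> z = cross (evp P z) (evp Q z)" for z
    by (rule ext) (simp add: evp_def \<gamma>_def cross_def)
  have cm: "coeff (P i * Q j) ?n = coeff (P i) m1 * coeff (Q j) m2" for i j
    using deg(1)[of i] deg(2)[of j] by (rule coeff_mult_degree_le)
  have cf: "cfp \<gamma> ?n = cross (cfp P m1) (cfp Q m2)"
    by (rule ext) (simp add: cfp_def \<gamma>_def cross_def cm)
  have nz: "\<exists>i\<in>?I. poly (\<gamma> i) z \<noteq> 0" for z
    using cross_nonzero[OF ind[of z]] ev[of z] by (metis evp_def lessThan_iff)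
  obtain i0 where i0: "i0 < 3" "cfp \<gamma> ?n i0 \<noteq> 0" using cross_nonzero[OF inf] cf by metis
  have degi0: "degree (\<gamma> i0) > 0" using i0(2) n le_degree[of "\<gamma> i0" ?n] unfolding cfp_def by linarith
  have paraE: "para ?I \<gamma> u z \<longleftrightarrow> same_plane 3 P Q u z" for u z
    unfolding \<gamma>_def by (rule cross_para_same_plane[OF ind])
  have parafin: "finite {z. para ?I \<gamma> u z}" for u
  proof -
    obtain j where "j \<in> ?I" "poly (\<gamma> j) u \<noteq> 0" using nz by blast
    then show ?thesis unfolding para_def
      using proportional_finite[of ?I \<gamma> i0 j "\<lambda>j. poly (\<gamma> j) u"] nz i0(1) degi0 by simp
  qed
  obtain k' B1 where B1: "finite B1" "\<And>u. u \<notin> B1 \<Longrightarrow> card {z. para ?I \<gamma> u z} = k'"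
    using para_generic_card[of ?I \<gamma>] by auto
  \<comment> \<open>The count of the overview: the class of \<open>z\<close> for \<open>E\<close> is
    contained in its class for proportionality of \<open>\<gamma>\<close>, both are finite, and a
    parameter of \<open>T\<close> shows that the generic sizes \<open>k\<close> and
    \<open>k'\<close> are the same number.\<close>
  have EE: "E z z'" if "z \<notin> B0 \<union> B1" "para ?I \<gamma> z z'" for z z'
  proof -
    have "k = k'"
    proof -
      have "infinite (T - (B0 \<union> B1))" using T(1) E(1) B1(1) by simp
      then obtain t where t: "t \<in> T" "t \<notin> B0" "t \<notin> B1"
        by (metis Diff_iff Un_iff ex_in_conv finite.emptyI)
      then have "{z'. E t z'} = {z'. para ?I \<gamma> t z'}" using E(3) T(2) paraE by blast
      then show ?thesis using E(2)[OF t(2)] B1(2)[OF t(3)] by simp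
    qed
    then have "card {z'. E z z'} = card {z'. para ?I \<gamma> z z'}" using E(2) B1(2) that(1) by simp
    moreover have "{z'. E z z'} \<subseteq> {z'. para ?I \<gamma> z z'}" using E(3) paraE by blast
    ultimately have "{z'. E z z'} = {z'. para ?I \<gamma> z z'}" using parafin card_subset_eq by blast
    then show ?thesis using that(2) by blast
  qed
  define BB where "BB = B \<union> B0 \<union> B1"
  have finBB: "finite BB" using B E(1) B1(1) unfolding BB_def by simp
  have nzev: "\<exists>i<3. evp \<gamma> z i \<noteq> 0" for z using nz[of z] unfolding evp_def by auto
  \<comment> \<open>The first condition keeps the full degree \<open>n\<close>, the second allows
    the division by \<open>\<alpha> 2\<close> in the parametrization of the line, and the others
    keep the exceptional parameters off the line.\<close>
  have "\<exists>e. \<forall>h\<in>insert (cfp \<gamma> ?n) (insert (\<lambda>i. if i = 2 then 1 else 0) (evp \<gamma> ` BB)). dotp 3 h e \<noteq> 0"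
    by (rule avoid_countable_hyperplanes)
      (use finBB i0 nzev in \<open>auto intro: countable_finite exI[of _ "2::nat"]\<close>)
  then obtain \<alpha>1 where a1: "dotp 3 (cfp \<gamma> ?n) \<alpha>1 \<noteq> 0" "\<alpha>1 2 \<noteq> 0" "\<And>b. b \<in> BB \<Longrightarrow> dotp 3 (evp \<gamma> b) \<alpha>1 \<noteq> 0"
    by (auto simp: dotp_def sum3)
  define f where "f = pdot 3 \<gamma> \<alpha>1"
  have fn: "coeff f ?n \<noteq> 0" unfolding f_def coeff_pdot by (rule a1(1))
  then have f0: "f \<noteq> 0" and degf: "degree f > 0" using le_degree[OF fn] n by auto
  have "\<exists>e. \<forall>h\<in>evp \<gamma> ` {z. poly f z = 0}. dotp 3 h e \<noteq> 0"
    by (rule avoid_countable_hyperplanes)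
      (use poly_roots_finite[OF f0] nzev in \<open>auto intro: countable_finite\<close>)
  then obtain \<alpha>2 where a2: "\<And>z. poly f z = 0 \<Longrightarrow> dotp 3 (evp \<gamma> z) \<alpha>2 \<noteq> 0" by auto
  define g where "g = pdot 3 \<gamma> \<alpha>2"
  have fg: "poly g z \<noteq> 0" if "poly f z = 0" for z using a2[OF that] unfolding g_def poly_pdot .
  \<comment> \<open>The Wronskian of the pencil \<open>f + c * g\<close>: a double root of a member
    of the pencil is a root of \<open>W\<close>. As there are finitely many such roots, and
    \<open>f\<close> and \<open>g\<close> have no common root, almost every \<open>c\<close> gives
    simple roots only.\<close>
  define W where "W = pderiv f * g - f * pderiv g"
  \<comment> \<open>At a root of \<open>f\<close>, the order of \<open>pderiv f * g\<close> is one
    less than the order of \<open>f\<close>, whereas the order of \<open>f * pderiv g\<close> is at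
    least that of \<open>f\<close>.\<close>
  have W0: "W \<noteq> 0"
  proof
    assume "W = 0"
    then have eq: "pderiv f * g = f * pderiv g" unfolding W_def by simp
    have "pderiv f \<noteq> 0" using degf by (simp add: pderiv_eq_0_iff)
    obtain z where z: "poly f z = 0"
      using degf fundamental_theorem_of_algebra[of f] by (auto simp: constant_degree)
    have "g \<noteq> 0" using fg[OF z] by auto
    have "f * pderiv g \<noteq> 0" using eq \<open>pderiv f \<noteq> 0\<close> \<open>g \<noteq> 0\<close> by (metis mult_eq_0_iff)
    have "order z (pderiv f * g) = order z (pderiv f)"
      using \<open>pderiv f \<noteq> 0\<close> \<open>g \<noteq> 0\<close> fg[OF z] by (simp add: order_mult order_0I)
    moreover have "order z (f * pderiv g) = order z f + order z (pderiv g)"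
      by (rule order_mult[OF \<open>f * pderiv g \<noteq> 0\<close>])
    moreover have "order z f = Suc (order z (pderiv f))"
      using order_pderiv[of f z] z f0 \<open>pderiv f \<noteq> 0\<close> order_root[of f z] by auto
    ultimately show False using eq by simp
  qed
  have "\<exists>c. \<forall>(a, b)\<in>insert (coeff f ?n, coeff g ?n) (insert (\<alpha>1 2, \<alpha>2 2)
      ((\<lambda>z. (poly f z, poly g z)) ` (BB \<union> {z. poly W z = 0}))). a + c * b \<noteq> 0"
  proof (rule avoid_countable_lines)
    show "countable (insert (coeff f ?n, coeff g ?n) (insert (\<alpha>1 2, \<alpha>2 2)
      ((\<lambda>z. (poly f z, poly g z)) ` (BB \<union> {z. poly W z = 0}))))"
      using finBB poly_roots_finite[OF W0] by (auto intro: countable_finite)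
  qed (use fn a1(2) fg in auto)
  then obtain c where c: "coeff f ?n + c * coeff g ?n \<noteq> 0" "\<alpha>1 2 + c * \<alpha>2 2 \<noteq> 0"
    "\<And>z. z \<in> BB \<Longrightarrow> poly f z + c * poly g z \<noteq> 0" "\<And>z. poly W z = 0 \<Longrightarrow> poly f z + c * poly g z \<noteq> 0"
    by auto
  define \<alpha> where "\<alpha> i = \<alpha>1 i + c * \<alpha>2 i" for i
  have an: "\<alpha> 2 \<noteq> 0" using c(2) unfolding \<alpha>_def .
  \<comment> \<open>These vectors span the line with normal \<open>\<alpha>\<close> and are scaled
    such that their cross product is \<open>\<alpha>\<close> itself; hence \<open>line_res\<close>
    is exactly \<open>h\<close>.\<close>
  define x where "x i = (if i = 0 then 1 else if i = 1 then 0 else - \<alpha> 0 / \<alpha> 2)" for i :: nat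
  define y where "y i = (if i = 0 then 0 else if i = 1 then \<alpha> 2 else - \<alpha> 1)" for i :: nat
  define h where "h = f + Polynomial.smult c g"
  have res: "line_res 3 P Q x y = h"
  proof -
    have "poly (line_res 3 P Q x y) z = poly h z" for z
    proof -
      define p q where "p = evp P z" and "q = evp Q z"
      define r where "r = \<alpha> 0 / \<alpha> 2"
      have r: "\<alpha> 0 = r * \<alpha> 2" using an by (simp add: r_def)
      have "poly h z = (p 1 * q 2 - p 2 * q 1) * \<alpha> 0 + (p 2 * q 0 - p 0 * q 2) * \<alpha> 1 + (p 0 * q 1 - p 1 * q 0) * \<alpha> 2"
        unfolding h_def f_def g_def poly_add poly_smult poly_pdot ev dotp_def sum3 cross_simps p_def q_def \<alpha>_def
        by (simp add: algebra_simps)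
      moreover have "poly (line_res 3 P Q x y) z =
          (p 0 - r * p 2) * (\<alpha> 2 * q 1 - \<alpha> 1 * q 2) - (\<alpha> 2 * p 1 - \<alpha> 1 * p 2) * (q 0 - r * q 2)"
        unfolding line_res_def poly_diff poly_mult poly_pdot dotp_def sum3 x_def y_def p_def q_def r_def
        by (simp add: mult.commute)
      moreover have "(p 0 - r * p 2) * (\<alpha> 2 * q 1 - \<alpha> 1 * q 2) - (\<alpha> 2 * p 1 - \<alpha> 1 * p 2) * (q 0 - r * q 2) =
          (p 1 * q 2 - p 2 * q 1) * \<alpha> 0 + (p 2 * q 0 - p 0 * q 2) * \<alpha> 1 + (p 0 * q 1 - p 1 * q 0) * \<alpha> 2"
        unfolding r by (simp add: algebra_simps)
      ultimately show ?thesis by simp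
    qed
    then show ?thesis using poly_eq_poly_eq_iff by blast
  qed
  have hz: "poly h z = poly f z + c * poly g z" for z by (simp add: h_def)
  have "good_line 3 P Q ?n B E x y"
    unfolding good_line_def res
  proof (intro conjI allI impI ballI)
    show "coeff h ?n \<noteq> 0" using c(1) by (simp add: h_def)
    show "poly (pderiv h) z \<noteq> 0" if "poly h z = 0" for z
    proof
      assume "poly (pderiv h) z = 0"
      then have 1: "poly (pderiv f) z + c * poly (pderiv g) z = 0"
        by (simp add: h_def pderiv_add pderiv_smult)
      have 2: "poly f z + c * poly g z = 0" using that hz by simp
      have "poly W z = poly (pderiv f) z * poly g z - poly f z * poly (pderiv g) z" by (simp add: W_def)
      also have "\<dots> = (poly (pderiv f) z + c * poly (pderiv g) z) * poly g z - (poly f z + c * poly g z) * poly (pderiv g) z"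
        by (simp add: algebra_simps)
      also have "\<dots> = 0" unfolding 1 2 by simp
      finally show False using c(4) 2 by blast
    qed
    show "poly h b \<noteq> 0" if "b \<in> B" for b using c(3)[of b] that hz unfolding BB_def by simp
    fix z z' a b
    assume z: "poly h z = 0" "poly h z' = 0" and ab: "a \<noteq> 0 \<or> b \<noteq> 0"
      and w: "\<forall>w\<in>{z, z'}. a * poly (pdot 3 P x) w + b * poly (pdot 3 P y) w = 0 \<and>
                 a * poly (pdot 3 Q x) w + b * poly (pdot 3 Q y) w = 0"
    \<comment> \<open>The common point of the line with the rulings at \<open>z\<close> and
      \<open>z'\<close>. Being orthogonal to both planes, it is proportional to
      \<open>\<gamma> z\<close> and to \<open>\<gamma> z'\<close>.\<close>
    define v where "v i = a * x i + b * y i" for i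
    have v: "\<exists>i<3. v i \<noteq> 0"
    proof (cases "a = 0")
      case True
      then have "v 1 \<noteq> 0" using ab an by (simp add: v_def x_def y_def)
      then show ?thesis by (intro exI[of _ 1]) simp
    next
      case False
      then have "v 0 \<noteq> 0" by (simp add: v_def x_def y_def)
      then show ?thesis by (intro exI[of _ 0]) simp
    qed
    have o: "dotp 3 (evp P w) v = 0" "dotp 3 (evp Q w) v = 0" if "w \<in> {z, z'}" for w
      using w that unfolding v_def dotp_lincomb_right poly_pdot by blast+
    have pc: "v i * evp \<gamma> w j = v j * evp \<gamma> w i" if "w \<in> {z, z'}" "i < 3" "j < 3" for w i j
      unfolding ev by (rule proportional_to_cross) (use o that in auto)
    have "para ?I \<gamma> z z'"
      unfolding para_def
    proof (intro ballI)
      fix i j assume "i \<in> ?I" "j \<in> ?I"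
      then have "evp \<gamma> z' i * evp \<gamma> z j = evp \<gamma> z' j * evp \<gamma> z i"
        by (intro proportional_trans[OF v, of "evp \<gamma> z'" "evp \<gamma> z"] pc) simp_all
      then show "poly (\<gamma> i) z' * poly (\<gamma> j) z = poly (\<gamma> j) z' * poly (\<gamma> i) z" unfolding evp_def .
    qed
    moreover have "z \<notin> B0 \<union> B1" using c(3)[of z] z(1) hz unfolding BB_def by auto
    ultimately show "E z z'" by (rule EE[rotated])
  qed
  then show ?thesis by blast
qed

section \<open>Projection to the plane\<close>

lemma indep3_by_functional:
  fixes u :: "nat \<Rightarrow> 'a::field"
  assumes "indep2 d u v" "dotp d u h = 0" "dotp d v h = 0" "dotp d w h \<noteq> 0"
  shows "indep3 d u v w"
  unfolding indep3_def
proof (intro allI impI)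
  fix a b c assume *: "\<forall>i<d. a * u i + b * v i + c * w i = 0"
  have "0 = (\<Sum>i<d. (a * u i + b * v i + c * w i) * h i)" using * by simp
  also have "\<dots> = a * dotp d u h + b * dotp d v h + c * dotp d w h"
    unfolding dotp_def sum_distrib_left sum.distrib[symmetric] by (simp add: algebra_simps)
  finally have c: "c = 0" using assms by simp
  then have "\<forall>i<d. a * u i + b * v i = 0" using * by simp
  then show "a = 0 \<and> b = 0 \<and> c = 0" using c assms(1) unfolding indep2_def by blast
qed

lemma indep4_by_functional:
  fixes u :: "nat \<Rightarrow> 'a::field"
  assumes "indep3 d u v w" "dotp d u h = 0" "dotp d v h = 0" "dotp d w h = 0" "dotp d s h \<noteq> 0"
  shows "indep4 d u v w s"
  unfolding indep4_def
proof (intro allI impI)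
  fix a b c e assume *: "\<forall>i<d. a * u i + b * v i + c * w i + e * s i = 0"
  have "0 = (\<Sum>i<d. (a * u i + b * v i + c * w i + e * s i) * h i)" using * by simp
  also have "\<dots> = a * dotp d u h + b * dotp d v h + c * dotp d w h + e * dotp d s h"
    unfolding dotp_def sum_distrib_left sum.distrib[symmetric] by (simp add: algebra_simps)
  finally have e: "e = 0" using assms by simp
  then have "\<forall>i<d. a * u i + b * v i + c * w i = 0" using * by simp
  then show "a = 0 \<and> b = 0 \<and> c = 0 \<and> e = 0" using e assms(1) unfolding indep3_def by blast
qed

lemma annihilator2:
  fixes u v :: "nat \<Rightarrow> 'a::field"
  assumes "2 < d"
  shows "\<exists>h. (\<exists>i<d. h i \<noteq> 0) \<and> dotp d u h = 0 \<and> dotp d v h = 0"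
proof -
  have "2 < d \<or> (2 = d \<and> \<not> lin_indep 2 d (\<lambda>j. [u, v] ! j))" using assms by auto
  then obtain h where h: "\<exists>i<d. h i \<noteq> 0" "\<And>j. j < 2 \<Longrightarrow> dotp d ([u, v] ! j) h = 0"
    using annihilator_less[of 2 d "\<lambda>j. [u, v] ! j"] by blast
  show ?thesis using h(1) h(2)[of 0] h(2)[of 1] by (intro exI[of _ h]) simp
qed

lemma annihilator3:
  fixes u v w :: "nat \<Rightarrow> 'a::field"
  assumes "3 < d"
  shows "\<exists>h. (\<exists>i<d. h i \<noteq> 0) \<and> dotp d u h = 0 \<and> dotp d v h = 0 \<and> dotp d w h = 0"
proof -
  have "3 < d \<or> (3 = d \<and> \<not> lin_indep 3 d (\<lambda>j. [u, v, w] ! j))" using assms by auto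
  then obtain h where h: "\<exists>i<d. h i \<noteq> 0" "\<And>j. j < 3 \<Longrightarrow> dotp d ([u, v, w] ! j) h = 0"
    using annihilator_less[of 3 d "\<lambda>j. [u, v, w] ! j"] by blast
  show ?thesis using h(1) h(2)[of 0] h(2)[of 1] h(2)[of 2] by (intro exI[of _ h]) simp
qed

lemma annihilator4:
  fixes u v w s :: "nat \<Rightarrow> 'a::field"
  assumes "4 < d \<or> (d = 4 \<and> \<not> indep4 d u v w s)"
  shows "\<exists>h. (\<exists>i<d. h i \<noteq> 0) \<and> dotp d u h = 0 \<and> dotp d v h = 0 \<and> dotp d w h = 0 \<and> dotp d s h = 0"
proof -
  have "4 < d \<or> (4 = d \<and> \<not> lin_indep 4 d (\<lambda>j. [u, v, w, s] ! j))" using assms unfolding indep4_lin_indep by auto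
  then obtain h where h: "\<exists>i<d. h i \<noteq> 0" "\<And>j. j < 4 \<Longrightarrow> dotp d ([u, v, w, s] ! j) h = 0"
    using annihilator_less[of 4 d "\<lambda>j. [u, v, w, s] ! j"] by blast
  show ?thesis using h(1) h(2)[of 0] h(2)[of 1] h(2)[of 2] h(2)[of 3] by (intro exI[of _ h]) simp
qed

text \<open>The last coordinate \<open>- dotp m e x\<close> makes the extension of \<open>x\<close>
  orthogonal to the centre with last coordinate 1. Pairing \<open>R\<close> with it equals pairing
  the projection of \<open>R\<close> with \<open>x\<close>, so the polynomials of the line are
  literally the same above and below.\<close>

lemma good_line_project:
  fixes P Q :: "nat \<Rightarrow> complex poly"
  assumes P': "\<And>i. i < m \<Longrightarrow> P' i = P i - Polynomial.smult (e i) (P m)"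
    and Q': "\<And>i. i < m \<Longrightarrow> Q' i = Q i - Polynomial.smult (e i) (Q m)"
    and good: "good_line m P' Q' n B E x' y'"
  shows "\<exists>x y. good_line (Suc m) P Q n B E x y"
proof -
  define ext where "ext x i = (if i < m then x i else - dotp m e x)" for x :: "nat \<Rightarrow> complex" and i
  have "pdot (Suc m) R (ext x) = pdot m R' x"
    if "\<And>i. i < m \<Longrightarrow> R' i = R i - Polynomial.smult (e i) (R m)" for R R' x
  proof -
    have "pdot m R' x = (\<Sum>i<m. Polynomial.smult (x i) (R i)) - (\<Sum>i<m. Polynomial.smult (e i * x i) (R m))"
      unfolding pdot_def sum_subtractf[symmetric]
      by (rule sum.cong) (auto simp: that smult_diff_right mult.commute)
    also have "(\<Sum>i<m. Polynomial.smult (e i * x i) (R m)) = Polynomial.smult (dotp m e x) (R m)"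
      unfolding dotp_def by (rule smult_sum[symmetric])
    finally show ?thesis by (simp add: pdot_def ext_def)
  qed
  from this[of P' P] this[of Q' Q] have "good_line (Suc m) P Q n B E (ext x') (ext y')"
    using good P' Q' unfolding good_line_def line_res_def by simp
  then show ?thesis by blast
qed

text \<open>The map has kernel spanned by \<open>e\<close>, and a relation between the images lifts
  to a relation that involves \<open>e\<close>.\<close>

lemma projection_indep2:
  fixes u v e :: "nat \<Rightarrow> 'a::comm_ring_1"
  assumes e: "e m = 1" and ind: "indep3 (Suc m) u v e"
  shows "indep2 m (\<lambda>i. u i - e i * u m) (\<lambda>i. v i - e i * v m)"
  unfolding indep2_def
proof (intro allI impI)
  fix a b assume *: "\<forall>i<m. a * (u i - e i * u m) + b * (v i - e i * v m) = 0"
  have "a * u i + b * v i + (- (a * u m + b * v m)) * e i = 0" if "i < Suc m" for i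
  proof (cases "i = m")
    case True
    then show ?thesis using e by simp
  next
    case False
    then show ?thesis using *[rule_format, of i] that by (simp add: algebra_simps)
  qed
  then show "a = 0 \<and> b = 0" using ind unfolding indep3_def by blast
qed

lemma projection_same_plane:
  assumes "\<And>z i. i < m \<Longrightarrow> evp P' z i = evp P z i - e i * evp P z m"
    and "\<And>z i. i < m \<Longrightarrow> evp Q' z i = evp Q z i - e i * evp Q z m"
    and "same_plane (Suc m) P Q z z'"
  shows "same_plane m P' Q' z z'"
proof -
  obtain a b a' b' where *: "\<forall>i<Suc m. evp P z' i = a * evp P z i + b * evp Q z i \<and>
      evp Q z' i = a' * evp P z i + b' * evp Q z i" using assms(3) unfolding same_plane_def by blast
  have "evp P' z' i = a * evp P' z i + b * evp Q' z i \<and> evp Q' z' i = a' * evp P' z i + b' * evp Q' z i"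
    if "i < m" for i
    using *[rule_format, of i] *[rule_format, of m] that unfolding assms(1,2)[OF that] by (simp add: algebra_simps)
  then show ?thesis unfolding same_plane_def by blast
qed

text \<open>A coincidence of the projected planes lifts up to multiples \<open>\<kappa>\<close>,
  \<open>\<kappa>'\<close> of the centre; whether these vanish is decided by the users of the
  lemma.\<close>

lemma projection_same_planeD:
  assumes e: "e m = 1" and P': "\<And>z i. i < m \<Longrightarrow> evp P' z i = evp P z i - e i * evp P z m"
    and Q': "\<And>z i. i < m \<Longrightarrow> evp Q' z i = evp Q z i - e i * evp Q z m"
    and "same_plane m P' Q' z z'"
  obtains a b \<kappa> a' b' \<kappa>' where "\<And>i. i < Suc m \<Longrightarrow> evp P z' i = a * evp P z i + b * evp Q z i + \<kappa> * e i"
    "\<And>i. i < Suc m \<Longrightarrow> evp Q z' i = a' * evp P z i + b' * evp Q z i + \<kappa>' * e i"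
proof -
  obtain a b a' b' where *: "\<And>i. i < m \<Longrightarrow> evp P' z' i = a * evp P' z i + b * evp Q' z i"
    "\<And>i. i < m \<Longrightarrow> evp Q' z' i = a' * evp P' z i + b' * evp Q' z i" using assms(4) unfolding same_plane_def by blast
  have 1: "evp P z' i = a * evp P z i + b * evp Q z i + (evp P z' m - a * evp P z m - b * evp Q z m) * e i"
    if "i < Suc m" for i
  proof (cases "i = m")
    case False
    then show ?thesis using *(1)[of i] P'[of i] Q'[of i] that by (simp add: algebra_simps)
  qed (use e in simp)
  have 2: "evp Q z' i = a' * evp P z i + b' * evp Q z i + (evp Q z' m - a' * evp P z m - b' * evp Q z m) * e i"
    if "i < Suc m" for i
  proof (cases "i = m")
    case False
    then show ?thesis using *(2)[of i] P'[of i] Q'[of i] that by (simp add: algebra_simps)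
  qed (use e in simp)
  show ?thesis using that[OF 1 2] .
qed

text \<open>Projection from a point \<open>e\<close>. A generic \<open>e\<close> avoids the one-parameter family of planes; the planes
  at two parameters \<open>z \<in> T\<close> and \<open>z'\<close> get the same image only if they span a three-dimensional space
  through \<open>e\<close>, and there are only countably many such spaces to avoid.\<close>

lemma projection_centre_exists:
  fixes P Q :: "nat \<Rightarrow> complex poly"
  assumes d: "d = Suc m" "3 \<le> m"
    and ind: "\<And>z. indep2 d (evp P z) (evp Q z)"
    and S: "countable S" "\<And>z z'. (z, z') \<in> S \<Longrightarrow> 4 < d \<or> \<not> indep4 d (evp P z) (evp Q z) (evp P z') (evp Q z')"
    and inf: "indep2 d p q"
  shows "\<exists>e. e m = 1 \<and> (\<forall>z. indep3 d (evp P z) (evp Q z) e) \<and> indep3 d p q e \<and>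
    (\<forall>(z, z')\<in>S. \<exists>h. dotp d (evp P z) h = 0 \<and> dotp d (evp Q z) h = 0 \<and>
       dotp d (evp P z') h = 0 \<and> dotp d (evp Q z') h = 0 \<and> dotp d e h \<noteq> 0)"
proof -
  have d4: "4 \<le> d" using d by simp
  have "\<forall>zz\<in>S. \<exists>h. (\<exists>i<d. h i \<noteq> 0) \<and> dotp d (evp P (fst zz)) h = 0 \<and> dotp d (evp Q (fst zz)) h = 0 \<and>
      dotp d (evp P (snd zz)) h = 0 \<and> dotp d (evp Q (snd zz)) h = 0"
  proof
    fix zz assume "zz \<in> S"
    then have "4 < d \<or> (d = 4 \<and> \<not> indep4 d (evp P (fst zz)) (evp Q (fst zz)) (evp P (snd zz)) (evp Q (snd zz)))"
      using S(2)[of "fst zz" "snd zz"] d4 by auto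
    then show "\<exists>h. (\<exists>i<d. h i \<noteq> 0) \<and> dotp d (evp P (fst zz)) h = 0 \<and> dotp d (evp Q (fst zz)) h = 0 \<and>
      dotp d (evp P (snd zz)) h = 0 \<and> dotp d (evp Q (snd zz)) h = 0"
      by (rule annihilator4)
  qed
  then obtain H where H: "\<forall>zz\<in>S. (\<exists>i<d. H zz i \<noteq> 0) \<and>
      dotp d (evp P (fst zz)) (H zz) = 0 \<and> dotp d (evp Q (fst zz)) (H zz) = 0 \<and>
      dotp d (evp P (snd zz)) (H zz) = 0 \<and> dotp d (evp Q (snd zz)) (H zz) = 0"
    by metis
  have "\<forall>z. \<exists>h. (\<exists>i<d. h i \<noteq> 0) \<and> dotp d (evp P z) h = 0 \<and> dotp d (evp Q z) h = 0"
    using annihilator2[of d] d4 by auto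
  then obtain K where K: "\<And>z. \<exists>i<d. K z i \<noteq> 0"
    "\<And>z. dotp d (evp P z) (K z) = 0" "\<And>z. dotp d (evp Q z) (K z) = 0" by metis
  obtain hinf where hinf: "\<exists>i<d. hinf i \<noteq> 0" "dotp d p hinf = 0" "dotp d q hinf = 0"
    using annihilator2[of d p q] d4 by auto
  define \<delta> where "\<delta> i = (if i = m then 1 else 0 :: complex)" for i
  have \<delta>: "dotp d \<delta> e = e m" for e
    unfolding dotp_def \<delta>_def d(1) by (simp add: if_distrib[of "\<lambda>x. x * _"] cong: if_cong)
  \<comment> \<open>The condition at all \<open>z\<close> is not a countable one, so the centre is
    sought on a line of candidates. The vector \<open>a\<close> may fail at finitely many
    parameters; \<open>b\<close> is chosen independent of \<open>a\<close> modulo the plane outside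
    the finite set \<open>?E\<close>. There every \<open>a + c * b\<close> works, and the remaining
    conditions are countable in number.\<close>
  have "\<exists>a. \<forall>h\<in>insert \<delta> (insert (K 0) (H ` S)). dotp d h a \<noteq> 0"
  proof (rule avoid_countable_hyperplanes)
    show "countable (insert \<delta> (insert (K 0) (H ` S)))" using S(1) by simp
    have "\<exists>i<d. \<delta> i \<noteq> 0" unfolding \<delta>_def d(1) by (intro exI[of _ m]) simp
    then show "\<exists>i<d. h i \<noteq> 0" if "h \<in> insert \<delta> (insert (K 0) (H ` S))" for h
      using that K(1) H by auto
  qed
  then obtain a where a: "dotp d \<delta> a \<noteq> 0" "dotp d (K 0) a \<noteq> 0" "\<And>zz. zz \<in> S \<Longrightarrow> dotp d (H zz) a \<noteq> 0"
    by auto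
  have a3: "indep3 d (evp P 0) (evp Q 0) a"
    by (rule indep3_by_functional[of _ _ _ "K 0"]) (use ind K a(2) in \<open>auto simp: dotp_commute\<close>)
  have finEa: "finite {z. \<not> indep3 d (evp P z) (evp Q z) a}"
    unfolding indep3_lin_indep
    by (rule lin_dep_finite[of _ _ _ 0])
      (use a3 in \<open>auto simp: indep3_lin_indep evp_def eval_nat_numeral less_Suc_eq\<close>)
  obtain h3 where h3: "\<exists>i<d. h3 i \<noteq> 0" "dotp d (evp P 0) h3 = 0" "dotp d (evp Q 0) h3 = 0" "dotp d a h3 = 0"
    using annihilator3[of d "evp P 0" "evp Q 0" a] d4 by auto
  have "\<exists>b. \<forall>h\<in>insert hinf (insert h3 (K ` {z. \<not> indep3 d (evp P z) (evp Q z) a})). dotp d h b \<noteq> 0"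
    by (rule avoid_countable_hyperplanes) (use finEa hinf h3 K(1) in \<open>auto intro: countable_finite\<close>)
  then obtain b where b: "dotp d hinf b \<noteq> 0" "dotp d h3 b \<noteq> 0"
    "\<And>z. \<not> indep3 d (evp P z) (evp Q z) a \<Longrightarrow> dotp d (K z) b \<noteq> 0" by auto
  have b4: "indep4 d (evp P 0) (evp Q 0) a b"
    by (rule indep4_by_functional[of _ _ _ _ h3]) (use a3 h3 b(2) in \<open>auto simp: dotp_commute\<close>)
  let ?E = "{z. \<not> indep4 d (evp P z) (evp Q z) a b}"
  have finE: "finite ?E"
    unfolding indep4_lin_indep
    by (rule lin_dep_finite[of _ _ _ 0])
      (use b4 in \<open>auto simp: indep4_lin_indep evp_def eval_nat_numeral less_Suc_eq\<close>)
  have "\<forall>z. \<exists>h. dotp d (evp P z) h = 0 \<and> dotp d (evp Q z) h = 0 \<and> (dotp d h a \<noteq> 0 \<or> dotp d h b \<noteq> 0)"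
  proof
    fix z
    show "\<exists>h. dotp d (evp P z) h = 0 \<and> dotp d (evp Q z) h = 0 \<and> (dotp d h a \<noteq> 0 \<or> dotp d h b \<noteq> 0)"
    proof (cases "indep3 d (evp P z) (evp Q z) a")
      case True
      then obtain v where v: "\<forall>i<3. \<forall>j<3. dotp d ([evp P z, evp Q z, a] ! i) (v j) = (if i = j then 1 else 0)"
        using dual_vectors unfolding indep3_lin_indep by blast
      have "dotp d (evp P z) (v 2) = 0" "dotp d (evp Q z) (v 2) = 0" "dotp d a (v 2) = 1"
        using v[rule_format, of 0 2] v[rule_format, of 1 2] v[rule_format, of 2 2] by simp_all
      then show ?thesis by (intro exI[of _ "v 2"]) (simp add: dotp_commute[of d a])
    next
      case False
      then show ?thesis using K b(3) by blast
    qed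
  qed
  \<comment> \<open>A functional \<open>G z\<close> vanishes on the plane at \<open>z\<close> but
    not on both \<open>a\<close> and \<open>b\<close>; so only one value of \<open>c\<close> can put
    \<open>a + c * b\<close> on its zero set.\<close>
  then obtain G where G: "\<And>z. dotp d (evp P z) (G z) = 0" "\<And>z. dotp d (evp Q z) (G z) = 0"
    "\<And>z. dotp d (G z) a \<noteq> 0 \<or> dotp d (G z) b \<noteq> 0" by metis
  let ?U = "insert \<delta> (insert hinf (H ` S \<union> G ` ?E))"
  have "\<exists>c. \<forall>(x, y)\<in>(\<lambda>h. (dotp d h a, dotp d h b)) ` ?U. x + c * y \<noteq> 0"
  proof (rule avoid_countable_lines)
    show "countable ((\<lambda>h. (dotp d h a, dotp d h b)) ` ?U)"
      using S(1) finE by (intro countable_image countable_insert countable_Un) (auto intro: countable_finite)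
  qed (use a b G in auto)
  then obtain c where c: "\<And>h. h \<in> ?U \<Longrightarrow> dotp d h a + c * dotp d h b \<noteq> 0" by auto
  define e0 where "e0 i = 1 * a i + c * b i" for i
  have e0: "dotp d h e0 = dotp d h a + c * dotp d h b" for h
    unfolding e0_def dotp_lincomb_right by simp
  have em: "e0 m \<noteq> 0" using c[of \<delta>] e0[of \<delta>] \<delta> by simp
  have i3: "indep3 d (evp P z) (evp Q z) e0" for z
  proof (cases "z \<in> ?E")
    case True
    then show ?thesis using c[of "G z"] e0[of "G z"] ind G(1,2)
      by (intro indep3_by_functional[of _ _ _ "G z"]) (auto simp: dotp_commute[of d e0])
  next
    case False
    then have i4: "indep4 d (evp P z) (evp Q z) a b" by simp
    show ?thesis unfolding indep3_def
    proof (intro allI impI)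
      fix x y w assume "\<forall>i<d. x * evp P z i + y * evp Q z i + w * e0 i = 0"
      then have "\<forall>i<d. x * evp P z i + y * evp Q z i + w * a i + (w * c) * b i = 0"
        by (simp add: e0_def algebra_simps)
      then show "x = 0 \<and> y = 0 \<and> w = 0" using i4 unfolding indep4_def by blast
    qed
  qed
  have i3inf: "indep3 d p q e0"
    by (rule indep3_by_functional[of _ _ _ hinf])
      (use inf hinf c[of hinf] e0[of hinf] in \<open>auto simp: dotp_commute[of d e0]\<close>)
  define e where "e i = e0 i / e0 m" for i
  have scale: "indep3 d u v e" if "indep3 d u v e0" for u v
    unfolding indep3_def
  proof (intro allI impI)
    fix x y w assume "\<forall>i<d. x * u i + y * v i + w * e i = 0"
    then have "\<forall>i<d. x * u i + y * v i + (w / e0 m) * e0 i = 0" by (simp add: e_def)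
    then have "x = 0 \<and> y = 0 \<and> w / e0 m = 0" using that unfolding indep3_def by blast
    then show "x = 0 \<and> y = 0 \<and> w = 0" using em by simp
  qed
  have "dotp d e h = dotp d h e0 / e0 m" for h
    unfolding dotp_def e_def sum_divide_distrib by (simp add: mult.commute)
  then have he: "dotp d e (H zz) \<noteq> 0" if "zz \<in> S" for zz
    using c[of "H zz"] e0[of "H zz"] that em by simp
  show ?thesis
  proof (intro exI[of _ e] conjI allI)
    show "e m = 1" using em by (simp add: e_def)
    show "indep3 d (evp P z) (evp Q z) e" for z by (rule scale[OF i3])
    show "indep3 d p q e" by (rule scale[OF i3inf])
    show "\<forall>(z, z')\<in>S. \<exists>h. dotp d (evp P z) h = 0 \<and> dotp d (evp Q z) h = 0 \<and>
       dotp d (evp P z') h = 0 \<and> dotp d (evp Q z') h = 0 \<and> dotp d e h \<noteq> 0"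
      using H he by (auto intro!: exI[of _ "H _"])
  qed
qed

text \<open>Induction on the dimension through projections; the line found below is lifted.
  Coincidence implies \<open>E\<close> only for parameters in \<open>T\<close>, which the plane case
  turns into a generic statement. The plane at \<open>t0\<close>, complementary to all planes of
  \<open>T\<close>, makes the set of planes that meet a given plane of \<open>T\<close>
  finite.\<close>

lemma good_line_exists:
  fixes P Q :: "nat \<Rightarrow> complex poly"
  assumes "3 \<le> d"
    and "\<And>z. indep2 d (evp P z) (evp Q z)"
    and "\<And>i. degree (P i) \<le> m1" "\<And>i. degree (Q i) \<le> m2"
    and "indep2 d (cfp P m1) (cfp Q m2)" and n: "m1 + m2 > 0"
    and E: "finite B0" "\<And>z. z \<notin> B0 \<Longrightarrow> card {z'. E z z'} = k" and "\<And>z z'. E z z' \<Longrightarrow> same_plane d P Q z z'"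
    and T: "infinite T" "countable T" and "\<And>z z'. z \<in> T \<Longrightarrow> same_plane d P Q z z' \<Longrightarrow> E z z'"
    and "\<And>z. 4 \<le> d \<Longrightarrow> z \<in> T \<Longrightarrow> indep4 d (evp P z) (evp Q z) (evp P t0) (evp Q t0)"
    and B: "finite B"
  shows "\<exists>x y. good_line d P Q (m1 + m2) B E x y"
  using assms(1-5,9,12,13)
proof (induction d arbitrary: P Q rule: dec_induct)
  case base
  show ?case
  proof -
    show "\<exists>x y. good_line 3 P Q (m1 + m2) B E x y"
      using good_line_3[of P Q m1 m2 B0 E k T B] base E T(1) n B by blast
  qed
next
  case (step m)
  note ind = step.prems(1) and deg = step.prems(2,3) and inf = step.prems(4)
    and Esame = step.prems(5) and TE = step.prems(6)
  have T4: "indep4 (Suc m) (evp P z) (evp Q z) (evp P t0) (evp Q t0)" if "z \<in> T" for z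
    using step.prems(7) that step.hyps by simp
  have m3: "3 \<le> m" by (rule step.hyps)
  let ?d = "Suc m"
  \<comment> \<open>Parameters whose plane meets the plane at \<open>z\<close>, or coincides with
    it.\<close>
  define F where "F z = {z'. \<not> indep4 ?d (evp P z) (evp Q z) (evp P z') (evp Q z')}" for z
  have finF: "finite (F z)" if "z \<in> T" for z
    unfolding F_def indep4_lin_indep
    by (rule lin_dep_finite[of _ _ _ t0])
      (use T4[OF that] in \<open>auto simp: indep4_lin_indep evp_def eval_nat_numeral less_Suc_eq\<close>)
  \<comment> \<open>For \<open>d > 4\<close> the centre also avoids the four-dimensional spaces
    spanned at \<open>z\<close> and \<open>t0\<close>, so that these planes stay complementary
    below. For \<open>d = 4\<close> such a space is everything, and in dimension three nothing of
    the kind is required.\<close>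
  define S where "S = (SIGMA z:T. F z) \<union> (if 4 < ?d then T \<times> {t0} else {})"
  have "countable (Sigma T F)"
    by (rule countable_SIGMA) (use T(2) finF countable_finite in blast)+
  then have cS: "countable S"
    unfolding S_def using T(2) by simp
  have S4: "4 < ?d \<or> \<not> indep4 ?d (evp P z) (evp Q z) (evp P z') (evp Q z')" if "(z, z') \<in> S" for z z'
    using that unfolding S_def F_def by (cases "4 < ?d") auto
  obtain e where e: "e m = 1" "\<And>z. indep3 ?d (evp P z) (evp Q z) e" "indep3 ?d (cfp P m1) (cfp Q m2) e"
    and e4: "\<forall>(z, z')\<in>S. \<exists>h. dotp ?d (evp P z) h = 0 \<and> dotp ?d (evp Q z) h = 0 \<and>
       dotp ?d (evp P z') h = 0 \<and> dotp ?d (evp Q z') h = 0 \<and> dotp ?d e h \<noteq> 0"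
    using projection_centre_exists[OF refl m3 ind cS S4 inf] by blast
  have e5: "\<exists>h. dotp ?d (evp P z) h = 0 \<and> dotp ?d (evp Q z) h = 0 \<and>
       dotp ?d (evp P z') h = 0 \<and> dotp ?d (evp Q z') h = 0 \<and> dotp ?d e h \<noteq> 0" if "(z, z') \<in> S" for z z'
    using bspec[OF e4 that] by simp
  define P' where "P' i = P i - Polynomial.smult (e i) (P m)" for i
  define Q' where "Q' i = Q i - Polynomial.smult (e i) (Q m)" for i
  have evP': "evp P' z i = evp P z i - e i * evp P z m" and evQ': "evp Q' z i = evp Q z i - e i * evp Q z m" for z i
    by (simp_all add: evp_def P'_def Q'_def)
  have cfP': "cfp P' k i = cfp P k i - e i * cfp P k m" and cfQ': "cfp Q' k i = cfp Q k i - e i * cfp Q k m" for k i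
    by (simp_all add: cfp_def P'_def Q'_def)
  note ind2 = projection_indep2[of e m, OF e(1)]
  have "\<exists>x y. good_line m P' Q' (m1 + m2) B E x y"
  proof (rule step.IH)
    show "indep2 m (evp P' z) (evp Q' z)" for z
      using ind2[OF e(2)[of z]] unfolding evP'[abs_def] evQ'[abs_def] .
    show "degree (P' i) \<le> m1" "degree (Q' i) \<le> m2" for i
      unfolding P'_def Q'_def using deg(1)[of i] deg(1)[of m] deg(2)[of i] deg(2)[of m]
      by (auto intro!: degree_diff_le order.trans[OF degree_smult_le])
    show "indep2 m (cfp P' m1) (cfp Q' m2)"
      using ind2[OF e(3)] unfolding cfP'[abs_def] cfQ'[abs_def] .
    show "same_plane m P' Q' z z'" if "E z z'" for z z'
      using projection_same_plane[of m P' P e Q' Q z z'] evP' evQ' Esame[OF that] by blast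
    show "E z z'" if zT: "z \<in> T" and same: "same_plane m P' Q' z z'" for z z'
    proof -
      obtain a b \<kappa> a' b' \<kappa>' where
        1: "\<And>i. i < ?d \<Longrightarrow> evp P z' i = a * evp P z i + b * evp Q z i + \<kappa> * e i" and
        2: "\<And>i. i < ?d \<Longrightarrow> evp Q z' i = a' * evp P z i + b' * evp Q z i + \<kappa>' * e i"
        using projection_same_planeD[of e m P' P Q' Q z z'] e(1) evP' evQ' same by metis
      \<comment> \<open>Eliminating \<open>e\<close> from the two equations shows that the planes at
        \<open>z\<close> and \<open>z'\<close> meet, so the pair is in \<open>S\<close>. The
        functional that vanishes on both planes but not at \<open>e\<close> then kills
        \<open>\<kappa>\<close> and \<open>\<kappa>'\<close>.\<close>
      have "\<kappa> = 0 \<and> \<kappa>' = 0"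
      proof (rule ccontr)
        assume nz: "\<not> ?thesis"
        have "\<not> indep4 ?d (evp P z) (evp Q z) (evp P z') (evp Q z')"
        proof
          assume i4: "indep4 ?d (evp P z) (evp Q z) (evp P z') (evp Q z')"
          have "\<forall>i<?d. (\<kappa> * a' - \<kappa>' * a) * evp P z i + (\<kappa> * b' - \<kappa>' * b) * evp Q z i +
              \<kappa>' * evp P z' i + (- \<kappa>) * evp Q z' i = 0"
            using 1 2 by (simp add: algebra_simps)
          then have "\<kappa>' = 0 \<and> - \<kappa> = 0" using i4 unfolding indep4_def by blast
          then show False using nz by simp
        qed
        then have "(z, z') \<in> S" using zT by (simp add: S_def F_def)
        then obtain h where h: "dotp ?d (evp P z) h = 0" "dotp ?d (evp Q z) h = 0"
          "dotp ?d (evp P z') h = 0" "dotp ?d (evp Q z') h = 0" "dotp ?d e h \<noteq> 0" using e5 by blast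
        have lin: "dotp ?d w h = r * dotp ?d u h + s * dotp ?d v h + t * dotp ?d e h"
          if "\<And>i. i < ?d \<Longrightarrow> w i = r * u i + s * v i + t * e i" for w u v r s t
          unfolding dotp_def sum_distrib_left sum.distrib[symmetric]
          by (rule sum.cong) (auto simp: that algebra_simps)
        show False using lin[OF 1] lin[OF 2] h nz by auto
      qed
      then have "same_plane ?d P Q z z'" unfolding same_plane_def using 1 2 by auto
      then show ?thesis by (rule TE[OF zT])
    qed
    show "indep4 m (evp P' z) (evp Q' z) (evp P' t0) (evp Q' t0)" if "4 \<le> m" "z \<in> T" for z
      unfolding indep4_def
    proof (intro allI impI)
      fix a b c f
      assume *: "\<forall>i<m. a * evp P' z i + b * evp Q' z i + c * evp P' t0 i + f * evp Q' t0 i = 0"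
      define \<kappa> where "\<kappa> = a * evp P z m + b * evp Q z m + c * evp P t0 m + f * evp Q t0 m"
      have 1: "a * evp P z i + b * evp Q z i + c * evp P t0 i + f * evp Q t0 i = \<kappa> * e i" if "i < ?d" for i
      proof (cases "i = m")
        case True
        then show ?thesis using e(1) by (simp add: \<kappa>_def)
      next
        case False
        then show ?thesis using *[rule_format, of i] that unfolding evP' evQ' \<kappa>_def by (simp add: algebra_simps)
      qed
      have "(z, t0) \<in> S" using that by (simp add: S_def)
      then obtain h where h: "dotp ?d (evp P z) h = 0" "dotp ?d (evp Q z) h = 0"
        "dotp ?d (evp P t0) h = 0" "dotp ?d (evp Q t0) h = 0" "dotp ?d e h \<noteq> 0" using e5 by blast
      have "\<kappa> * dotp ?d e h = (\<Sum>i<?d. (\<kappa> * e i) * h i)"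
        unfolding dotp_def sum_distrib_left by (simp add: mult.assoc)
      also have "\<dots> = (\<Sum>i<?d. (a * evp P z i + b * evp Q z i + c * evp P t0 i + f * evp Q t0 i) * h i)"
        by (rule sum.cong) (use 1 in auto)
      also have "\<dots> = a * dotp ?d (evp P z) h + b * dotp ?d (evp Q z) h + c * dotp ?d (evp P t0) h + f * dotp ?d (evp Q t0) h"
        unfolding dotp_def sum_distrib_left sum.distrib[symmetric]
        by (rule sum.cong) (auto simp: algebra_simps)
      also have "\<dots> = 0" using h by simp
      finally have "\<kappa> = 0" using h(5) by simp
      then have "\<forall>i<?d. a * evp P z i + b * evp Q z i + c * evp P t0 i + f * evp Q t0 i = 0" using 1 by simp
      then show "a = 0 \<and> b = 0 \<and> c = 0 \<and> f = 0" using T4[OF that(2)] unfolding indep4_def by blast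
    qed
  qed
  then show ?case using good_line_project[of m P' P e Q' Q] P'_def Q'_def by blast
qed

text \<open>All planes lie in the span of the constant vectors \<open>u\<close>, \<open>v\<close>,
  \<open>w\<close>. Projection from a centre outside a hyperplane that contains this span is
  injective on it, so coincidence of planes is preserved exactly, and in dimension three all
  parameters can serve as \<open>T\<close>.\<close>

lemma good_line_coplanar:
  fixes P Q :: "nat \<Rightarrow> complex poly"
  assumes "3 \<le> d"
    and "\<And>z. indep2 d (evp P z) (evp Q z)"
    and "\<And>i. degree (P i) \<le> m1" "\<And>i. degree (Q i) \<le> m2"
    and "indep2 d (cfp P m1) (cfp Q m2)" and n: "m1 + m2 > 0"
    and E: "finite B0" "\<And>z. z \<notin> B0 \<Longrightarrow> card {z'. E z z'} = k" and "\<And>z z'. E z z' \<longleftrightarrow> same_plane d P Q z z'"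
    and "\<And>i. i < d \<Longrightarrow> P i = Polynomial.smult (u i) (p 0) + Polynomial.smult (v i) (p 1) + Polynomial.smult (w i) (p (2::nat))"
    and "\<And>i. i < d \<Longrightarrow> Q i = Polynomial.smult (u i) (q 0) + Polynomial.smult (v i) (q 1) + Polynomial.smult (w i) (q (2::nat))"
    and B: "finite B"
  shows "\<exists>x y. good_line d P Q (m1 + m2) B E x y"
  using assms(1-5,9-11)
proof (induction d arbitrary: P Q u v w rule: dec_induct)
  case base
  have "infinite (UNIV :: complex set)" by (rule infinite_UNIV_char_0)
  then show "\<exists>x y. good_line 3 P Q (m1 + m2) B E x y"
    using good_line_3[of P Q m1 m2 B0 E k UNIV B] base E n B by blast
next
  case (step m)
  note ind = step.prems(1) and deg = step.prems(2,3) and inf = step.prems(4) and same = step.prems(5)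
    and Pc = step.prems(6) and Qc = step.prems(7)
  let ?d = "Suc m"
  have m3: "3 \<le> m" by (rule step.hyps)
  obtain h where h: "\<exists>i<?d. h i \<noteq> 0" "dotp ?d u h = 0" "dotp ?d v h = 0" "dotp ?d w h = 0"
    using annihilator3[of ?d u v w] m3 by auto
  have hP: "dotp ?d (evp P z) h = 0" "dotp ?d (cfp P l) h = 0" for z l
  proof -
    have "dotp ?d (evp P z) h = poly (p 0) z * dotp ?d u h + poly (p 1) z * dotp ?d v h + poly (p 2) z * dotp ?d w h"
      unfolding dotp_def sum_distrib_left sum.distrib[symmetric]
      by (rule sum.cong) (auto simp: evp_def Pc algebra_simps)
    then show "dotp ?d (evp P z) h = 0" using h by simp
    have "dotp ?d (cfp P l) h = coeff (p 0) l * dotp ?d u h + coeff (p 1) l * dotp ?d v h + coeff (p 2) l * dotp ?d w h"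
      unfolding dotp_def sum_distrib_left sum.distrib[symmetric]
      by (rule sum.cong) (auto simp: cfp_def Pc algebra_simps)
    then show "dotp ?d (cfp P l) h = 0" using h by simp
  qed
  have hQ: "dotp ?d (evp Q z) h = 0" "dotp ?d (cfp Q l) h = 0" for z l
  proof -
    have "dotp ?d (evp Q z) h = poly (q 0) z * dotp ?d u h + poly (q 1) z * dotp ?d v h + poly (q 2) z * dotp ?d w h"
      unfolding dotp_def sum_distrib_left sum.distrib[symmetric]
      by (rule sum.cong) (auto simp: evp_def Qc algebra_simps)
    then show "dotp ?d (evp Q z) h = 0" using h by simp
    have "dotp ?d (cfp Q l) h = coeff (q 0) l * dotp ?d u h + coeff (q 1) l * dotp ?d v h + coeff (q 2) l * dotp ?d w h"
      unfolding dotp_def sum_distrib_left sum.distrib[symmetric]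
      by (rule sum.cong) (auto simp: cfp_def Qc algebra_simps)
    then show "dotp ?d (cfp Q l) h = 0" using h by simp
  qed
  \<comment> \<open>The centre has to avoid the hyperplane of \<open>h\<close> and to have a nonzero
    last coordinate, by which it is normalised.\<close>
  have "\<exists>e0. \<forall>f\<in>{h, \<lambda>i. if i = m then 1 else 0}. dotp ?d f e0 \<noteq> 0"
    by (rule avoid_countable_hyperplanes) (use h(1) in \<open>auto intro: exI[of _ m]\<close>)
  then obtain e0 where e0: "dotp ?d h e0 \<noteq> 0" "dotp ?d (\<lambda>i. if i = m then 1 else 0) e0 \<noteq> 0" by blast
  have e0m: "e0 m \<noteq> 0"
    using e0(2) unfolding dotp_def by (simp add: if_distrib[of "\<lambda>x. x * _"] cong: if_cong)
  define e where "e i = e0 i / e0 m" for i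
  have em: "e m = 1" using e0m by (simp add: e_def)
  have he: "dotp ?d e h \<noteq> 0"
  proof -
    have "dotp ?d e h = dotp ?d h e0 / e0 m"
      unfolding dotp_def e_def sum_divide_distrib by (simp add: mult.commute)
    then show ?thesis using e0(1) e0m by simp
  qed
  define pr where "pr R i = R i - Polynomial.smult (e i) (R m)" for R :: "nat \<Rightarrow> complex poly" and i
  have ev: "evp (pr R) z i = evp R z i - e i * evp R z m" and cf: "cfp (pr R) l i = cfp R l i - e i * cfp R l m" for R z l i
    by (simp_all add: evp_def cfp_def pr_def)
  have same': "same_plane m (pr P) (pr Q) z z' \<longleftrightarrow> same_plane ?d P Q z z'" for z z'
  proof
    assume "same_plane ?d P Q z z'"
    then show "same_plane m (pr P) (pr Q) z z'"
      using projection_same_plane[of m "pr P" P e "pr Q" Q z z'] ev by blast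
  next
    assume "same_plane m (pr P) (pr Q) z z'"
    then obtain a b \<kappa> a' b' \<kappa>' where 1: "\<And>i. i < ?d \<Longrightarrow> evp P z' i = a * evp P z i + b * evp Q z i + \<kappa> * e i"
      and 2: "\<And>i. i < ?d \<Longrightarrow> evp Q z' i = a' * evp P z i + b' * evp Q z i + \<kappa>' * e i"
      using projection_same_planeD[of e m "pr P" P "pr Q" Q z z'] em ev by metis
    have lin: "dotp ?d x h = r * dotp ?d y h + s * dotp ?d y' h + t * dotp ?d e h"
      if "\<And>i. i < ?d \<Longrightarrow> x i = r * y i + s * y' i + t * e i" for x y y' r s t
      unfolding dotp_def sum_distrib_left sum.distrib[symmetric]
      by (rule sum.cong) (auto simp: that algebra_simps)
    have "\<kappa> = 0" "\<kappa>' = 0" using lin[OF 1] lin[OF 2] hP hQ he by auto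
    then show "same_plane ?d P Q z z'" unfolding same_plane_def using 1 2 by auto
  qed
  have cop: "pr R i = Polynomial.smult (u i - e i * u m) (r 0) + Polynomial.smult (v i - e i * v m) (r 1) +
      Polynomial.smult (w i - e i * w m) (r (2::nat))"
    if "i < m" "\<And>i. i < ?d \<Longrightarrow> R i = Polynomial.smult (u i) (r 0) + Polynomial.smult (v i) (r 1) + Polynomial.smult (w i) (r (2::nat))"
    for R r i
    unfolding pr_def using that(2)[of i] that(2)[of m] that(1)
    by (simp add: smult_diff_left smult_add_right algebra_simps)
  have "\<exists>x y. good_line m (pr P) (pr Q) (m1 + m2) B E x y"
  proof (rule step.IH)
    show "indep2 m (evp (pr P) z) (evp (pr Q) z)" for z
      using projection_indep2[of e m "evp P z" "evp Q z"] em
        indep3_by_functional[OF ind[of z] hP(1) hQ(1) he] unfolding ev[abs_def] by blast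
    show "degree (pr P i) \<le> m1" "degree (pr Q i) \<le> m2" for i
      unfolding pr_def using deg(1)[of i] deg(1)[of m] deg(2)[of i] deg(2)[of m]
      by (auto intro!: degree_diff_le order.trans[OF degree_smult_le])
    show "indep2 m (cfp (pr P) m1) (cfp (pr Q) m2)"
      using projection_indep2[of e m "cfp P m1" "cfp Q m2"] em
        indep3_by_functional[OF inf hP(2) hQ(2) he] unfolding cf[abs_def] by blast
    show "E z z' \<longleftrightarrow> same_plane m (pr P) (pr Q) z z'" for z z' unfolding same' by (rule same)
  qed (use cop Pc Qc in blast)+
  then show ?case using good_line_project[of m "pr P" P e "pr Q" Q] pr_def by blast
qed

section \<open>Conditions on a generic line\<close>

lemma pf2_const [intro]: "polynomial_fun2 d (\<lambda>x y. c)"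
  by (rule polynomial_fun2.intros)

lemma pf2_add [intro]: "polynomial_fun2 d f \<Longrightarrow> polynomial_fun2 d g \<Longrightarrow> polynomial_fun2 d (\<lambda>x y. f x y + g x y)"
  by (rule polynomial_fun2.intros)

lemma pf2_mult [intro]: "polynomial_fun2 d f \<Longrightarrow> polynomial_fun2 d g \<Longrightarrow> polynomial_fun2 d (\<lambda>x y. f x y * g x y)"
  by (rule polynomial_fun2.intros)

lemma pf2_diff [intro]:
  assumes "polynomial_fun2 d f" "polynomial_fun2 d g"
  shows "polynomial_fun2 d (\<lambda>x y. f x y - g x y)"
proof -
  have "polynomial_fun2 d (\<lambda>x y. f x y + (\<lambda>x y. - 1) x y * g x y)" using assms by (intro pf2_add pf2_mult pf2_const)
  then show ?thesis by simp
qed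

lemma pf2_sum [intro]: "(\<And>i. i \<in> I \<Longrightarrow> polynomial_fun2 d (f i)) \<Longrightarrow> polynomial_fun2 d (\<lambda>x y. \<Sum>i\<in>I. f i x y)"
  by (induction I rule: infinite_finite_induct) auto

lemma pf2_prod [intro]: "(\<And>i. i \<in> I \<Longrightarrow> polynomial_fun2 d (f i)) \<Longrightarrow> polynomial_fun2 d (\<lambda>x y. \<Prod>i\<in>I. f i x y)"
  by (induction I rule: infinite_finite_induct) auto

lemma pf2_det:
  assumes "\<And>i j. i < r \<Longrightarrow> j < r \<Longrightarrow> polynomial_fun2 d (\<lambda>x y. A x y i j)"
  shows "polynomial_fun2 d (\<lambda>x y. det (mat r r (\<lambda>(i, j). A x y i j)))"
  unfolding det_mat_leibniz
  by (intro pf2_sum pf2_mult pf2_const pf2_prod assms)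
    (auto simp: permutes_in_image)

lemma pf2_line:
  assumes "polynomial_fun2 d F"
  shows "polyfun (\<lambda>z. F (vec d (\<lambda>i. x0 i + z * x1 i)) (vec d (\<lambda>i. y0 i + z * y1 i)))"
  using assms
proof induction
  case (2 i)
  have "polyfun (\<lambda>z. x0 i + z * x1 i)" unfolding polyfun_def
    by (rule exI[of _ "[:x0 i, x1 i:]"]) (simp add: mult.commute)
  then show ?case using 2 by simp
next
  case (3 i)
  have "polyfun (\<lambda>z. y0 i + z * y1 i)" unfolding polyfun_def
    by (rule exI[of _ "[:y0 i, y1 i:]"]) (simp add: mult.commute)
  then show ?case using 3 by simp
qed auto

text \<open>Two nonempty open sets meet: on the line that joins the two given points,
  \<open>F\<close> and \<open>G\<close> are one-variable polynomials, neither of them zero.\<close>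

lemma pf2_common_nonzero:
  assumes "polynomial_fun2 d F" "polynomial_fun2 d G"
    and xy: "x0 \<in> carrier_vec d" "y0 \<in> carrier_vec d" "F x0 y0 \<noteq> 0"
    and xy': "x1 \<in> carrier_vec d" "y1 \<in> carrier_vec d" "G x1 y1 \<noteq> 0"
  shows "\<exists>x\<in>carrier_vec d. \<exists>y\<in>carrier_vec d. F x y \<noteq> 0 \<and> G x y \<noteq> 0"
proof -
  let ?X = "\<lambda>z. vec d (\<lambda>i. x0 $ i + z * (x1 $ i - x0 $ i))"
  let ?Y = "\<lambda>z. vec d (\<lambda>i. y0 $ i + z * (y1 $ i - y0 $ i))"
  have "?X 0 = x0" "?Y 0 = y0" "?X 1 = x1" "?Y 1 = y1" using xy xy' by auto
  then have "finite {z. F (?X z) (?Y z) = 0}" "finite {z. G (?X z) (?Y z) = 0}"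
    using polyfun_finite_zeros[OF pf2_line[OF assms(1), of "($) x0" "\<lambda>i. x1 $ i - x0 $ i" "($) y0" "\<lambda>i. y1 $ i - y0 $ i"], of 0]
      polyfun_finite_zeros[OF pf2_line[OF assms(2), of "($) x0" "\<lambda>i. x1 $ i - x0 $ i" "($) y0" "\<lambda>i. y1 $ i - y0 $ i"], of 1]
      xy(3) xy'(3) by simp_all
  then have "finite ({z. F (?X z) (?Y z) = 0} \<union> {z. G (?X z) (?Y z) = 0})" by simp
  from ex_new_if_finite[OF infinite_UNIV_char_0 this]
  obtain z where z: "F (?X z) (?Y z) \<noteq> 0" "G (?X z) (?Y z) \<noteq> 0" by blast
  have "?X z \<in> carrier_vec d" "?Y z \<in> carrier_vec d" by simp_all
  with z show ?thesis by blast
qed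

lemma indep_pair_by_minor:
  fixes x y :: "complex vec"
  assumes xy: "x \<in> carrier_vec d" "y \<in> carrier_vec d" and ij: "i < d" "j < d"
    and "x $ i * y $ j - x $ j * y $ i \<noteq> 0"
  shows "indep_pair d x y"
  unfolding indep_pair_def
proof (intro allI impI)
  fix a b assume *: "a \<cdot>\<^sub>v x + b \<cdot>\<^sub>v y = 0\<^sub>v d"
  have "a * x $ k + b * y $ k = 0" if "k < d" for k
  proof -
    have "(a \<cdot>\<^sub>v x + b \<cdot>\<^sub>v y) $ k = 0" using * that by simp
    then show ?thesis using xy that by simp
  qed
  from this[OF ij(1)] this[OF ij(2)]
  have 1: "a * x $ i + b * y $ i = 0" "a * x $ j + b * y $ j = 0" by auto
  have "a * (x $ i * y $ j - x $ j * y $ i) = y $ j * (a * x $ i + b * y $ i) - y $ i * (a * x $ j + b * y $ j)"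
    "b * (x $ i * y $ j - x $ j * y $ i) = x $ i * (a * x $ j + b * y $ j) - x $ j * (a * x $ i + b * y $ i)"
    by (simp_all add: algebra_simps)
  then show "a = 0 \<and> b = 0" unfolding 1 using assms(5) by simp
qed

text \<open>A third open condition, one nonzero minor of \<open>x\<close> and \<open>y\<close>,
  ensures that the common pair spans a line. This makes the generic number of intersections
  unique.\<close>

lemma generic_line_conj:
  assumes d: "2 \<le> d" and "generic_line d P1" "generic_line d P2"
  shows "\<exists>l. P1 l \<and> P2 l"
proof -
  obtain F where F: "polynomial_fun2 d F" "\<exists>x\<in>carrier_vec d. \<exists>y\<in>carrier_vec d. F x y \<noteq> 0"
    "\<And>x y. x \<in> carrier_vec d \<Longrightarrow> y \<in> carrier_vec d \<Longrightarrow> F x y \<noteq> 0 \<Longrightarrow> indep_pair d x y \<Longrightarrow> P1 (line_through d x y)"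
    using assms(2) unfolding generic_line_def by blast
  obtain G where G: "polynomial_fun2 d G" "\<exists>x\<in>carrier_vec d. \<exists>y\<in>carrier_vec d. G x y \<noteq> 0"
    "\<And>x y. x \<in> carrier_vec d \<Longrightarrow> y \<in> carrier_vec d \<Longrightarrow> G x y \<noteq> 0 \<Longrightarrow> indep_pair d x y \<Longrightarrow> P2 (line_through d x y)"
    using assms(3) unfolding generic_line_def by blast
  let ?M = "\<lambda>(x :: complex vec) (y :: complex vec). x $ 0 * y $ 1 - x $ 1 * y $ 0"
  have M: "polynomial_fun2 d ?M" using d by (auto intro!: polynomial_fun2.intros pf2_diff)
  have FG: "polynomial_fun2 d (\<lambda>x y. F x y * G x y)" using F(1) G(1) by auto
  obtain x0 y0 where 0: "x0 \<in> carrier_vec d" "y0 \<in> carrier_vec d" "F x0 y0 * G x0 y0 \<noteq> 0"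
    using pf2_common_nonzero[OF F(1) G(1)] F(2) G(2) by (metis mult_eq_0_iff)
  obtain x y where "x \<in> carrier_vec d" "y \<in> carrier_vec d" "F x y * G x y \<noteq> 0" "?M x y \<noteq> 0"
    using pf2_common_nonzero[OF FG M 0, of "unit_vec d 0" "unit_vec d 1"] d by auto
  then show ?thesis using F(3)[of x y] G(3)[of x y] indep_pair_by_minor[of x d y 0 1] d
    by (intro exI[of _ "line_through d x y"]) auto
qed

lemma implicit_degree_eqI:
  assumes "2 \<le> d" "generic_line d (\<lambda>l. finite (l \<inter> X) \<and> card (l \<inter> X) = n)"
  shows "implicit_degree d X = n"
  unfolding implicit_degree_def
proof (rule the_equality)
  fix m assume "generic_line d (\<lambda>l. finite (l \<inter> X) \<and> card (l \<inter> X) = m)"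
  from generic_line_conj[OF assms(1) this assms(2)] show "m = n" by auto
qed (rule assms(2))

section \<open>Linear independence of polynomials as an open condition\<close>

definition pindep :: "nat \<Rightarrow> (nat \<Rightarrow> complex poly) \<Rightarrow> bool" where
  "pindep r g \<longleftrightarrow> (\<forall>c. (\<Sum>i<r. Polynomial.smult (c i) (g i)) = 0 \<longrightarrow> (\<forall>i<r. c i = 0))"

definition pf2_poly :: "nat \<Rightarrow> (complex vec \<Rightarrow> complex vec \<Rightarrow> complex poly) \<Rightarrow> bool" where
  "pf2_poly d p \<longleftrightarrow> (\<forall>m. polynomial_fun2 d (\<lambda>x y. coeff (p x y) m))"

lemma pf2_poly_const [intro]: "pf2_poly d (\<lambda>x y. p)"
  unfolding pf2_poly_def by auto

lemma pf2_poly_add [intro]: "pf2_poly d p \<Longrightarrow> pf2_poly d q \<Longrightarrow> pf2_poly d (\<lambda>x y. p x y + q x y)"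
  unfolding pf2_poly_def by auto

lemma pf2_poly_diff [intro]: "pf2_poly d p \<Longrightarrow> pf2_poly d q \<Longrightarrow> pf2_poly d (\<lambda>x y. p x y - q x y)"
  unfolding pf2_poly_def by auto

lemma pf2_poly_mult [intro]: "pf2_poly d p \<Longrightarrow> pf2_poly d q \<Longrightarrow> pf2_poly d (\<lambda>x y. p x y * q x y)"
  unfolding pf2_poly_def coeff_mult by (auto intro!: pf2_sum pf2_mult)

lemma pf2_poly_power [intro]: "pf2_poly d p \<Longrightarrow> pf2_poly d (\<lambda>x y. p x y ^ k)"
  by (induction k) auto

lemma pf2_poly_pderiv [intro]: "pf2_poly d p \<Longrightarrow> pf2_poly d (\<lambda>x y. pderiv (p x y))"
  unfolding pf2_poly_def coeff_pderiv by (auto intro!: pf2_mult)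

lemma pf2_poly_pdot1 [intro]: "pf2_poly d (\<lambda>x y. pdot d P (($) x))"
  unfolding pf2_poly_def coeff_pdot dotp_def by (auto intro!: pf2_sum pf2_mult polynomial_fun2.intros)

lemma pf2_poly_pdot2 [intro]: "pf2_poly d (\<lambda>x y. pdot d P (($) y))"
  unfolding pf2_poly_def coeff_pdot dotp_def by (auto intro!: pf2_sum pf2_mult polynomial_fun2.intros)

lemma pf2_poly_line_res [intro]: "pf2_poly d (\<lambda>x y. line_res d P Q (($) x) (($) y))"
  unfolding line_res_def
  by (intro pf2_poly_diff pf2_poly_mult pf2_poly_pdot1 pf2_poly_pdot2)

lemma pf2_coeff: "pf2_poly d p \<Longrightarrow> polynomial_fun2 d (\<lambda>x y. coeff (p x y) m)"
  unfolding pf2_poly_def by blast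

text \<open>The dual vectors of the coefficient vectors at \<open>x0\<close>, \<open>y0\<close> are
  kept fixed, and \<open>F\<close> is the compressed determinant. The bound \<open>N\<close> is
  valid at \<open>x0\<close>, \<open>y0\<close> only; elsewhere coefficients may be cut off, but a
  relation between polynomials is also one between their truncations.\<close>

lemma pindep_open:
  assumes g: "\<And>i. i < r \<Longrightarrow> pf2_poly d (g i)" and ind: "pindep r (\<lambda>i. g i x0 y0)"
  shows "\<exists>F. polynomial_fun2 d F \<and> F x0 y0 \<noteq> 0 \<and> (\<forall>x y. F x y \<noteq> 0 \<longrightarrow> pindep r (\<lambda>i. g i x y))"
proof -
  define N where "N = Suc (Max (insert 0 ((\<lambda>i. degree (g i x0 y0)) ` {..<r})))"
  have N: "degree (g i x0 y0) < N" if "i < r" for i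
    unfolding N_def using that by (simp add: less_Suc_eq_le)
  have "lin_indep r N (\<lambda>i. coeff (g i x0 y0))"
    unfolding lin_indep_def
  proof (rule allI, rule impI)
    fix c assume c: "\<forall>m<N. (\<Sum>i<r. c i * coeff (g i x0 y0) m) = 0"
    have "coeff (\<Sum>i<r. Polynomial.smult (c i) (g i x0 y0)) m = 0" for m
    proof (cases "m < N")
      case False
      then have "coeff (g i x0 y0) m = 0" if "i < r" for i using N[OF that] by (intro coeff_eq_0) simp
      then show ?thesis by (simp add: coeff_sum)
    qed (use c in \<open>simp add: coeff_sum\<close>)
    then have "(\<Sum>i<r. Polynomial.smult (c i) (g i x0 y0)) = 0" by (intro poly_eqI) simp
    then show "\<forall>i<r. c i = 0" using ind unfolding pindep_def by blast
  qed
  then obtain v where v: "\<forall>i<r. \<forall>j<r. dotp N (coeff (g i x0 y0)) (v j) = (if i = j then 1 else 0)"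
    using dual_vectors by blast
  let ?F = "\<lambda>x y. det (mat r r (\<lambda>(i, j). dotp N (coeff (g i x y)) (v j)))"
  have "polynomial_fun2 d ?F"
    unfolding dotp_def by (intro pf2_det pf2_sum pf2_mult pf2_const pf2_coeff g)
  moreover have "?F x0 y0 \<noteq> 0" using det_dual_vectors[OF v] by simp
  moreover have "pindep r (\<lambda>i. g i x y)" if "?F x y \<noteq> 0" for x y
    unfolding pindep_def
  proof (rule allI, rule impI)
    fix c assume "(\<Sum>i<r. Polynomial.smult (c i) (g i x y)) = 0"
    then have "coeff (\<Sum>i<r. Polynomial.smult (c i) (g i x y)) m = 0" for m by simp
    then have "\<forall>m<N. (\<Sum>i<r. c i * coeff (g i x y) m) = 0" by (simp add: coeff_sum)
    then show "\<forall>i<r. c i = 0" using lin_indep_by_det[OF that] unfolding lin_indep_def by blast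
  qed
  ultimately show ?thesis by blast
qed

section \<open>Squarefreeness through the Sylvester matrix\<close>

lemma sum_lessThan_add:
  fixes f :: "nat \<Rightarrow> 'a::comm_monoid_add"
  shows "(\<Sum>i<a + b. f i) = (\<Sum>i<a. f i) + (\<Sum>i<b. f (a + i))"
  by (induction b) (simp_all add: add.assoc)

lemma coeff_monom_sum:
  "coeff (\<Sum>i<N. monom (c i) i) m = (if m < N then c m else (0::'a::comm_monoid_add))"
  by (simp add: coeff_sum sum.delta)

lemma smult_monom_sum:
  "(\<Sum>i<N. Polynomial.smult (c i) (monom 1 i * q)) = (\<Sum>i<N. monom (c i) i) * (q :: 'a::comm_ring_1 poly)"
  unfolding sum_distrib_right by (intro sum.cong refl) (simp flip: mult_smult_left add: smult_monom)

lemma degree_monom_sum: "N > 0 \<Longrightarrow> degree (\<Sum>i<N. monom (c i) i :: 'a::comm_monoid_add poly) < N"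
  by (rule le_less_trans[of _ "N - 1"], rule degree_le) (auto simp: coeff_monom_sum)

lemma squarefree_dvd:
  fixes p q :: "complex poly"
  assumes "p \<noteq> 0" and sq: "\<And>z. poly p z = 0 \<Longrightarrow> poly (pderiv p) z \<noteq> 0" and r: "\<And>z. poly p z = 0 \<Longrightarrow> poly q z = 0"
  shows "p dvd q"
proof -
  have *: "(\<Prod>z\<in>Z. [:- z, 1:]) dvd q" if "finite Z" "\<And>z. z \<in> Z \<Longrightarrow> poly q z = 0" for Z
    using that
  proof (induction Z rule: finite_induct)
    case (insert z Z)
    then obtain k where k: "q = (\<Prod>z\<in>Z. [:- z, 1:]) * k" by (auto elim: dvdE)
    have "poly (\<Prod>z\<in>Z. [:- z, 1:]) z \<noteq> 0" using insert.hyps by (auto simp: poly_prod)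
    then have "poly k z = 0" using insert.prems[of z] k by simp
    then have "[:- z, 1:] dvd k" by (simp add: poly_eq_0_iff_dvd)
    then show ?case unfolding k prod.insert[OF insert.hyps] by (metis mult.commute mult_dvd_mono dvd_refl)
  qed simp
  have "rsquarefree p" using sq by (auto simp: rsquarefree_roots)
  then have p: "Polynomial.smult (lead_coeff p) (\<Prod>z | poly p z = 0. [:- z, 1:]) = p"
    by (rule complex_poly_decompose_rsquarefree)
  have "(\<Prod>z | poly p z = 0. [:- z, 1:]) dvd q"
    by (rule *) (use r poly_roots_finite[OF assms(1)] in auto)
  then show ?thesis using assms(1) by (subst p[symmetric]) (simp add: smult_dvd)
qed

lemma card_roots_squarefree:
  fixes p :: "complex poly"
  assumes "p \<noteq> 0" and "\<And>z. poly p z = 0 \<Longrightarrow> poly (pderiv p) z \<noteq> 0"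
  shows "card {z. poly p z = 0} = degree p"
  using rsquarefree_card_degree[OF assms(1)] assms(2) by (auto simp: rsquarefree_roots)

text \<open>The rows of the Sylvester matrix of \<open>p\<close> and its derivative for
  \<open>degree p = n\<close>: \<open>n - 1\<close> shifts of \<open>p\<close>, then
  \<open>n\<close> shifts of the derivative. Independence replaces a nonzero discriminant.\<close>

definition sylvester_family :: "nat \<Rightarrow> complex poly \<Rightarrow> nat \<Rightarrow> complex poly" where
  "sylvester_family n p i = (if i < n - 1 then monom 1 i * p else monom 1 (i - (n - 1)) * pderiv p)"

lemma sylvester_sum:
  "(\<Sum>i<(n - 1) + n. Polynomial.smult (c i) (sylvester_family n p i)) =
    (\<Sum>i<n - 1. monom (c i) i) * p + (\<Sum>i<n. monom (c (n - 1 + i)) i) * pderiv p"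
proof -
  have "sylvester_family n p i = monom 1 i * p" if "i < n - 1" for i
    using that by (simp add: sylvester_family_def)
  moreover have "sylvester_family n p (n - 1 + i) = monom 1 i * pderiv p" for i
    unfolding sylvester_family_def by simp
  ultimately show ?thesis
    unfolding sum_lessThan_add smult_monom_sum[symmetric]
    by (intro arg_cong2[of _ _ _ _ "(+)"] sum.cong refl) simp_all
qed

text \<open>Without a common root, a relation \<open>a * p + b * pderiv p = 0\<close> forces
  \<open>p\<close> to divide \<open>b\<close>, whose degree is less than \<open>n\<close>.\<close>

lemma sylvester_squarefree:
  assumes p: "p \<noteq> 0" "degree p = n" "0 < n"
  shows "pindep ((n - 1) + n) (sylvester_family n p) \<longleftrightarrow> (\<forall>z. poly p z = 0 \<longrightarrow> poly (pderiv p) z \<noteq> 0)"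
proof
  assume ind: "pindep ((n - 1) + n) (sylvester_family n p)"
  show "\<forall>z. poly p z = 0 \<longrightarrow> poly (pderiv p) z \<noteq> 0"
  proof (intro allI impI notI)
    fix w assume "poly p w = 0" "poly (pderiv p) w = 0"
    then obtain a b where a: "p = [:- w, 1:] * a" and b: "pderiv p = [:- w, 1:] * b"
      by (metis poly_eq_0_iff_dvd dvdE)
    have "a \<noteq> 0" using a p(1) by auto
    then have da: "degree a < n" using a p(2) by (simp add: degree_mult_eq del: mult_pCons_left)
    have db: "b = 0 \<or> degree b < n - 1"
    proof (cases "b = 0")
      case False
      then have "degree (pderiv p) = Suc (degree b)" unfolding b by (simp add: degree_mult_eq del: mult_pCons_left)
      then show ?thesis using degree_pderiv[of p] p(2) by simp
    qed simp
    \<comment> \<open>The common linear factor cancels: the cofactors \<open>b\<close> of the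
      derivative and \<open>- a\<close> of \<open>p\<close> are the coefficients of a
      relation.\<close>
    define c where "c i = (if i < n - 1 then coeff b i else - coeff a (i - (n - 1)))" for i
    have "(\<Sum>i<n - 1. monom (c i) i) = b"
      using db by (intro poly_eqI) (auto simp: coeff_monom_sum c_def coeff_eq_0)
    moreover have "(\<Sum>i<n. monom (c (n - 1 + i)) i) = - a"
      using da by (intro poly_eqI) (auto simp: coeff_monom_sum c_def coeff_eq_0)
    ultimately have "(\<Sum>i<(n - 1) + n. Polynomial.smult (c i) (sylvester_family n p i)) = b * p + (- a) * pderiv p"
      unfolding sylvester_sum by simp
    also have "\<dots> = 0"
    proof -
      have "b * (L * a) + (- a) * (L * b) = 0" for L by (simp add: algebra_simps)
      then show ?thesis unfolding b by (subst a) blast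
    qed
    finally have cz: "\<forall>i<(n - 1) + n. c i = 0" using ind unfolding pindep_def by blast
    have "coeff a i = 0" if "i < n" for i
    proof -
      have "n - 1 + i < (n - 1) + n" using that by simp
      then have "c (n - 1 + i) = 0" using cz by blast
      then show ?thesis by (simp add: c_def)
    qed
    then have "lead_coeff a = 0" using da by blast
    then show False using \<open>a \<noteq> 0\<close> by simp
  qed
next
  assume sq: "\<forall>z. poly p z = 0 \<longrightarrow> poly (pderiv p) z \<noteq> 0"
  show "pindep ((n - 1) + n) (sylvester_family n p)"
    unfolding pindep_def
  proof (rule allI, rule impI)
    fix c assume *: "(\<Sum>i<(n - 1) + n. Polynomial.smult (c i) (sylvester_family n p i)) = 0"
    define a where "a = (\<Sum>i<n - 1. monom (c i) i)"
    define b where "b = (\<Sum>i<n. monom (c (n - 1 + i)) i)"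
    have ab: "a * p + b * pderiv p = 0" using * unfolding sylvester_sum a_def b_def .
    have "p dvd b"
    proof (rule squarefree_dvd[OF p(1)])
      fix z assume z: "poly p z = 0"
      then have "poly (a * p + b * pderiv p) z = poly b z * poly (pderiv p) z" by simp
      then show "poly b z = 0" using ab sq z by simp
    qed (use sq in blast)
    moreover have "degree b < n" unfolding b_def using p(3) by (rule degree_monom_sum)
    ultimately have b0: "b = 0" using p(2) by (metis dvd_imp_degree_le leD)
    then have a0: "a = 0" using ab p(1) by simp
    show "\<forall>i<(n - 1) + n. c i = 0"
    proof (intro allI impI)
      fix i assume i: "i < (n - 1) + n"
      show "c i = 0"
      proof (cases "i < n - 1")
        case True
        then show ?thesis using arg_cong[OF a0, of "\<lambda>p. coeff p i"] by (simp add: a_def coeff_monom_sum)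
      next
        case False
        then show ?thesis using arg_cong[OF b0, of "\<lambda>p. coeff p (i - (n - 1))"] i
          by (simp add: b_def coeff_monom_sum split: if_splits)
      qed
    qed
  qed
qed

section \<open>Binary forms and their roots on the projective line\<close>

definition hform :: "nat \<Rightarrow> 'a::comm_semiring_1 poly \<Rightarrow> 'a \<Rightarrow> 'a \<Rightarrow> 'a" where
  "hform N q u v = (\<Sum>j\<le>N. coeff q j * (u ^ j * v ^ (N - j)))"

lemma hform_linear_mult:
  fixes u v :: "'a::comm_ring_1"
  assumes "degree q \<le> N"
  shows "hform (Suc N) ([:b, a:] * q) u v = (a * u + b * v) * hform N q u v"
proof -
  have 1: "hform (Suc N) q u v = v * hform N q u v"
  proof -
    have "coeff q (Suc N) = 0" using assms by (intro coeff_eq_0) simp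
    then have "hform (Suc N) q u v = (\<Sum>j\<le>N. coeff q j * (u ^ j * v ^ (Suc N - j)))" by (simp add: hform_def)
    also have "\<dots> = (\<Sum>j\<le>N. v * (coeff q j * (u ^ j * v ^ (N - j))))"
      by (intro sum.cong refl) (simp add: Suc_diff_le mult_ac)
    finally show ?thesis by (simp add: hform_def sum_distrib_left)
  qed
  have 2: "hform (Suc N) (pCons 0 q) u v = u * hform N q u v"
    unfolding hform_def by (subst sum.atMost_Suc_shift) (simp add: sum_distrib_left mult_ac)
  have "hform (Suc N) ([:b, a:] * q) u v = b * hform (Suc N) q u v + a * hform (Suc N) (pCons 0 q) u v"
  proof -
    have "coeff ([:b, a:] * q) j = b * coeff q j + a * coeff (pCons 0 q) j" for j
      by (simp add: coeff_pCons split: nat.split)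
    then show ?thesis
      unfolding hform_def sum_distrib_left sum.distrib[symmetric]
      by (intro sum.cong refl) (simp only: distrib_right mult.assoc)
  qed
  then show ?thesis unfolding 1 2 by (simp add: algebra_simps)
qed

text \<open>A factor with \<open>a = 0\<close> raises the degree of the form but not that of
  \<open>q\<close>; therefore only \<open>degree q \<le> length ps\<close> is claimed.\<close>

lemma hform_product:
  fixes ps :: "(complex \<times> complex) list"
  assumes "\<And>a b. (a, b) \<in> set ps \<Longrightarrow> a \<noteq> 0 \<or> b \<noteq> 0"
  shows "\<exists>q. q \<noteq> 0 \<and> degree q \<le> length ps \<and> (\<forall>u v. hform (length ps) q u v = (\<Prod>(a, b)\<leftarrow>ps. a * u + b * v))"
  using assms
proof (induction ps)
  case Nil
  then show ?case by (intro exI[of _ 1]) (simp add: hform_def)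
next
  case (Cons ab ps)
  obtain a b where ab: "ab = (a, b)" by fastforce
  obtain q where q: "q \<noteq> 0" "degree q \<le> length ps" "\<And>u v. hform (length ps) q u v = (\<Prod>(a, b)\<leftarrow>ps. a * u + b * v)"
    using Cons by auto
  have "[:b, a:] \<noteq> 0" using Cons.prems[of a b] ab by auto
  moreover have "degree ([:b, a:] * q) \<le> Suc (length ps)"
    using degree_mult_le[of "[:b, a:]" q] q(2) by (simp del: mult_pCons_left split: if_splits)
  ultimately show ?case using q hform_linear_mult[OF q(2)] ab
    by (intro exI[of _ "[:b, a:] * q"]) (simp del: mult_pCons_left)
qed

text \<open>Points with \<open>v \<noteq> 0\<close> give different roots \<open>u / v\<close> of
  \<open>q\<close>. At most one point has \<open>v = 0\<close>, and a zero there removes the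
  coefficient at \<open>N\<close>. Either way a nonzero form of degree \<open>N\<close> has too few
  roots for \<open>Suc N\<close> points.\<close>

lemma hform_zero:
  fixes q :: "complex poly" and u v :: "'b \<Rightarrow> complex"
  assumes "finite Z" "card Z = Suc N" and deg: "degree q \<le> N"
    and nz: "\<And>z. z \<in> Z \<Longrightarrow> u z \<noteq> 0 \<or> v z \<noteq> 0"
    and np: "\<And>z z'. z \<in> Z \<Longrightarrow> z' \<in> Z \<Longrightarrow> u z * v z' = u z' * v z \<Longrightarrow> z = z'"
    and h: "\<And>z. z \<in> Z \<Longrightarrow> hform N q (u z) (v z) = 0"
  shows "q = 0"
proof (rule ccontr)
  assume q0: "q \<noteq> 0"
  define Z1 where "Z1 = {z \<in> Z. v z \<noteq> 0}"
  have root: "poly q (u z / v z) = 0" if "z \<in> Z1" for z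
  proof -
    have "hform N q (u z) (v z) = (\<Sum>j\<le>N. v z ^ N * (coeff q j * (u z / v z) ^ j))"
      unfolding hform_def
    proof (intro sum.cong refl)
      fix j assume "j \<in> {..N}"
      then have "v z ^ N = v z ^ j * v z ^ (N - j)" by (simp flip: power_add)
      then show "coeff q j * (u z ^ j * v z ^ (N - j)) = v z ^ N * (coeff q j * (u z / v z) ^ j)"
        using that by (simp add: Z1_def power_divide)
    qed
    also have "\<dots> = v z ^ N * poly q (u z / v z)"
      unfolding poly_altdef sum_distrib_left[symmetric]
      using deg by (intro arg_cong2[of _ _ _ _ "(*)"] refl sum.mono_neutral_right) (auto intro: coeff_eq_0)
    finally show ?thesis using h[of z] that by (simp add: Z1_def)
  qed
  have inj: "inj_on (\<lambda>z. u z / v z) Z1"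
    by (rule inj_onI, rule np) (auto simp: Z1_def field_simps)
  have "card Z1 = card ((\<lambda>z. u z / v z) ` Z1)" by (rule card_image[OF inj, symmetric])
  also have "\<dots> \<le> card {x. poly q x = 0}" by (rule card_mono[OF poly_roots_finite[OF q0]]) (use root in auto)
  also have "\<dots> \<le> degree q" by (rule card_poly_roots_bound[OF q0])
  finally have c1: "card Z1 \<le> degree q" .
  show False
  proof (cases "Z1 = Z")
    case True
    then show False using c1 assms(2) deg by simp
  next
    case False
    then obtain z0 where z0: "z0 \<in> Z" "v z0 = 0" unfolding Z1_def by blast
    have "Z \<subseteq> insert z0 Z1"
    proof
      fix z assume z: "z \<in> Z"
      show "z \<in> insert z0 Z1"
      proof (cases "v z = 0")
        case True
        then have "z = z0" using np[OF z z0(1)] z0(2) by simp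
        then show ?thesis by simp
      qed (use z Z1_def in auto)
    qed
    then have "card Z \<le> Suc (card Z1)"
      using card_mono[of "insert z0 Z1" Z] assms(1) by (simp add: Z1_def card_insert_if split: if_splits)
    then have dN: "degree q = N" using c1 deg assms(2) by simp
    have "hform N q (u z0) (v z0) = coeff q N * u z0 ^ N"
    proof -
      have "hform N q (u z0) (v z0) = (\<Sum>j\<le>N. if j = N then coeff q N * u z0 ^ N else 0)"
        unfolding hform_def by (intro sum.cong refl) (auto simp: z0(2))
      then show ?thesis by simp
    qed
    then have "coeff q N = 0" using h[OF z0(1)] nz[OF z0(1)] z0(2) by simp
    then show False using dN q0 by auto
  qed
qed

lemma class_count:
  assumes "finite Z" and "\<And>z. z \<in> Z \<Longrightarrow> card {z'. E z z'} = k" and "\<And>z. z \<in> Z \<Longrightarrow> {z'. E z z'} \<subseteq> Z"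
    and E: "equivp E"
  shows "k * card ((\<lambda>z. {z'. E z z'}) ` Z) = card Z"
proof -
  let ?C = "(\<lambda>z. {z'. E z z'}) ` Z"
  have U: "\<Union>?C = Z" using assms(3) equivp_reflp[OF E] by blast
  have "k * card ?C = card (\<Union>?C)"
  proof (rule card_partition)
    show "finite ?C" "finite (\<Union>?C)" using assms(1) U by auto
    show "card c = k" if "c \<in> ?C" for c using that assms(2) by auto
    show "c1 \<inter> c2 = {}" if c: "c1 \<in> ?C" "c2 \<in> ?C" "c1 \<noteq> c2" for c1 c2
    proof (rule ccontr)
      assume "c1 \<inter> c2 \<noteq> {}"
      then obtain z1 z2 w where *: "c1 = {z'. E z1 z'}" "c2 = {z'. E z2 z'}" "E z1 w" "E z2 w" using c by blast
      then have "E z1 z2" using equivp_symp[OF E] equivp_transp[OF E] by blast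
      then have "c1 = c2" unfolding * using equivp_symp[OF E] equivp_transp[OF E] by blast
      then show False using c(3) by simp
    qed
  qed
  then show ?thesis using U by simp
qed

section \<open>The polynomial of a line and the points given by its roots\<close>

lemma degree_pdot_le:
  assumes "\<And>i. degree (P i) \<le> m"
  shows "degree (pdot d P x) \<le> m"
  unfolding pdot_def by (rule degree_sum_le) (auto intro: order.trans[OF degree_smult_le] assms)

lemma degree_line_res_le:
  assumes "\<And>i. degree (P i) \<le> m1" "\<And>i. degree (Q i) \<le> m2"
  shows "degree (line_res d P Q x y) \<le> m1 + m2"
  unfolding line_res_def
  by (intro degree_diff_le order.trans[OF degree_mult_le] add_mono degree_pdot_le assms)

lemma coeff_line_res:
  assumes "\<And>i. degree (P i) \<le> m1" "\<And>i. degree (Q i) \<le> m2"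
  shows "coeff (line_res d P Q x y) (m1 + m2) =
    dotp d (cfp P m1) x * dotp d (cfp Q m2) y - dotp d (cfp P m1) y * dotp d (cfp Q m2) x"
  unfolding line_res_def coeff_diff coeff_pdot[symmetric]
  by (simp add: coeff_mult_degree_le degree_pdot_le assms)

lemma line_res_same_plane:
  assumes "same_plane d P Q z z'" "poly (line_res d P Q x y) z = 0"
  shows "poly (line_res d P Q x y) z' = 0"
proof -
  obtain a b a' b' where *: "\<And>i. i < d \<Longrightarrow> evp P z' i = a * evp P z i + b * evp Q z i"
    "\<And>i. i < d \<Longrightarrow> evp Q z' i = a' * evp P z i + b' * evp Q z i" using assms(1) unfolding same_plane_def by blast
  have P: "dotp d (evp P z') w = a * dotp d (evp P z) w + b * dotp d (evp Q z) w" for w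
    unfolding dotp_lincomb_left[symmetric] unfolding dotp_def by (rule sum.cong) (use *(1) in auto)
  have Q: "dotp d (evp Q z') w = a' * dotp d (evp P z) w + b' * dotp d (evp Q z) w" for w
    unfolding dotp_lincomb_left[symmetric] unfolding dotp_def by (rule sum.cong) (use *(2) in auto)
  have "poly (line_res d P Q x y) z' = (a * b' - a' * b) * poly (line_res d P Q x y) z"
    unfolding line_res_def poly_diff poly_mult poly_pdot P Q by (simp add: algebra_simps)
  then show ?thesis using assms(2) by simp
qed

text \<open>At a simple root of \<open>R\<close> the \<open>2 \<times> 2\<close> matrix of pairings
  therefore has rank exactly one, and its kernel is a single point of the line.\<close>

lemma double_root_line_res:
  assumes "poly (pdot d P x) z = 0" "poly (pdot d P y) z = 0" "poly (pdot d Q x) z = 0" "poly (pdot d Q y) z = 0"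
  shows "poly (pderiv (line_res d P Q x y)) z = 0"
  unfolding line_res_def pderiv_diff pderiv_mult using assms by simp

text \<open>Forms of degree \<open>D - 1\<close> in the coordinates \<open>u\<close>, \<open>v\<close> of the points on a line, followed by
  multiples of \<open>R\<close>: this family is independent if and only if the roots of \<open>R\<close> give at least \<open>D\<close> points.\<close>

definition point_family :: "nat \<Rightarrow> complex poly \<Rightarrow> complex poly \<Rightarrow> complex poly \<Rightarrow> nat \<Rightarrow> complex poly" where
  "point_family D u v R i = (if i < D then u ^ i * v ^ (D - 1 - i) else monom 1 (i - D) * R)"

lemma point_family_sum:
  "(\<Sum>i<D + K. Polynomial.smult (c i) (point_family D u v R i)) =
    (\<Sum>i<D. Polynomial.smult (c i) (u ^ i * v ^ (D - 1 - i))) + (\<Sum>i<K. monom (c (D + i)) i) * R"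
proof -
  have "point_family D u v R i = u ^ i * v ^ (D - 1 - i)" if "i < D" for i
    using that by (simp add: point_family_def)
  moreover have "point_family D u v R (D + i) = monom 1 i * R" for i
    unfolding point_family_def by simp
  ultimately show ?thesis
    unfolding sum_lessThan_add smult_monom_sum[symmetric]
    by (intro arg_cong2[of _ _ _ _ "(+)"] sum.cong refl) simp_all
qed

text \<open>At the \<open>D\<close> points of \<open>Z\<close> the multiples of \<open>R\<close>
  drop out of a relation, and the remaining form of degree \<open>D - 1\<close> has \<open>D\<close>
  projective zeros.\<close>

lemma point_family_indep:
  assumes R: "R \<noteq> 0" and "0 < D" "finite Z" "card Z = D" "\<And>z. z \<in> Z \<Longrightarrow> poly R z = 0"
    and nz: "\<And>z. z \<in> Z \<Longrightarrow> poly u z \<noteq> 0 \<or> poly v z \<noteq> 0"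
    and np: "\<And>z z'. z \<in> Z \<Longrightarrow> z' \<in> Z \<Longrightarrow> poly u z * poly v z' = poly u z' * poly v z \<Longrightarrow> z = z'"
  shows "pindep (D + K) (point_family D u v R)"
  unfolding pindep_def
proof (rule allI, rule impI)
  fix c assume *: "(\<Sum>i<D + K. Polynomial.smult (c i) (point_family D u v R i)) = 0"
  obtain N where N: "D = Suc N" using assms(2) by (cases D) auto
  define q where "q = (\<Sum>i<D. monom (c i) i)"
  define h where "h = (\<Sum>i<K. monom (c (D + i)) i)"
  have cq: "coeff q i = c i" if "i < D" for i using that by (simp add: q_def coeff_monom_sum)
  have "q = 0"
  proof (rule hform_zero[of Z N q "poly u" "poly v"])
    show "degree q \<le> N" unfolding q_def using degree_monom_sum[of D c] N by simp
    fix z assume z: "z \<in> Z"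
    have "0 = poly ((\<Sum>i<D. Polynomial.smult (c i) (u ^ i * v ^ (D - 1 - i))) + h * R) z"
      using * unfolding point_family_sum h_def by simp
    also have "\<dots> = hform N q (poly u z) (poly v z)"
      using assms(5)[OF z] cq unfolding hform_def N lessThan_Suc_atMost
      by (simp add: poly_sum less_Suc_eq_le)
    finally show "hform N q (poly u z) (poly v z) = 0" ..
  qed (use assms N nz np in auto)
  then have q: "c i = 0" if "i < D" for i
    using cq[OF that] by simp
  have "h * R = 0" using * q unfolding point_family_sum h_def by simp
  then have "h = 0" using R by simp
  then have h: "c (D + i) = 0" if "i < K" for i
  proof -
    have "coeff h i = c (D + i)" unfolding h_def coeff_monom_sum using that by simp
    then show ?thesis using \<open>h = 0\<close> by simp
  qed
  show "\<forall>i<D + K. c i = 0"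
  proof (intro allI impI)
    fix i assume "i < D + K"
    then show "c i = 0" using q[of i] h[of "i - D"] by (cases "i < D") auto
  qed
qed

text \<open>If fewer than \<open>D\<close> points accounted for all roots, the product of their
  linear forms would vanish at the roots of the squarefree \<open>R\<close>, hence be a multiple of
  \<open>R\<close>: a nontrivial relation. The bound \<open>K\<close> leaves room for the
  cofactor.\<close>

lemma point_family_indep_imp:
  assumes ind: "pindep (D + K) (point_family D u v R)"
    and R: "R \<noteq> 0" "\<And>z. poly R z = 0 \<Longrightarrow> poly (pderiv R) z \<noteq> 0"
    and K: "\<And>i. i < D \<Longrightarrow> degree (u ^ i * v ^ (D - 1 - i)) < K"
    and A: "finite A" "card A < D" "\<And>a b. (a, b) \<in> A \<Longrightarrow> a \<noteq> 0 \<or> b \<noteq> 0"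
  shows "\<exists>z. poly R z = 0 \<and> (\<forall>(a, b)\<in>A. a * poly u z + b * poly v z \<noteq> 0)"
proof (rule ccontr)
  assume "\<not> ?thesis"
  then have cov: "\<And>z. poly R z = 0 \<Longrightarrow> \<exists>(a, b)\<in>A. a * poly u z + b * poly v z = 0" by blast
  obtain ps where ps: "set ps = A" "distinct ps" using finite_distinct_list[OF A(1)] by blast
  define N where "N = D - 1"
  have D: "D = Suc N" using A(2) by (simp add: N_def)
  \<comment> \<open>The pair \<open>(1, 0)\<close> is the first coordinate form; copies of it fill
    the product up to degree exactly \<open>D - 1\<close>.\<close>
  define qs where "qs = ps @ replicate (N - card A) (1, 0)"
  have lqs: "length qs = N" using A(2) D distinct_card[OF ps(2)] ps(1) by (simp add: qs_def)
  have "a \<noteq> 0 \<or> b \<noteq> 0" if "(a, b) \<in> set qs" for a b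
    using that A(3) ps(1) by (auto simp: qs_def)
  then obtain q where q: "q \<noteq> 0" "degree q \<le> N" "\<And>s t. hform N q s t = (\<Prod>(a, b)\<leftarrow>qs. a * s + b * t)"
    using hform_product[of qs] lqs by auto
  define H where "H = (\<Sum>i<D. Polynomial.smult (coeff q i) (u ^ i * v ^ (D - 1 - i)))"
  have Hz: "poly H z = hform N q (poly u z) (poly v z)" for z
    unfolding H_def hform_def D lessThan_Suc_atMost by (simp add: poly_sum)
  have "R dvd H"
  proof (rule squarefree_dvd[OF R])
    fix z assume "poly R z = 0"
    then obtain a b where "(a, b) \<in> set qs" "a * poly u z + b * poly v z = 0"
      using cov[of z] ps(1) by (auto simp: qs_def)
    then show "poly H z = 0" unfolding Hz q(3) by (auto simp: prod_list_zero_iff image_iff intro!: bexI)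
  qed
  then obtain h where h: "H = R * h" by blast
  have dH: "degree H < K"
  proof -
    have "0 < K" using K[of 0] D by linarith
    moreover have "degree H \<le> K - 1"
      unfolding H_def
    proof (rule degree_sum_le)
      fix i assume "i \<in> {..<D}"
      then have "degree (u ^ i * v ^ (D - 1 - i)) \<le> K - 1" using K[of i] by simp
      then show "degree (Polynomial.smult (coeff q i) (u ^ i * v ^ (D - 1 - i))) \<le> K - 1"
        by (rule order.trans[OF degree_smult_le])
    qed simp
    ultimately show ?thesis by simp
  qed
  have dh: "h = 0 \<or> degree h < K"
  proof (cases "h = 0")
    case False
    then have "degree h \<le> degree H" unfolding h using R(1) by (simp add: degree_mult_eq)
    then show ?thesis using dH by simp
  qed simp
  define c where "c i = (if i < D then coeff q i else - coeff h (i - D))" for i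
  have "(\<Sum>i<K. monom (c (D + i)) i) = - h"
    using dh by (intro poly_eqI) (auto simp: coeff_monom_sum c_def coeff_eq_0)
  moreover have "(\<Sum>i<D. Polynomial.smult (c i) (u ^ i * v ^ (D - 1 - i))) = H"
    unfolding H_def by (rule sum.cong) (auto simp: c_def)
  ultimately have "(\<Sum>i<D + K. Polynomial.smult (c i) (point_family D u v R i)) = 0"
    unfolding point_family_sum h by (simp add: mult.commute)
  then have c0: "\<forall>i<D + K. c i = 0" using ind unfolding pindep_def by blast
  have "coeff q i = 0" if "i \<le> N" for i
    using c0[rule_format, of i] that D by (simp add: c_def)
  then have "lead_coeff q = 0" using q(2) by blast
  then show False using q(1) by simp
qed

text \<open>For a matrix of rank at most one, a nonzero combination of the rows has the same kernel
  as the whole matrix.\<close>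

lemma kernel_point_combination:
  fixes f f' g g' :: complex
  assumes "f * g' - f' * g = 0" "f + t * g \<noteq> 0 \<or> f' + t * g' \<noteq> 0" "a * (f + t * g) + b * (f' + t * g') = 0"
  shows "a * f + b * f' = 0 \<and> a * g + b * g' = 0"
proof -
  let ?u = "f + t * g" and ?v = "f' + t * g'"
  have "?u * (a * f + b * f') = f * (a * ?u + b * ?v) - b * t * (f * g' - f' * g)"
    "?v * (a * f + b * f') = f' * (a * ?u + b * ?v) + a * t * (f * g' - f' * g)"
    "?u * (a * g + b * g') = g * (a * ?u + b * ?v) + b * (f * g' - f' * g)"
    "?v * (a * g + b * g') = g' * (a * ?u + b * ?v) - a * (f * g' - f' * g)"
    by (simp_all add: algebra_simps)
  then show ?thesis using assms by auto
qed

text \<open>The last clause says that the roots give at least \<open>D\<close> different points \<open>(a : b)\<close> of the line: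
  fewer than \<open>D\<close> points miss a root.\<close>

definition transversal_line :: "nat \<Rightarrow> (nat \<Rightarrow> complex poly) \<Rightarrow> (nat \<Rightarrow> complex poly) \<Rightarrow> nat \<Rightarrow>
    complex set \<Rightarrow> nat \<Rightarrow> complex vec \<Rightarrow> complex vec \<Rightarrow> bool" where
  "transversal_line d P Q n B D x y \<longleftrightarrow>
    coeff (line_res d P Q (vec_index x) (vec_index y)) n \<noteq> 0 \<and>
    (\<forall>z. poly (line_res d P Q (vec_index x) (vec_index y)) z = 0 \<longrightarrow>
       poly (pderiv (line_res d P Q (vec_index x) (vec_index y))) z \<noteq> 0) \<and>
    (\<forall>b\<in>B. poly (line_res d P Q (vec_index x) (vec_index y)) b \<noteq> 0) \<and>
    (\<forall>A. finite A \<longrightarrow> card A < D \<longrightarrow> (\<forall>(a, b)\<in>A. a \<noteq> 0 \<or> b \<noteq> 0) \<longrightarrow>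
      (\<exists>z. poly (line_res d P Q (vec_index x) (vec_index y)) z = 0 \<and>
        (\<forall>(a, b)\<in>A. \<not> (a * poly (pdot d P (vec_index x)) z + b * poly (pdot d P (vec_index y)) z = 0 \<and>
                        a * poly (pdot d Q (vec_index x)) z + b * poly (pdot d Q (vec_index y)) z = 0))))"

text \<open>All properties of the good line are rewritten as open conditions at
  \<open>(x0, y0)\<close>; the product of the four polynomial functions is \<open>F\<close>. The
  number \<open>D\<close> counts the \<open>E\<close>-classes of the roots.\<close>

lemma generic_line_points:
  fixes P Q :: "nat \<Rightarrow> complex poly"
  assumes deg: "\<And>i. degree (P i) \<le> m1" "\<And>i. degree (Q i) \<le> m2" and n: "n = m1 + m2" "n > 0"
    and good: "good_line d P Q n B E x0 y0" and E: "equivp E"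
    and B: "finite B" "\<And>z. z \<notin> B \<Longrightarrow> card {z'. E z z'} = k" and Es: "\<And>z z'. E z z' \<Longrightarrow> same_plane d P Q z z'"
  shows "\<exists>F D. polynomial_fun2 d F \<and> F (vec d x0) (vec d y0) \<noteq> 0 \<and> k * D = n \<and>
    (\<forall>x y. F x y \<noteq> 0 \<longrightarrow> transversal_line d P Q n B D x y)"
proof -
  let ?R = "\<lambda>x y. line_res d P Q (vec_index x) (vec_index y)"
  let ?x0 = "vec d x0" and ?y0 = "vec d y0"
  have pd: "pdot d S (vec_index (vec d w)) = pdot d S w" for S and w :: "nat \<Rightarrow> complex"
    unfolding pdot_def by (rule sum.cong) auto
  define R0 where "R0 = line_res d P Q x0 y0"
  have R0: "?R ?x0 ?y0 = R0" unfolding R0_def line_res_def pd ..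
  note g = good[unfolded good_line_def, folded R0_def]
  have R0n: "coeff R0 n \<noteq> 0" by (rule conjunct1[OF g])
  have R0sq: "poly (pderiv R0) z \<noteq> 0" if "poly R0 z = 0" for z
    using g[THEN conjunct2, THEN conjunct1] that by blast
  have R0B: "poly R0 b \<noteq> 0" if "b \<in> B" for b
    using g[THEN conjunct2, THEN conjunct2, THEN conjunct1] that by blast
  have R0E: "E z z'" if "poly R0 z = 0" "poly R0 z' = 0" "a \<noteq> 0 \<or> b \<noteq> 0"
    "\<forall>w\<in>{z, z'}. a * poly (pdot d P x0) w + b * poly (pdot d P y0) w = 0 \<and>
                 a * poly (pdot d Q x0) w + b * poly (pdot d Q y0) w = 0" for z z' a b
    using g[THEN conjunct2, THEN conjunct2, THEN conjunct2] that by blast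
  have degR': "degree (?R x y) \<le> n" for x y
    unfolding n(1) by (rule degree_line_res_le) (use deg in auto)
  have degR: "degree (?R x y) = n" if "coeff (?R x y) n \<noteq> 0" for x y
    using degR' le_degree[OF that] by (simp add: le_antisym)
  have nz: "R0 \<noteq> 0" using R0n by auto
  have dR0: "degree R0 = n" using degR[of ?x0 ?y0] R0n R0 by simp
  define Z where "Z = {z. poly R0 z = 0}"
  have finZ: "finite Z" unfolding Z_def by (rule poly_roots_finite[OF nz])
  have cardZ: "card Z = n" using card_roots_squarefree[OF nz R0sq] dR0 unfolding Z_def by simp
  define C where "C = (\<lambda>z. {z'. E z z'}) ` Z"
  define D where "D = card C"
  have kD: "k * D = n"
    unfolding D_def C_def cardZ[symmetric]
  proof (rule class_count[OF finZ _ _ E])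
    show "card {z'. E z z'} = k" if "z \<in> Z" for z using that R0B B(2)[of z] unfolding Z_def by auto
    show "{z'. E z z'} \<subseteq> Z" if "z \<in> Z" for z
      using that Es line_res_same_plane[of d P Q z _ x0 y0] unfolding Z_def R0_def by blast
  qed
  have D0: "0 < D" using kD n(2) by (cases D) auto
  \<comment> \<open>The value \<open>\<theta>\<close> is chosen such that, at a root, the combined
    pairing with \<open>x0\<close> vanishes only if both separate pairings do, and likewise for
    \<open>y0\<close>.\<close>
  define S where "S x = (\<lambda>z. (poly (pdot d P x) z, poly (pdot d Q x) z)) `
      {z \<in> Z. poly (pdot d P x) z \<noteq> 0 \<or> poly (pdot d Q x) z \<noteq> 0}" for x
  have "\<exists>\<theta>. \<forall>(a, b)\<in>S x0 \<union> S y0. a + \<theta> * b \<noteq> 0"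
  proof (rule avoid_countable_lines)
    have "finite (S x)" for x unfolding S_def using finZ by simp
    then show "countable (S x0 \<union> S y0)" by (simp add: countable_finite)
    show "a \<noteq> 0 \<or> b \<noteq> 0" if "(a, b) \<in> S x0 \<union> S y0" for a b using that unfolding S_def by auto
  qed
  then obtain \<theta> where \<theta>S: "\<forall>(a, b)\<in>S x0 \<union> S y0. a + \<theta> * b \<noteq> 0" by blast
  have \<theta>: "poly (pdot d P x) z + \<theta> * poly (pdot d Q x) z \<noteq> 0"
    if "x = x0 \<or> x = y0" "z \<in> Z" "poly (pdot d P x) z \<noteq> 0 \<or> poly (pdot d Q x) z \<noteq> 0" for x z
  proof -
    have "(poly (pdot d P x) z, poly (pdot d Q x) z) \<in> S x0 \<union> S y0"
      using that unfolding S_def by blast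
    from bspec[OF \<theta>S this] show ?thesis by simp
  qed
  \<comment> \<open>One combination of the two rows replaces the matrix, so
    \<open>(u x : u y)\<close> determines the intersection point by polynomials in the parameter
    whose degrees are bounded independently of \<open>x\<close> and \<open>y\<close>.\<close>
  define u where "u x = pdot d P x + [:\<theta>:] * pdot d Q x" for x
  have uz: "poly (u x) z = poly (pdot d P x) z + \<theta> * poly (pdot d Q x) z" for x z by (simp add: u_def)
  have nzu: "poly (u x0) z \<noteq> 0 \<or> poly (u y0) z \<noteq> 0" if "z \<in> Z" for z
  proof (rule ccontr)
    assume "\<not> ?thesis"
    then have "poly (pdot d P x0) z = 0" "poly (pdot d Q x0) z = 0" "poly (pdot d P y0) z = 0" "poly (pdot d Q y0) z = 0"
      using \<theta>[of x0 z] \<theta>[of y0 z] that unfolding uz by blast+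
    then have "poly (pderiv R0) z = 0" unfolding R0_def by (intro double_root_line_res)
    then show False using R0sq that unfolding Z_def by blast
  qed
  define rp where "rp c = (SOME z. z \<in> Z \<and> c = {z'. E z z'})" for c
  have rp: "rp c \<in> Z" "c = {z'. E (rp c) z'}" if "c \<in> C" for c
  proof -
    have "\<exists>z. z \<in> Z \<and> c = {z'. E z z'}" using that unfolding C_def by blast
    from someI_ex[OF this] show "rp c \<in> Z" "c = {z'. E (rp c) z'}" unfolding rp_def by blast+
  qed
  define Z1 where "Z1 = rp ` C"
  have injrp: "inj_on rp C" by (rule inj_onI) (metis rp(2))
  have Z1: "finite Z1" "card Z1 = D" "Z1 \<subseteq> Z"
    unfolding Z1_def D_def using finZ C_def card_image[OF injrp] rp(1) by auto
  have np: "z = z'" if z: "z \<in> Z1" "z' \<in> Z1" and eq: "poly (u x0) z * poly (u y0) z' = poly (u x0) z' * poly (u y0) z" for z z'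
  proof -
    have zZ: "z \<in> Z" "z' \<in> Z" using z Z1(3) by auto
    define a b where "a = poly (u y0) z" and "b = - poly (u x0) z"
    have ab: "a \<noteq> 0 \<or> b \<noteq> 0" using nzu[OF zZ(1)] unfolding a_def b_def by auto
    have ker: "a * poly (pdot d P x0) w + b * poly (pdot d P y0) w = 0 \<and>
               a * poly (pdot d Q x0) w + b * poly (pdot d Q y0) w = 0"
      if w: "w \<in> Z" "a * poly (u x0) w + b * poly (u y0) w = 0" for w
    proof (rule kernel_point_combination[where t = \<theta>])
      show "poly (pdot d P x0) w * poly (pdot d Q y0) w - poly (pdot d P y0) w * poly (pdot d Q x0) w = 0"
        using w(1) unfolding Z_def R0_def line_res_def by simp
    qed (use nzu[OF w(1)] w(2) in \<open>auto simp: uz\<close>)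
    have "a * poly (u x0) z + b * poly (u y0) z = 0" "a * poly (u x0) z' + b * poly (u y0) z' = 0"
      using eq unfolding a_def b_def by (simp_all add: algebra_simps)
    then have "\<forall>w\<in>{z, z'}. a * poly (pdot d P x0) w + b * poly (pdot d P y0) w = 0 \<and>
                     a * poly (pdot d Q x0) w + b * poly (pdot d Q y0) w = 0"
      using ker zZ by blast
    with zZ ab have Ezz: "E z z'" unfolding Z_def by (intro R0E) simp_all
    obtain c c' where c: "c \<in> C" "z = rp c" "c' \<in> C" "z' = rp c'" using z unfolding Z1_def by blast
    have "c = c'" using rp(2)[OF c(1)] rp(2)[OF c(3)] Ezz c(2,4) equivp_symp[OF E] equivp_transp[OF E] by blast
    then show ?thesis using c by simp
  qed
  let ?m = "max m1 m2"
  have degu: "degree (u x) \<le> ?m" for x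
    unfolding u_def
    by (rule degree_add_le)
      (use degree_pdot_le[of P m1 d x] degree_pdot_le[of Q m2 d x] deg in \<open>auto intro: order.trans[OF degree_smult_le]\<close>)
  define K where "K = Suc (?m * (D - 1))"
  have Kd: "degree (u x ^ i * u y ^ (D - 1 - i)) < K" if "i < D" for x y i
  proof -
    have "degree (u x ^ i * u y ^ (D - 1 - i)) \<le> degree (u x) * i + degree (u y) * (D - 1 - i)"
      by (rule order.trans[OF degree_mult_le]) (intro add_mono degree_power_le)
    also have "\<dots> \<le> ?m * i + ?m * (D - 1 - i)" by (intro add_mono mult_right_mono degu) auto
    also have "\<dots> = ?m * (D - 1)" using that by (simp flip: distrib_left)
    finally show ?thesis unfolding K_def by simp
  qed
  have pfu: "pf2_poly d (\<lambda>x y. u (vec_index x))" "pf2_poly d (\<lambda>x y. u (vec_index y))"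
    unfolding u_def
    by (intro pf2_poly_add pf2_poly_mult pf2_poly_const pf2_poly_pdot1 pf2_poly_pdot2)+
  have uv: "u (vec_index ?x0) = u x0" "u (vec_index ?y0) = u y0" unfolding u_def pd by auto
  obtain F1 where F1: "polynomial_fun2 d F1" "F1 ?x0 ?y0 \<noteq> 0"
    "\<And>x y. F1 x y \<noteq> 0 \<Longrightarrow> pindep ((n - 1) + n) (sylvester_family n (?R x y))"
  proof -
    have "pf2_poly d (\<lambda>x y. sylvester_family n (?R x y) i)" for i
      unfolding sylvester_family_def
      by (cases "i < n - 1") (auto intro!: pf2_poly_mult pf2_poly_const pf2_poly_pderiv pf2_poly_line_res)
    moreover have "pindep ((n - 1) + n) (sylvester_family n (?R ?x0 ?y0))"
      unfolding R0 using sylvester_squarefree[OF nz dR0 n(2)] R0sq by blast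
    ultimately show ?thesis
      using pindep_open[of "(n - 1) + n" d "\<lambda>i x y. sylvester_family n (?R x y) i" ?x0 ?y0] that by blast
  qed
  obtain F2 where F2: "polynomial_fun2 d F2" "F2 ?x0 ?y0 \<noteq> 0"
    "\<And>x y. F2 x y \<noteq> 0 \<Longrightarrow> pindep (D + K) (point_family D (u (vec_index x)) (u (vec_index y)) (?R x y))"
  proof -
    have "pf2_poly d (\<lambda>x y. point_family D (u (vec_index x)) (u (vec_index y)) (?R x y) i)" for i
      unfolding point_family_def using pfu
      by (cases "i < D") (auto intro!: pf2_poly_mult pf2_poly_const pf2_poly_power pf2_poly_line_res)
    moreover have "pindep (D + K) (point_family D (u (vec_index ?x0)) (u (vec_index ?y0)) (?R ?x0 ?y0))"
      unfolding R0 uv by (rule point_family_indep[OF nz D0 Z1(1,2)]) (use Z1(3) nzu np Z_def in auto)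
    ultimately show ?thesis
      using pindep_open[of "D + K" d "\<lambda>i x y. point_family D (u (vec_index x)) (u (vec_index y)) (?R x y) i" ?x0 ?y0] that by blast
  qed
  have F3: "polynomial_fun2 d (\<lambda>x y. coeff (?R x y) n)" by (rule pf2_coeff[OF pf2_poly_line_res])
  have pR: "poly (?R x y) b = (\<Sum>i\<le>n. coeff (?R x y) i * b ^ i)" for x y b
    unfolding poly_altdef using degR'[of x y]
    by (intro sum.mono_neutral_left) (auto intro: coeff_eq_0)
  have F4: "polynomial_fun2 d (\<lambda>x y. \<Prod>b\<in>B. poly (?R x y) b)"
    unfolding pR by (intro pf2_prod pf2_sum pf2_mult pf2_const pf2_coeff pf2_poly_line_res)
  define F where "F x y = F1 x y * F2 x y * coeff (?R x y) n * (\<Prod>b\<in>B. poly (?R x y) b)" for x y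
  have "polynomial_fun2 d F" unfolding F_def using F1(1) F2(1) F3 F4 by (intro pf2_mult)
  moreover have "F ?x0 ?y0 \<noteq> 0"
    unfolding F_def R0 using F1(2) F2(2) R0n R0B B(1) by simp
  moreover have "transversal_line d P Q n B D x y"
    if F: "F x y \<noteq> 0" for x y
  proof -
    have f: "F1 x y \<noteq> 0" "F2 x y \<noteq> 0" "coeff (?R x y) n \<noteq> 0" "\<forall>b\<in>B. poly (?R x y) b \<noteq> 0"
      using F B(1) unfolding F_def by auto
    have Rnz: "?R x y \<noteq> 0" using f(3) by auto
    have sq: "poly (pderiv (?R x y)) z \<noteq> 0" if "poly (?R x y) z = 0" for z
      using sylvester_squarefree[OF Rnz degR[OF f(3)] n(2)] F1(3)[OF f(1)] that by blast
    have "\<exists>z. poly (?R x y) z = 0 \<and>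
          (\<forall>(a, b)\<in>A. \<not> (a * poly (pdot d P (vec_index x)) z + b * poly (pdot d P (vec_index y)) z = 0 \<and>
                          a * poly (pdot d Q (vec_index x)) z + b * poly (pdot d Q (vec_index y)) z = 0))"
      if A: "finite A" "card A < D" "\<forall>(a, b)\<in>A. a \<noteq> 0 \<or> b \<noteq> 0" for A
    proof -
      obtain z where z: "poly (?R x y) z = 0" "\<forall>(a, b)\<in>A. a * poly (u (vec_index x)) z + b * poly (u (vec_index y)) z \<noteq> 0"
        using point_family_indep_imp[OF F2(3)[OF f(2)] Rnz sq Kd A(1,2)] A(3) by blast
      have "\<not> (a * poly (pdot d P (vec_index x)) z + b * poly (pdot d P (vec_index y)) z = 0 \<and>
                a * poly (pdot d Q (vec_index x)) z + b * poly (pdot d Q (vec_index y)) z = 0)" if "(a, b) \<in> A" for a b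
      proof
        assume *: "a * poly (pdot d P (vec_index x)) z + b * poly (pdot d P (vec_index y)) z = 0 \<and>
                a * poly (pdot d Q (vec_index x)) z + b * poly (pdot d Q (vec_index y)) z = 0"
        have "a * poly (u (vec_index x)) z + b * poly (u (vec_index y)) z =
          (a * poly (pdot d P (vec_index x)) z + b * poly (pdot d P (vec_index y)) z) +
          \<theta> * (a * poly (pdot d Q (vec_index x)) z + b * poly (pdot d Q (vec_index y)) z)"
          unfolding uz by (simp add: algebra_simps)
        also have "\<dots> = 0" using * by simp
        finally show False using bspec[OF z(2) that] by simp
      qed
      then show ?thesis using z(1) by blast
    qed
    then show ?thesis unfolding transversal_line_def using f(3,4) sq by blast
  qed
  ultimately show ?thesis using kD by (intro exI[of _ F] exI[of _ D]) blast
qed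

section \<open>The points of a line on the hypersurface\<close>

lemma proj_pt_scale: "c \<noteq> 0 \<Longrightarrow> proj_pt (c \<cdot>\<^sub>v v) = proj_pt v"
proof -
  assume c: "c \<noteq> 0"
  have "e \<cdot>\<^sub>v v = (e / c) \<cdot>\<^sub>v (c \<cdot>\<^sub>v v)" for e using c by (simp add: smult_smult_assoc)
  moreover have "e \<cdot>\<^sub>v (c \<cdot>\<^sub>v v) = (e * c) \<cdot>\<^sub>v v" for e by (simp add: smult_smult_assoc)
  ultimately show ?thesis unfolding proj_pt_def by (metis (no_types, lifting))
qed

lemma proj_pt_eqD:
  assumes "proj_pt v = proj_pt w" shows "\<exists>c. v = c \<cdot>\<^sub>v w"
proof -
  have "v \<in> proj_pt v" unfolding proj_pt_def by (auto intro!: exI[of _ 1])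
  then show ?thesis using assms unfolding proj_pt_def by auto
qed

lemma proportional_pair:
  assumes "a * b' = a' * (b :: 'a::field)" "a \<noteq> 0 \<or> b \<noteq> 0" "a' \<noteq> 0 \<or> b' \<noteq> 0"
  shows "\<exists>c. c \<noteq> 0 \<and> a' = c * a \<and> b' = c * b"
proof (cases "a = 0")
  case True
  then have "b \<noteq> 0" "a' = 0" "b' \<noteq> 0" using assms by auto
  then show ?thesis using True by (intro exI[of _ "b' / b"]) simp
next
  case False
  have "a' \<noteq> 0" using assms False by auto
  then show ?thesis using False assms(1) by (intro exI[of _ "a' / a"]) (simp add: field_simps)
qed

lemma dotp_vec_lincomb:
  assumes "x \<in> carrier_vec d" "y \<in> carrier_vec d"
  shows "dotp d f (vec_index (a \<cdot>\<^sub>v x + b \<cdot>\<^sub>v y)) = a * dotp d f (vec_index x) + b * dotp d f (vec_index y)"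
proof -
  have "dotp d f (vec_index (a \<cdot>\<^sub>v x + b \<cdot>\<^sub>v y)) = dotp d f (\<lambda>i. a * vec_index x i + b * vec_index y i)"
    unfolding dotp_def by (rule sum.cong) (use assms in auto)
  then show ?thesis by (simp add: dotp_lincomb_right)
qed

lemma indep_pair_lincomb_eq:
  fixes x y :: "complex vec"
  assumes xy: "x \<in> carrier_vec d" "y \<in> carrier_vec d" "indep_pair d x y"
    and eq: "a \<cdot>\<^sub>v x + b \<cdot>\<^sub>v y = c \<cdot>\<^sub>v (a' \<cdot>\<^sub>v x + b' \<cdot>\<^sub>v y)"
  shows "a = c * a' \<and> b = c * b'"
proof -
  have "(a - c * a') \<cdot>\<^sub>v x + (b - c * b') \<cdot>\<^sub>v y = 0\<^sub>v d"
  proof (rule eq_vecI)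
    fix i assume i: "i < dim_vec (0\<^sub>v d :: complex vec)"
    then have "vec_index (a \<cdot>\<^sub>v x + b \<cdot>\<^sub>v y) i = vec_index (c \<cdot>\<^sub>v (a' \<cdot>\<^sub>v x + b' \<cdot>\<^sub>v y)) i" using eq by simp
    then show "vec_index ((a - c * a') \<cdot>\<^sub>v x + (b - c * b') \<cdot>\<^sub>v y) i = vec_index (0\<^sub>v d) i"
      using i xy(1,2) by (simp add: algebra_simps)
  qed (use xy in simp)
  then have "a - c * a' = 0 \<and> b - c * b' = 0" using xy(3) unfolding indep_pair_def by blast
  then show ?thesis by simp
qed

lemma kernel_exists:
  fixes f g f' g' :: "'a::field"
  assumes "f * g' - f' * g = 0"
  shows "\<exists>a b. (a \<noteq> 0 \<or> b \<noteq> 0) \<and> a * f + b * f' = 0 \<and> a * g + b * g' = 0"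
proof (cases "f = 0 \<and> f' = 0")
  case True
  show ?thesis
  proof (cases "g = 0 \<and> g' = 0")
    case True
    then show ?thesis using \<open>f = 0 \<and> f' = 0\<close> by (intro exI[of _ 1] exI[of _ 0]) simp
  next
    case False
    then show ?thesis using True by (intro exI[of _ "g'"] exI[of _ "- g"]) auto
  qed
next
  case False
  then show ?thesis using assms by (intro exI[of _ "f'"] exI[of _ "- f"]) (auto simp: algebra_simps)
qed

lemma kernel_proportional:
  fixes f g f' g' :: "'a::field"
  assumes "f \<noteq> 0 \<or> f' \<noteq> 0 \<or> g \<noteq> 0 \<or> g' \<noteq> 0"
    and "a * f + b * f' = 0" "a * g + b * g' = 0" "a' * f + b' * f' = 0" "a' * g + b' * g' = 0"
  shows "a * b' = a' * b"
proof -
  have "(a * b' - a' * b) * f = b' * (a * f + b * f') - b * (a' * f + b' * f')"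
    "(a * b' - a' * b) * f' = a * (a' * f + b' * f') - a' * (a * f + b * f')"
    "(a * b' - a' * b) * g = b' * (a * g + b * g') - b * (a' * g + b' * g')"
    "(a * b' - a' * b) * g' = a * (a' * g + b' * g') - a' * (a * g + b * g')"
    by (simp_all add: algebra_simps)
  then show ?thesis using assms by auto
qed

text \<open>The map \<open>\<phi>\<close> sends a root to the unique point of the line on its
  ruling. It is constant on the \<open>D\<close> classes of \<open>E\<close>, so there are at most
  \<open>D\<close> points; the last clause of \<open>transversal_line\<close> excludes
  fewer.\<close>

lemma line_section_card:
  fixes P Q :: "nat \<Rightarrow> complex poly" and L :: "complex \<times> complex \<Rightarrow> complex vec set"
  assumes deg: "\<And>i. degree (P i) \<le> m1" "\<And>i. degree (Q i) \<le> m2" and n: "n = m1 + m2" "n > 0"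
    and E: "equivp E" and B: "\<And>z. z \<notin> B \<Longrightarrow> card {z'. E z z'} = k"
    and Es: "\<And>z z'. E z z' \<Longrightarrow> same_plane d P Q z z'"
    and Lz: "\<And>z. L (z, 1) = {v \<in> carrier_vec d. dotp d (evp P z) (vec_index v) = 0 \<and> dotp d (evp Q z) (vec_index v) = 0}"
    and Linf: "L (1, 0) \<subseteq> {v \<in> carrier_vec d. dotp d (cfp P m1) (vec_index v) = 0 \<and> dotp d (cfp Q m2) (vec_index v) = 0}"
    and xy: "x \<in> carrier_vec d" "y \<in> carrier_vec d" "indep_pair d x y"
    and kD: "k * D = n"
    and trans: "transversal_line d P Q n B D x y"
    and X: "X = (\<Union>t\<in>params. proj d (L t))"
  shows "finite (line_through d x y \<inter> X) \<and> card (line_through d x y \<inter> X) = D"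
proof -
  note tr = trans[unfolded transversal_line_def]
  note R = tr[THEN conjunct1] tr[THEN conjunct2, THEN conjunct1, rule_format]
    tr[THEN conjunct2, THEN conjunct2, THEN conjunct1, rule_format]
  note cover = tr[THEN conjunct2, THEN conjunct2, THEN conjunct2, rule_format]
  define R where "R = line_res d P Q (vec_index x) (vec_index y)"
  define f where "f z = poly (pdot d P (vec_index x)) z" for z
  define f' where "f' z = poly (pdot d P (vec_index y)) z" for z
  define g where "g z = poly (pdot d Q (vec_index x)) z" for z
  define g' where "g' z = poly (pdot d Q (vec_index y)) z" for z
  define Z where "Z = {z. poly R z = 0}"
  have Rz: "poly R z = f z * g' z - f' z * g z" for z
    unfolding R_def line_res_def f_def f'_def g_def g'_def by simp
  have Rnz: "R \<noteq> 0" using R(1) unfolding R_def by auto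
  have degR: "degree R = n"
  proof -
    have "degree R \<le> n" unfolding R_def n(1) by (rule degree_line_res_le) (use deg in auto)
    then show ?thesis using le_degree[of R n] R(1) unfolding R_def by simp
  qed
  have finZ: "finite Z" unfolding Z_def by (rule poly_roots_finite[OF Rnz])
  have cardZ: "card Z = n"
    using card_roots_squarefree[OF Rnz] R(2) degR unfolding Z_def R_def by blast
  let ?pt = "\<lambda>a b. a \<cdot>\<^sub>v x + b \<cdot>\<^sub>v y"
  have ptc: "?pt a b \<in> carrier_vec d" for a b using xy by simp
  have pt0: "?pt a b \<noteq> 0\<^sub>v d" if "a \<noteq> 0 \<or> b \<noteq> 0" for a b using xy(3) that unfolding indep_pair_def by blast
  have ptL: "?pt a b \<in> L (z, 1) \<longleftrightarrow> a * f z + b * f' z = 0 \<and> a * g z + b * g' z = 0" for a b z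
    using ptc[of a b] unfolding Lz f_def f'_def g_def g'_def by (simp add: dotp_vec_lincomb[OF xy(1,2)] poly_pdot)
  have "\<forall>z\<in>Z. \<exists>a b. (a \<noteq> 0 \<or> b \<noteq> 0) \<and> a * f z + b * f' z = 0 \<and> a * g z + b * g' z = 0"
  proof
    fix z assume "z \<in> Z"
    then have "f z * g' z - f' z * g z = 0" unfolding Z_def Rz by simp
    then show "\<exists>a b. (a \<noteq> 0 \<or> b \<noteq> 0) \<and> a * f z + b * f' z = 0 \<and> a * g z + b * g' z = 0"
      by (rule kernel_exists)
  qed
  then obtain \<alpha> \<beta> where ker: "\<And>z. z \<in> Z \<Longrightarrow> \<alpha> z \<noteq> 0 \<or> \<beta> z \<noteq> 0"
    "\<And>z. z \<in> Z \<Longrightarrow> \<alpha> z * f z + \<beta> z * f' z = 0" "\<And>z. z \<in> Z \<Longrightarrow> \<alpha> z * g z + \<beta> z * g' z = 0"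
    by metis
  have rank1: "f z \<noteq> 0 \<or> f' z \<noteq> 0 \<or> g z \<noteq> 0 \<or> g' z \<noteq> 0" if "z \<in> Z" for z
  proof (rule ccontr)
    assume "\<not> ?thesis"
    then have "poly (pderiv R) z = 0"
      unfolding R_def f_def f'_def g_def g'_def by (intro double_root_line_res) auto
    then show False using R(2)[of z] that unfolding Z_def R_def by blast
  qed
  define \<phi> where "\<phi> z = proj_pt (?pt (\<alpha> z) (\<beta> z))" for z
  have uniq: "proj_pt (?pt a b) = \<phi> z"
    if z: "z \<in> Z" and ab: "a \<noteq> 0 \<or> b \<noteq> 0" "a * f z + b * f' z = 0" "a * g z + b * g' z = 0" for z a b
  proof -
    have "\<alpha> z * b = a * \<beta> z"
      by (rule kernel_proportional[OF rank1[OF z] ker(2)[OF z] ker(3)[OF z] ab(2,3)])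
    then obtain c where c: "c \<noteq> 0" "a = c * \<alpha> z" "b = c * \<beta> z"
      using proportional_pair ker(1)[OF z] ab(1) by blast
    have "?pt a b = c \<cdot>\<^sub>v ?pt (\<alpha> z) (\<beta> z)"
      unfolding c using xy by (intro eq_vecI) (auto simp: algebra_simps)
    then show ?thesis unfolding \<phi>_def using proj_pt_scale[OF c(1)] by simp
  qed
  have sec: "line_through d x y \<inter> X = \<phi> ` Z"
  proof (intro equalityI subsetI)
    fix p assume "p \<in> \<phi> ` Z"
    then obtain z where z: "z \<in> Z" "p = \<phi> z" by blast
    have "?pt (\<alpha> z) (\<beta> z) \<in> L (z, 1) - {0\<^sub>v d}" using ptL ker[OF z(1)] pt0 by auto
    then have "p \<in> proj d (L (z, 1))" unfolding z(2) \<phi>_def proj_def by blast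
    moreover have "(z, 1) \<in> params" unfolding params_def by blast
    moreover have "p \<in> line_through d x y"
      unfolding z(2) \<phi>_def line_through_def proj_def using pt0[OF ker(1)[OF z(1)]] by blast
    ultimately show "p \<in> line_through d x y \<inter> X" unfolding X by blast
  next
    fix p assume p: "p \<in> line_through d x y \<inter> X"
    then obtain a b where ab: "p = proj_pt (?pt a b)" "?pt a b \<noteq> 0\<^sub>v d"
      unfolding line_through_def proj_def by blast
    have ab0: "a \<noteq> 0 \<or> b \<noteq> 0"
    proof (rule ccontr)
      assume "\<not> ?thesis"
      then have "?pt a b = 0\<^sub>v d" using xy by auto
      then show False using ab(2) by simp
    qed
    obtain t w where t: "t \<in> params" "w \<in> L t" "p = proj_pt w" using p unfolding X proj_def by blast
    obtain c where c: "?pt a b = c \<cdot>\<^sub>v w" using proj_pt_eqD ab(1) t(3) by metis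
    have dw: "dotp d h (vec_index (c \<cdot>\<^sub>v w)) = c * dotp d h (vec_index w)" if "w \<in> carrier_vec d" for h
      unfolding dotp_def sum_distrib_left by (rule sum.cong) (use that in auto)
    consider "t = (1, 0)" | z where "t = (z, 1)" using t(1) unfolding params_def by blast
    then show "p \<in> \<phi> ` Z"
    proof cases
      case 1
      then have w: "w \<in> carrier_vec d" "dotp d (cfp P m1) (vec_index w) = 0" "dotp d (cfp Q m2) (vec_index w) = 0"
        using t(2) Linf by auto
      let ?p1 = "dotp d (cfp P m1) (vec_index x)" and ?p2 = "dotp d (cfp P m1) (vec_index y)"
      let ?q1 = "dotp d (cfp Q m2) (vec_index x)" and ?q2 = "dotp d (cfp Q m2) (vec_index y)"
      have 0: "a * ?p1 + b * ?p2 = 0" "a * ?q1 + b * ?q2 = 0"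
        unfolding dotp_vec_lincomb[OF xy(1,2), symmetric] c dw[OF w(1)] w(2,3) by simp_all
      \<comment> \<open>The leading coefficient of \<open>R\<close> is the determinant of the
        pairings at infinity; as it is nonzero, the line misses the ruling there.\<close>
      have "coeff (line_res d P Q (vec_index x) (vec_index y)) (m1 + m2) = ?p1 * ?q2 - ?p2 * ?q1"
        by (rule coeff_line_res) (use deg in auto)
      then have nz: "?p1 * ?q2 - ?p2 * ?q1 \<noteq> 0" using R(1) n(1) by simp
      have "a * (?p1 * ?q2 - ?p2 * ?q1) = ?q2 * (a * ?p1 + b * ?p2) - ?p2 * (a * ?q1 + b * ?q2)"
        "b * (?p1 * ?q2 - ?p2 * ?q1) = ?p1 * (a * ?q1 + b * ?q2) - ?q1 * (a * ?p1 + b * ?p2)"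
        by (simp_all add: algebra_simps)
      then have "a = 0 \<and> b = 0" unfolding 0 using nz by simp
      then show ?thesis using ab0 by simp
    next
      case 2
      then have w: "w \<in> carrier_vec d" "dotp d (evp P z) (vec_index w) = 0" "dotp d (evp Q z) (vec_index w) = 0"
        using t(2) Lz by auto
      have "c \<cdot>\<^sub>v w \<in> L (z, 1)" unfolding Lz using w dw[OF w(1)] by simp
      then have k: "a * f z + b * f' z = 0" "a * g z + b * g' z = 0" using c ptL by metis+
      have "a * (f z * g' z - f' z * g z) = g' z * (a * f z + b * f' z) - f' z * (a * g z + b * g' z)"
        "b * (f z * g' z - f' z * g z) = f z * (a * g z + b * g' z) - g z * (a * f z + b * f' z)"
        by (simp_all add: algebra_simps)
      then have "poly R z = 0" unfolding Rz k using ab0 by auto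
      then have z: "z \<in> Z" unfolding Z_def by simp
      show ?thesis using uniq[OF z ab0 k] ab(1) z by blast
    qed
  qed
  have closed: "z' \<in> Z" if "z \<in> Z" "E z z'" for z z'
    using that line_res_same_plane[OF Es[OF that(2)]] unfolding Z_def R_def by blast
  have \<phi>E: "\<phi> z = \<phi> z'" if z: "z \<in> Z" and zz: "E z z'" for z z'
  proof -
    obtain a b a' b' where *: "\<And>i. i < d \<Longrightarrow> evp P z' i = a * evp P z i + b * evp Q z i"
      "\<And>i. i < d \<Longrightarrow> evp Q z' i = a' * evp P z i + b' * evp Q z i" using Es[OF zz] unfolding same_plane_def by blast
    have P: "dotp d (evp P z') w = a * dotp d (evp P z) w + b * dotp d (evp Q z) w" for w
      unfolding dotp_lincomb_left[symmetric] unfolding dotp_def by (rule sum.cong) (use *(1) in auto)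
    have Q: "dotp d (evp Q z') w = a' * dotp d (evp P z) w + b' * dotp d (evp Q z) w" for w
      unfolding dotp_lincomb_left[symmetric] unfolding dotp_def by (rule sum.cong) (use *(2) in auto)
    have lin: "f z' = a * f z + b * g z" "f' z' = a * f' z + b * g' z"
      "g z' = a' * f z + b' * g z" "g' z' = a' * f' z + b' * g' z"
      unfolding f_def f'_def g_def g'_def poly_pdot P Q by auto
    have "\<alpha> z * f z' + \<beta> z * f' z' = a * (\<alpha> z * f z + \<beta> z * f' z) + b * (\<alpha> z * g z + \<beta> z * g' z)"
      "\<alpha> z * g z' + \<beta> z * g' z' = a' * (\<alpha> z * f z + \<beta> z * f' z) + b' * (\<alpha> z * g z + \<beta> z * g' z)"
      unfolding lin by (simp_all add: algebra_simps)
    then have "\<alpha> z * f z' + \<beta> z * f' z' = 0" "\<alpha> z * g z' + \<beta> z * g' z' = 0"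
      using ker(2,3)[OF z] by simp_all
    from uniq[OF closed[OF z zz] ker(1)[OF z] this] show ?thesis unfolding \<phi>_def .
  qed
  let ?C = "(\<lambda>z. {z'. E z z'}) ` Z"
  have "k * card ?C = card Z"
  proof (rule class_count[OF finZ _ _ E])
    show "card {z'. E z z'} = k" if "z \<in> Z" for z
      using that R(3) B[of z] unfolding Z_def R_def by auto
    show "{z'. E z z'} \<subseteq> Z" if "z \<in> Z" for z using closed that by blast
  qed
  then have "k * card ?C = k * D" using cardZ kD by simp
  moreover have "k \<noteq> 0" using kD n(2) by auto
  ultimately have cardC: "card ?C = D" by simp
  have "\<phi> ` Z = (\<lambda>c. \<phi> (SOME w. w \<in> c)) ` ?C"
  proof -
    have "\<phi> (SOME w. w \<in> {z'. E z z'}) = \<phi> z" if "z \<in> Z" for z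
    proof -
      have "(SOME w. w \<in> {z'. E z z'}) \<in> {z'. E z z'}"
        by (rule someI[of _ z]) (use equivp_reflp[OF E] in blast)
      then show ?thesis using \<phi>E[OF that] by simp
    qed
    then show ?thesis unfolding image_image by (intro image_cong refl) simp
  qed
  then have le: "card (\<phi> ` Z) \<le> D" using card_image_le[of ?C "\<lambda>c. \<phi> (SOME w. w \<in> c)"] finZ cardC by simp
  have "\<not> card (\<phi> ` Z) < D"
  proof
    assume lt: "card (\<phi> ` Z) < D"
    define rp where "rp p = (SOME z. z \<in> Z \<and> p = \<phi> z)" for p
    have rp: "rp p \<in> Z" "p = \<phi> (rp p)" if "p \<in> \<phi> ` Z" for p
    proof -
      have "\<exists>z. z \<in> Z \<and> p = \<phi> z" using that by blast
      from someI_ex[OF this] show "rp p \<in> Z" "p = \<phi> (rp p)" unfolding rp_def by blast+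
    qed
    \<comment> \<open>The coordinates of all points on the line. If there were fewer than
      \<open>D\<close>, some root would avoid all of them, against the point that this root itself
      contributes.\<close>
    define A where "A = (\<lambda>p. (\<alpha> (rp p), \<beta> (rp p))) ` \<phi> ` Z"
    have "finite A" unfolding A_def using finZ by simp
    moreover have "card A < D"
      unfolding A_def using card_image_le[of "\<phi> ` Z" "\<lambda>p. (\<alpha> (rp p), \<beta> (rp p))"] finZ lt by simp
    moreover have "\<forall>(a, b)\<in>A. a \<noteq> 0 \<or> b \<noteq> 0" unfolding A_def using ker(1)[OF rp(1)] by auto
    ultimately obtain z where z: "poly R z = 0"
      "\<forall>(a, b)\<in>A. \<not> (a * f z + b * f' z = 0 \<and> a * g z + b * g' z = 0)"
      using cover[of A] unfolding R_def f_def f'_def g_def g'_def by blast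
    have zZ: "z \<in> Z" using z(1) unfolding Z_def by simp
    let ?w = "rp (\<phi> z)"
    have w: "?w \<in> Z" "\<phi> ?w = \<phi> z" using rp[of "\<phi> z"] zZ by auto
    obtain c where c: "?pt (\<alpha> ?w) (\<beta> ?w) = c \<cdot>\<^sub>v ?pt (\<alpha> z) (\<beta> z)"
      using proj_pt_eqD w(2) unfolding \<phi>_def by blast
    have "\<alpha> ?w = c * \<alpha> z \<and> \<beta> ?w = c * \<beta> z" by (rule indep_pair_lincomb_eq[OF xy c])
    then have "\<alpha> ?w * f z + \<beta> ?w * f' z = c * (\<alpha> z * f z + \<beta> z * f' z)"
      "\<alpha> ?w * g z + \<beta> ?w * g' z = c * (\<alpha> z * g z + \<beta> z * g' z)" by (simp_all add: algebra_simps)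
    then have "\<alpha> ?w * f z + \<beta> ?w * f' z = 0 \<and> \<alpha> ?w * g z + \<beta> ?w * g' z = 0"
      using ker(2,3)[OF zZ] by simp
    moreover have "(\<alpha> ?w, \<beta> ?w) \<in> A" unfolding A_def using zZ by blast
    ultimately show False using z(2) by blast
  qed
  then show ?thesis using le sec finZ by simp
qed

lemma degree_formula:
  fixes P Q :: "nat \<Rightarrow> complex poly" and L :: "complex \<times> complex \<Rightarrow> complex vec set"
  assumes d: "2 \<le> d" and deg: "\<And>i. degree (P i) \<le> m1" "\<And>i. degree (Q i) \<le> m2" and n: "n = m1 + m2" "n > 0"
    and good: "good_line d P Q n B E x0 y0" and E: "equivp E"
    and B: "finite B" "\<And>z. z \<notin> B \<Longrightarrow> card {z'. E z z'} = k" and Es: "\<And>z z'. E z z' \<Longrightarrow> same_plane d P Q z z'"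
    and Lz: "\<And>z. L (z, 1) = {v \<in> carrier_vec d. dotp d (evp P z) (vec_index v) = 0 \<and> dotp d (evp Q z) (vec_index v) = 0}"
    and Linf: "L (1, 0) \<subseteq> {v \<in> carrier_vec d. dotp d (cfp P m1) (vec_index v) = 0 \<and> dotp d (cfp Q m2) (vec_index v) = 0}"
  shows "k * implicit_degree d (\<Union>t\<in>params. proj d (L t)) = n"
proof -
  have "\<exists>F D. polynomial_fun2 d F \<and> F (vec d x0) (vec d y0) \<noteq> 0 \<and> k * D = n \<and>
    (\<forall>x y. F x y \<noteq> 0 \<longrightarrow> transversal_line d P Q n B D x y)"
    by (rule generic_line_points[where E = E and P = P and Q = Q and ?m1.0 = m1 and ?m2.0 = m2])
      (use assms in blast)+
  then obtain F D where F: "polynomial_fun2 d F" "F (vec d x0) (vec d y0) \<noteq> 0" and kD: "k * D = n"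
    and FD: "\<And>x y. F x y \<noteq> 0 \<Longrightarrow> transversal_line d P Q n B D x y" by blast
  let ?X = "\<Union>t\<in>params. proj d (L t)"
  have "generic_line d (\<lambda>l. finite (l \<inter> ?X) \<and> card (l \<inter> ?X) = D)"
    unfolding generic_line_def
  proof (intro exI[of _ F] conjI ballI impI)
    show "\<exists>x\<in>carrier_vec d. \<exists>y\<in>carrier_vec d. F x y \<noteq> 0"
      using F(2) by (intro bexI[of _ "vec d x0"] bexI[of _ "vec d y0"]) auto
    fix x y assume xy: "x \<in> carrier_vec d" "y \<in> carrier_vec d" and *: "F x y \<noteq> 0 \<and> indep_pair d x y"
    have "finite (line_through d x y \<inter> ?X) \<and> card (line_through d x y \<inter> ?X) = D"
      by (rule line_section_card[where L = L and P = P and Q = Q and E = E and B = B and k = k and ?m1.0 = m1 and ?m2.0 = m2])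
        (use deg n E B(2) Es Lz Linf xy conjunct2[OF *] kD FD[OF conjunct1[OF *]] in blast)+
    then show "finite (line_through d x y \<inter> ?X)" "card (line_through d x y \<inter> ?X) = D" by auto
  qed (rule F(1))
  then have "implicit_degree d ?X = D" by (rule implicit_degree_eqI[OF d])
  then show ?thesis using kD by simp
qed

section \<open>Modules and the reduction loop\<close>

text \<open>If all minors vanished, the coordinates \<open>v j\<close> and \<open>- u j\<close>
  would be coefficients of a relation for each \<open>j\<close>, forcing both vectors to be
  zero.\<close>

lemma indep2_minor:
  fixes u v :: "nat \<Rightarrow> 'a::comm_ring_1"
  assumes "indep2 d u v"
  obtains i j where "i < j" "j < d" "u i * v j - u j * v i \<noteq> 0"
proof -
  have "\<exists>i j. i < j \<and> j < d \<and> u i * v j - u j * v i \<noteq> 0"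
  proof (rule ccontr)
    assume "\<not> ?thesis"
    then have z: "u i * v j = u j * v i" if "i < d" "j < d" for i j
      using that by (cases i j rule: linorder_cases) auto
    have "v j = 0 \<and> - u j = 0" if "j < d" for j
    proof -
      have "\<forall>i<d. v j * u i + (- u j) * v i = 0" using z[OF _ that] by (simp add: mult.commute)
      then show ?thesis using assms unfolding indep2_def by blast
    qed
    then have "\<forall>i<d. 1 * u i + 0 * v i = 0" by simp
    with spec[OF spec[OF assms[unfolded indep2_def], of 1], of 0] show False by auto
  qed
  then show ?thesis using that by blast
qed

text \<open>\<open>X\<close> and \<open>Y\<close> certify over the polynomials that the pair is
  primitive. The certificate can be evaluated at any parameter, survives row operations, and needs
  no matrix to be carried along.\<close>

definition dual_pair :: "nat \<Rightarrow> real poly vec \<Rightarrow> real poly vec \<Rightarrow> bool" where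
  "dual_pair d P Q \<longleftrightarrow> P \<in> carrier_vec d \<and> Q \<in> carrier_vec d \<and>
     (\<exists>X Y. dotp d (vec_index P) X = 1 \<and> dotp d (vec_index P) Y = 0 \<and>
            dotp d (vec_index Q) X = 0 \<and> dotp d (vec_index Q) Y = 1)"

lemma dual_pairE:
  assumes "dual_pair d P Q"
  obtains X Y where "P \<in> carrier_vec d" "Q \<in> carrier_vec d" "dotp d (vec_index P) X = 1"
    "dotp d (vec_index P) Y = 0" "dotp d (vec_index Q) X = 0" "dotp d (vec_index Q) Y = 1"
  using assms unfolding dual_pair_def by blast

lemma dual_pair_swap: "dual_pair d P Q \<longleftrightarrow> dual_pair d Q P"
  unfolding dual_pair_def by blast

lemma vec_lincomb_index:
  assumes "P \<in> carrier_vec d" "Q \<in> carrier_vec d" "i < d"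
  shows "vec_index (a \<cdot>\<^sub>v P + b \<cdot>\<^sub>v Q) i = a * vec_index P i + b * vec_index Q i"
  using assms by simp

lemma dotp_vec_lincomb_left:
  assumes "P \<in> carrier_vec d" "Q \<in> carrier_vec d"
  shows "dotp d (vec_index (a \<cdot>\<^sub>v P + b \<cdot>\<^sub>v Q)) X = a * dotp d (vec_index P) X + b * dotp d (vec_index Q) X"
  unfolding dotp_lincomb_left[symmetric] unfolding dotp_def
  by (rule sum.cong) (use assms in auto)

lemma dual_pair_indep:
  assumes "dual_pair d P Q"
  shows "indep_pair d P Q"
  unfolding indep_pair_def
proof (intro allI impI)
  fix a b assume *: "a \<cdot>\<^sub>v P + b \<cdot>\<^sub>v Q = 0\<^sub>v d"
  obtain X Y where XY: "P \<in> carrier_vec d" "Q \<in> carrier_vec d" "dotp d (vec_index P) X = 1"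
    "dotp d (vec_index P) Y = 0" "dotp d (vec_index Q) X = 0" "dotp d (vec_index Q) Y = 1"
    using dual_pairE[OF assms] by blast
  have "dotp d (vec_index (0\<^sub>v d)) Z = 0" for Z :: "nat \<Rightarrow> real poly" by (simp add: dotp_def)
  then have "a * dotp d (vec_index P) Z + b * dotp d (vec_index Q) Z = 0" for Z
    using dotp_vec_lincomb_left[OF XY(1,2), of a b Z] * by simp
  from this[of X] this[of Y] show "a = 0 \<and> b = 0" using XY by simp
qed

lemma to_fract_dotp: "to_fract (dotp d f g) = dotp d (\<lambda>i. to_fract (f i)) (\<lambda>i. to_fract (g i))"
proof -
  have "to_fract (sum h A) = (\<Sum>i\<in>A. to_fract (h i))" for h :: "nat \<Rightarrow> 'a" and A
    by (induction A rule: infinite_finite_induct) (simp_all add: to_fract_add)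
  then show ?thesis unfolding dotp_def by (simp add: to_fract_mult)
qed

lemma module2_iff:
  assumes "A \<in> carrier_vec d" "B \<in> carrier_vec d"
  shows "C \<in> module2 d A B \<longleftrightarrow> C \<in> carrier_vec d \<and>
    (\<exists>\<alpha> \<beta>. \<forall>i<d. to_fract (vec_index C i) = \<alpha> * to_fract (vec_index A i) + \<beta> * to_fract (vec_index B i))"
proof -
  have "map_vec to_fract C = \<alpha> \<cdot>\<^sub>v map_vec to_fract A + \<beta> \<cdot>\<^sub>v map_vec to_fract B \<longleftrightarrow>
      (\<forall>i<d. to_fract (vec_index C i) = \<alpha> * to_fract (vec_index A i) + \<beta> * to_fract (vec_index B i))"
    if "C \<in> carrier_vec d" for \<alpha> \<beta>
    using that assms by (subst vec_eq_iff) auto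
  then show ?thesis unfolding module2_def by blast
qed

lemma module2_generator:
  assumes "A \<in> carrier_vec d" "B \<in> carrier_vec d"
  shows "A \<in> module2 d A B" "B \<in> module2 d A B"
  unfolding module2_iff[OF assms]
  by (intro conjI exI[of _ 1] exI[of _ 0]; use assms in simp)
    (intro conjI exI[of _ 0] exI[of _ 1]; use assms in simp)

text \<open>Pairing an element of the module with \<open>X\<close> and \<open>Y\<close> recovers its
  coefficients, which are a priori fractions and are thereby seen to be polynomials.\<close>

lemma module2_dual_pair:
  assumes "dual_pair d P Q"
  shows "module2 d P Q = {a \<cdot>\<^sub>v P + b \<cdot>\<^sub>v Q | a b. True}"
proof (intro equalityI subsetI)
  obtain X Y where XY: "P \<in> carrier_vec d" "Q \<in> carrier_vec d" "dotp d (vec_index P) X = 1"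
    "dotp d (vec_index P) Y = 0" "dotp d (vec_index Q) X = 0" "dotp d (vec_index Q) Y = 1"
    using dual_pairE[OF assms] by blast
  {
    fix C assume "C \<in> module2 d P Q"
    then obtain \<alpha> \<beta> where C: "C \<in> carrier_vec d"
      "\<And>i. i < d \<Longrightarrow> to_fract (vec_index C i) = \<alpha> * to_fract (vec_index P i) + \<beta> * to_fract (vec_index Q i)"
      unfolding module2_iff[OF XY(1,2)] by blast
    have dot: "to_fract (dotp d (vec_index C) Z) = \<alpha> * to_fract (dotp d (vec_index P) Z) + \<beta> * to_fract (dotp d (vec_index Q) Z)" for Z
      unfolding to_fract_dotp dotp_lincomb_left[symmetric] unfolding dotp_def
      by (rule sum.cong) (auto simp: C(2))
    have "\<alpha> = to_fract (dotp d (vec_index C) X)" "\<beta> = to_fract (dotp d (vec_index C) Y)"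
      unfolding dot XY(3-6) by simp_all
    then have "to_fract (vec_index C i) =
        to_fract (dotp d (vec_index C) X * vec_index P i + dotp d (vec_index C) Y * vec_index Q i)" if "i < d" for i
      using C(2)[OF that] by (simp add: to_fract_add to_fract_mult)
    then have "vec_index C i = dotp d (vec_index C) X * vec_index P i + dotp d (vec_index C) Y * vec_index Q i"
      if "i < d" for i using that by (simp only: to_fract_eq_iff)
    then have "C = dotp d (vec_index C) X \<cdot>\<^sub>v P + dotp d (vec_index C) Y \<cdot>\<^sub>v Q"
      using C(1) XY(1,2) by (intro eq_vecI) auto
    then show "C \<in> {a \<cdot>\<^sub>v P + b \<cdot>\<^sub>v Q | a b. True}" by blast
  }
  fix C assume "C \<in> {a \<cdot>\<^sub>v P + b \<cdot>\<^sub>v Q | a b. True}"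
  then obtain a b where C: "C = a \<cdot>\<^sub>v P + b \<cdot>\<^sub>v Q" by blast
  have "C \<in> carrier_vec d" using XY(1,2) C by simp
  moreover have "\<forall>i<d. to_fract (vec_index C i) =
      to_fract a * to_fract (vec_index P i) + to_fract b * to_fract (vec_index Q i)"
    unfolding C using vec_lincomb_index[OF XY(1,2)] by (simp add: to_fract_add to_fract_mult)
  ultimately show "C \<in> module2 d P Q"
    unfolding module2_iff[OF XY(1,2)] by blast
qed

definition bracket :: "'a::comm_ring_1 vec \<Rightarrow> 'a vec \<Rightarrow> nat \<Rightarrow> nat \<Rightarrow> 'a" where
  "bracket A B i j = vec_index A i * vec_index B j - vec_index A j * vec_index B i"

lemma set_wedge:
  assumes "A \<in> carrier_vec d"
  shows "set\<^sub>v (wedge A B) = {bracket A B i j | i j. i < j \<and> j < d}"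
proof -
  have "set\<^sub>v (wedge A B) = set (brackets A B)"
    unfolding wedge_def by (metis set_list_of_vec list_vec)
  also have "\<dots> = {bracket A B i j | i j. i < j \<and> j < d}"
    using assms unfolding brackets_def bracket_def by (fastforce simp: image_iff)
  finally show ?thesis .
qed

lemma bracket_lincomb:
  assumes "P \<in> carrier_vec d" "Q \<in> carrier_vec d" "i < d" "j < d"
  shows "bracket (a \<cdot>\<^sub>v P + b \<cdot>\<^sub>v Q) (c \<cdot>\<^sub>v P + e \<cdot>\<^sub>v Q) i j = (a * e - b * c) * bracket P Q i j"
  using assms unfolding bracket_def by (simp add: algebra_simps)

lemma wedge_lincomb:
  assumes "P \<in> carrier_vec d" "Q \<in> carrier_vec d"
  shows "wedge (a \<cdot>\<^sub>v P + b \<cdot>\<^sub>v Q) (c \<cdot>\<^sub>v P + e \<cdot>\<^sub>v Q) = (a * e - b * c) \<cdot>\<^sub>v wedge P Q"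
proof -
  have "brackets (a \<cdot>\<^sub>v P + b \<cdot>\<^sub>v Q) (c \<cdot>\<^sub>v P + e \<cdot>\<^sub>v Q) = map (\<lambda>x. (a * e - b * c) * x) (brackets P Q)"
    using assms bracket_lincomb[OF assms, of _ _ a b c e]
    unfolding brackets_def bracket_def map_concat map_map o_def
    by (intro arg_cong[of _ _ concat]) (auto intro!: map_cong)
  then show ?thesis unfolding wedge_def by (intro eq_vecI) auto
qed

text \<open>The double sum is the determinant of the pairings of \<open>P\<close>, \<open>Q\<close>
  with \<open>X\<close>, \<open>Y\<close>. So the brackets generate the unit ideal.\<close>

lemma dual_pair_bracket:
  assumes "dual_pair d P Q"
  obtains X Y where "(\<Sum>i<d. \<Sum>j<d. bracket P Q i j * (X i * Y j)) = 1"
proof -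
  obtain X Y where XY: "P \<in> carrier_vec d" "Q \<in> carrier_vec d" "dotp d (vec_index P) X = 1"
    "dotp d (vec_index P) Y = 0" "dotp d (vec_index Q) X = 0" "dotp d (vec_index Q) Y = 1"
    using dual_pairE[OF assms] by blast
  have "(\<Sum>i<d. \<Sum>j<d. bracket P Q i j * (X i * Y j)) =
      (\<Sum>i<d. \<Sum>j<d. (vec_index P i * X i) * (vec_index Q j * Y j)) -
      (\<Sum>i<d. \<Sum>j<d. (vec_index Q i * X i) * (vec_index P j * Y j))"
    unfolding bracket_def sum_subtractf[symmetric] by (intro sum.cong refl) (simp add: algebra_simps)
  also have "\<dots> = 1"
    using XY unfolding dotp_def by (simp flip: sum_product)
  finally show ?thesis using that by blast
qed

section \<open>Degrees of vectors and of wedge products\<close>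

lemma vdeg_ge: "i < dim_vec C \<Longrightarrow> degree (vec_index C i) \<le> vdeg C"
  unfolding vdeg_def by (rule Max_ge) (auto simp: vec_set_def)

lemma vdeg_le: "0 < dim_vec C \<Longrightarrow> (\<And>i. i < dim_vec C \<Longrightarrow> degree (vec_index C i) \<le> m) \<Longrightarrow> vdeg C \<le> m"
  unfolding vdeg_def by (subst Max_le_iff) (auto simp: vec_set_def)

lemma vdeg_attained:
  assumes "0 < dim_vec C"
  obtains i where "i < dim_vec C" "degree (vec_index C i) = vdeg C"
proof -
  have "vdeg C \<in> degree ` set\<^sub>v C" unfolding vdeg_def by (rule Max_in) (use assms in \<open>auto simp: vec_set_def\<close>)
  then show ?thesis using that unfolding vec_set_def by auto
qed

lemma vdeg_eqI:
  assumes "\<And>i. i < dim_vec C \<Longrightarrow> degree (vec_index C i) \<le> m" "i < dim_vec C" "coeff (vec_index C i) m \<noteq> 0"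
  shows "vdeg C = m"
  using vdeg_le[of C m] assms(1,2) vdeg_ge[OF assms(2)] le_degree[OF assms(3)] by fastforce

lemma lead_vec_nonzero:
  assumes "i < dim_vec C" "vec_index C i \<noteq> 0"
  shows "\<exists>i<dim_vec C. coeff (vec_index C i) (vdeg C) \<noteq> 0"
proof (cases "vdeg C = 0")
  case True
  then have "degree (vec_index C i) = 0" using vdeg_ge[OF assms(1)] by simp
  then have "coeff (vec_index C i) 0 \<noteq> 0" using assms(2) by (metis leading_coeff_0_iff)
  then show ?thesis using True assms(1) by auto
next
  case False
  obtain j where j: "j < dim_vec C" "degree (vec_index C j) = vdeg C" using vdeg_attained assms(1) by (metis gr_implies_not0 gr0I)
  then have "vec_index C j \<noteq> 0" using False by auto
  then show ?thesis using j by (intro exI[of _ j]) (simp flip: j(2))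
qed

lemma vdeg_smult:
  fixes q :: "real poly"
  assumes "q \<noteq> 0" "i < dim_vec C" "vec_index C i \<noteq> 0"
  shows "vdeg (q \<cdot>\<^sub>v C) = degree q + vdeg C"
proof -
  obtain j where j: "j < dim_vec C" "coeff (vec_index C j) (vdeg C) \<noteq> 0" using lead_vec_nonzero assms(2,3) by blast
  show ?thesis
  proof (rule vdeg_eqI[where i = j])
    show "degree (vec_index (q \<cdot>\<^sub>v C) k) \<le> degree q + vdeg C" if "k < dim_vec (q \<cdot>\<^sub>v C)" for k
      using that vdeg_ge[of k C] degree_mult_le[of q "vec_index C k"] by simp
    have "coeff (q * vec_index C j) (degree q + vdeg C) = lead_coeff q * coeff (vec_index C j) (vdeg C)"
      by (rule coeff_mult_degree_le) (use vdeg_ge[OF j(1)] in auto)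
    then show "coeff (vec_index (q \<cdot>\<^sub>v C) j) (degree q + vdeg C) \<noteq> 0" using j assms(1) by simp
  qed (use j in simp)
qed

lemma bracket_nonzero:
  assumes "dual_pair d P Q"
  obtains i j where "i < j" "j < d" "bracket P Q i j \<noteq> 0"
proof -
  obtain X Y where XY: "(\<Sum>i<d. \<Sum>j<d. bracket P Q i j * (X i * Y j)) = 1" using dual_pair_bracket[OF assms] .
  have "\<exists>i j. i < d \<and> j < d \<and> bracket P Q i j \<noteq> 0"
  proof (rule ccontr)
    assume "\<not> ?thesis"
    then have "(\<Sum>i<d. \<Sum>j<d. bracket P Q i j * (X i * Y j)) = 0" by (intro sum.neutral ballI) auto
    then show False using XY by simp
  qed
  then obtain i j where ij: "i < d" "j < d" "bracket P Q i j \<noteq> 0" by blast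
  have "bracket P Q j i = - bracket P Q i j" "bracket P Q i i = 0" unfolding bracket_def by simp_all
  then show ?thesis using that[of i j] that[of j i] ij by (cases i j rule: linorder_cases) auto
qed

lemma wedge_entry:
  assumes "A \<in> carrier_vec d" "i < j" "j < d"
  obtains l where "l < dim_vec (wedge A B)" "vec_index (wedge A B) l = bracket A B i j"
proof -
  have "bracket A B i j \<in> set\<^sub>v (wedge A B)" unfolding set_wedge[OF assms(1)] using assms(2,3) by blast
  then show ?thesis using that unfolding vec_set_def by auto
qed

lemma wedge_entry_bracket:
  assumes "A \<in> carrier_vec d" "l < dim_vec (wedge A B)"
  obtains i j where "i < j" "j < d" "vec_index (wedge A B) l = bracket A B i j"
proof -
  have "vec_index (wedge A B) l \<in> set\<^sub>v (wedge A B)" using assms(2) unfolding vec_set_def by auto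
  then show ?thesis using that unfolding set_wedge[OF assms(1)] by auto
qed

lemma vdeg_wedge_lead_indep:
  assumes PQ: "P \<in> carrier_vec d" "Q \<in> carrier_vec d" and
    lead: "indep2 d (\<lambda>i. coeff (vec_index P i) (vdeg P)) (\<lambda>i. coeff (vec_index Q i) (vdeg Q))"
  shows "vdeg (wedge P Q) = vdeg P + vdeg Q"
proof -
  let ?p = "\<lambda>i. coeff (vec_index P i) (vdeg P)" and ?q = "\<lambda>i. coeff (vec_index Q i) (vdeg Q)"
  have cb: "coeff (bracket P Q i j) (vdeg P + vdeg Q) = ?p i * ?q j - ?p j * ?q i" if "i < d" "j < d" for i j
    unfolding bracket_def coeff_diff using that PQ vdeg_ge[of _ P] vdeg_ge[of _ Q]
    by (simp add: coeff_mult_degree_le)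
  have db: "degree (bracket P Q i j) \<le> vdeg P + vdeg Q" if "i < d" "j < d" for i j
    unfolding bracket_def using that PQ vdeg_ge[of _ P] vdeg_ge[of _ Q]
    by (intro degree_diff_le order.trans[OF degree_mult_le] add_mono) auto
  obtain i j where ij: "i < j" "j < d" "?p i * ?q j - ?p j * ?q i \<noteq> 0"
    using indep2_minor[OF lead] .
  obtain l where l: "l < dim_vec (wedge P Q)" "vec_index (wedge P Q) l = bracket P Q i j"
    using wedge_entry[OF PQ(1) ij(1,2)] by blast
  show ?thesis
  proof (rule vdeg_eqI[OF _ l(1)])
    show "coeff (vec_index (wedge P Q) l) (vdeg P + vdeg Q) \<noteq> 0" unfolding l(2) using cb ij by simp
    show "degree (vec_index (wedge P Q) k) \<le> vdeg P + vdeg Q" if k: "k < dim_vec (wedge P Q)" for k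
    proof -
      obtain i' j' where "i' < j'" "j' < d" "vec_index (wedge P Q) k = bracket P Q i' j'"
        using wedge_entry_bracket[OF PQ(1) k] by blast
      then show ?thesis using db[of i' j'] by simp
    qed
  qed
qed

lemma module2_generators:
  assumes PQ: "dual_pair d P Q" and AB: "A \<in> carrier_vec d" "B \<in> carrier_vec d" "module2 d A B = module2 d P Q"
  obtains a b c e where "A = a \<cdot>\<^sub>v P + b \<cdot>\<^sub>v Q" "B = c \<cdot>\<^sub>v P + e \<cdot>\<^sub>v Q" "a * e - b * c \<noteq> 0"
proof -
  have PQc: "P \<in> carrier_vec d" "Q \<in> carrier_vec d" using PQ unfolding dual_pair_def by auto
  have "A \<in> module2 d A B" "B \<in> module2 d A B" by (rule module2_generator[OF AB(1,2)])+
  then obtain a b c e where A: "A = a \<cdot>\<^sub>v P + b \<cdot>\<^sub>v Q" and B: "B = c \<cdot>\<^sub>v P + e \<cdot>\<^sub>v Q"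
    unfolding AB(3) module2_dual_pair[OF PQ] by blast
  have "P \<in> module2 d P Q" "Q \<in> module2 d P Q" by (rule module2_generator[OF PQc])+
  then obtain \<alpha> \<beta> \<gamma> \<delta> where
    P: "\<And>i. i < d \<Longrightarrow> to_fract (vec_index P i) = \<alpha> * to_fract (vec_index A i) + \<beta> * to_fract (vec_index B i)" and
    Q: "\<And>i. i < d \<Longrightarrow> to_fract (vec_index Q i) = \<gamma> * to_fract (vec_index A i) + \<delta> * to_fract (vec_index B i)"
    unfolding AB(3)[symmetric] module2_iff[OF AB(1,2)] by blast
  obtain i j where ij: "i < j" "j < d" "bracket P Q i j \<noteq> 0" using bracket_nonzero[OF PQ] .
  have "a * e - b * c \<noteq> 0"
  proof
    assume 0: "a * e - b * c = 0"
    have "to_fract (bracket P Q i j) = (\<alpha> * \<delta> - \<beta> * \<gamma>) * to_fract (bracket A B i j)"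
      unfolding bracket_def using P[of i] P[of j] Q[of i] Q[of j] ij(1,2)
      by (simp add: to_fract_mult to_fract_diff algebra_simps)
    also have "bracket A B i j = 0"
      unfolding A B using bracket_lincomb[OF PQc, of i j a b c e] 0 ij(1,2) by simp
    finally show False using ij(3) by simp
  qed
  then show ?thesis using that A B by blast
qed

lemma module_degree_dual_pair:
  assumes PQ: "dual_pair d P Q" and M: "module2 d P Q = M"
  shows "module_degree d M = vdeg (wedge P Q)"
  unfolding module_degree_def
proof (rule Least_equality)
  have PQc: "P \<in> carrier_vec d" "Q \<in> carrier_vec d" using PQ unfolding dual_pair_def by auto
  then show "\<exists>A B. A \<in> carrier_vec d \<and> B \<in> carrier_vec d \<and> module2 d A B = M \<and> vdeg (wedge P Q) = vdeg (wedge A B)"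
    using M by blast
  fix n assume "\<exists>A B. A \<in> carrier_vec d \<and> B \<in> carrier_vec d \<and> module2 d A B = M \<and> n = vdeg (wedge A B)"
  then obtain A B where AB: "A \<in> carrier_vec d" "B \<in> carrier_vec d" "module2 d A B = module2 d P Q" and n: "n = vdeg (wedge A B)"
    using M by blast
  obtain a b c e where A: "A = a \<cdot>\<^sub>v P + b \<cdot>\<^sub>v Q" and B: "B = c \<cdot>\<^sub>v P + e \<cdot>\<^sub>v Q" and det: "a * e - b * c \<noteq> 0"
    using module2_generators[OF PQ AB] .
  obtain i j where ij: "i < j" "j < d" "bracket P Q i j \<noteq> 0" using bracket_nonzero[OF PQ] .
  obtain l where l: "l < dim_vec (wedge P Q)" "vec_index (wedge P Q) l = bracket P Q i j"
    using wedge_entry[OF PQc(1) ij(1,2)] by blast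
  have "n = degree (a * e - b * c) + vdeg (wedge P Q)"
    unfolding n A B wedge_lincomb[OF PQc] by (rule vdeg_smult[OF det l(1)]) (use l(2) ij(3) in simp)
  then show "vdeg (wedge P Q) \<le> n" by simp
qed

section \<open>Cancelling leading terms\<close>

lemma leading_terms_eq_iff:
  assumes "P \<in> carrier_vec d" "Q \<in> carrier_vec d"
  shows "leading_terms P = h \<cdot>\<^sub>v leading_terms Q \<longleftrightarrow>
    (\<forall>i<d. monom (coeff (vec_index P i) (vdeg P)) (vdeg P) = h * monom (coeff (vec_index Q i) (vdeg Q)) (vdeg Q))"
  using assms unfolding leading_terms_def by (subst vec_eq_iff) auto

text \<open>The degree of \<open>h\<close> is the difference of the row degrees, so
  \<open>h \<cdot>\<^sub>v Q\<close> has degree at most \<open>vdeg P\<close> and its coefficients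
  there equal those of \<open>P\<close>. The dual vectors survive with \<open>Y\<close> replaced by
  \<open>Y + h * X\<close>.\<close>

lemma reduce_step:
  assumes PQ: "dual_pair d P Q" and h: "leading_terms P = h \<cdot>\<^sub>v leading_terms Q"
  shows "dual_pair d (P - h \<cdot>\<^sub>v Q) Q" "module2 d (P - h \<cdot>\<^sub>v Q) Q = module2 d P Q" "vdeg (P - h \<cdot>\<^sub>v Q) < vdeg P"
proof -
  obtain X Y where XY: "P \<in> carrier_vec d" "Q \<in> carrier_vec d" "dotp d (vec_index P) X = 1"
    "dotp d (vec_index P) Y = 0" "dotp d (vec_index Q) X = 0" "dotp d (vec_index Q) Y = 1"
    using dual_pairE[OF PQ] by blast
  have eq: "P - h \<cdot>\<^sub>v Q = 1 \<cdot>\<^sub>v P + (- h) \<cdot>\<^sub>v Q" using XY(1,2) by (intro eq_vecI) auto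
  have dl: "dotp d (vec_index (P - h \<cdot>\<^sub>v Q)) Z = dotp d (vec_index P) Z - h * dotp d (vec_index Q) Z" for Z
    unfolding eq dotp_vec_lincomb_left[OF XY(1,2)] by simp
  have Y': "dotp d f (\<lambda>i. 1 * Y i + h * X i) = dotp d f Y + h * dotp d f X" for f
    unfolding dotp_lincomb_right by simp
  show dp: "dual_pair d (P - h \<cdot>\<^sub>v Q) Q"
    unfolding dual_pair_def
    by (intro conjI exI[of _ X] exI[of _ "\<lambda>i. 1 * Y i + h * X i"]; (unfold Y')?; (unfold dl)?)
      (use XY in \<open>auto simp: algebra_simps\<close>)
  have "a \<cdot>\<^sub>v (P - h \<cdot>\<^sub>v Q) + b \<cdot>\<^sub>v Q = a \<cdot>\<^sub>v P + (b - a * h) \<cdot>\<^sub>v Q" for a b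
    using XY(1,2) by (intro eq_vecI) (auto simp: algebra_simps)
  moreover have "a \<cdot>\<^sub>v P + b \<cdot>\<^sub>v Q = a \<cdot>\<^sub>v (P - h \<cdot>\<^sub>v Q) + (b + a * h) \<cdot>\<^sub>v Q" for a b
    using XY(1,2) by (intro eq_vecI) (auto simp: algebra_simps)
  ultimately show "module2 d (P - h \<cdot>\<^sub>v Q) Q = module2 d P Q"
    unfolding module2_dual_pair[OF dp] module2_dual_pair[OF PQ] by blast
  let ?m = "vdeg P"
  have dP: "dim_vec P = d" "dim_vec Q = d" using XY by auto
  have "\<exists>i<d. vec_index P i \<noteq> 0"
  proof (rule ccontr)
    assume "\<not> ?thesis"
    then have "dotp d (vec_index P) X = 0" unfolding dotp_def by simp
    then show False using XY(3) by simp
  qed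
  then obtain i0 where i0: "i0 < d" "coeff (vec_index P i0) ?m \<noteq> 0" using lead_vec_nonzero[of _ P] dP by auto
  have lt: "monom (coeff (vec_index P i) ?m) ?m = h * monom (coeff (vec_index Q i) (vdeg Q)) (vdeg Q)" if "i < d" for i
    using h that unfolding leading_terms_eq_iff[OF XY(1,2)] by blast
  let ?c = "coeff (vec_index Q i0) (vdeg Q)"
  have c0: "?c \<noteq> 0"
  proof
    assume "?c = 0"
    then have "monom (coeff (vec_index P i0) ?m) ?m = 0" using lt[OF i0(1)] by simp
    then show False using i0(2) by simp
  qed
  have hm: "degree h + vdeg Q = ?m"
  proof -
    have "h \<noteq> 0" using lt[OF i0(1)] i0(2) by auto
    have "degree (h * monom ?c (vdeg Q)) = degree h + vdeg Q"
      using \<open>h \<noteq> 0\<close> c0 by (simp add: degree_mult_eq degree_monom_eq)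
    then show ?thesis using lt[OF i0(1)] i0(2) by (metis degree_monom_eq)
  qed
  have dh: "degree (h * vec_index Q i) \<le> ?m" if "i < d" for i
    using degree_mult_le[of h "vec_index Q i"] vdeg_ge[of i Q] that dP hm by simp
  have ch: "coeff (h * vec_index Q i) ?m = coeff (vec_index P i) ?m" if "i < d" for i
  proof -
    have "coeff (h * vec_index Q i) ?m = lead_coeff h * coeff (vec_index Q i) (vdeg Q)"
      unfolding hm[symmetric] by (rule coeff_mult_degree_le) (use vdeg_ge[of i Q] that dP in auto)
    also have "\<dots> = coeff (h * monom (coeff (vec_index Q i) (vdeg Q)) (vdeg Q)) ?m"
      unfolding hm[symmetric] by (subst coeff_mult_degree_le) (auto intro: degree_monom_le)
    also have "\<dots> = coeff (vec_index P i) ?m" using lt[OF that] by (metis coeff_monom)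
    finally show ?thesis .
  qed
  have cP': "degree (vec_index (P - h \<cdot>\<^sub>v Q) i) \<le> ?m \<and> coeff (vec_index (P - h \<cdot>\<^sub>v Q) i) ?m = 0" if "i < d" for i
    using that dP ch[OF that] dh[OF that] vdeg_ge[of i P] by (auto intro!: degree_diff_le)
  \<comment> \<open>For \<open>vdeg P = 0\<close> the cancellation would make
    \<open>P - h \<cdot>\<^sub>v Q\<close> zero, but its pairing with \<open>X\<close> is 1.\<close>
  have m0: "0 < ?m"
  proof (rule ccontr)
    assume "\<not> 0 < ?m"
    then have "degree (vec_index (P - h \<cdot>\<^sub>v Q) i) = 0 \<and> coeff (vec_index (P - h \<cdot>\<^sub>v Q) i) 0 = 0" if "i < d" for i
      using cP'[OF that] by simp
    then have "vec_index (P - h \<cdot>\<^sub>v Q) i = 0" if "i < d" for i using that by (metis leading_coeff_0_iff)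
    then have "dotp d (vec_index (P - h \<cdot>\<^sub>v Q)) X = 0" unfolding dotp_def by simp
    then show False unfolding dl using XY by simp
  qed
  have "vdeg (P - h \<cdot>\<^sub>v Q) \<le> ?m - 1"
  proof (rule vdeg_le)
    show "0 < dim_vec (P - h \<cdot>\<^sub>v Q)" using dP i0(1) by simp
    fix i assume "i < dim_vec (P - h \<cdot>\<^sub>v Q)"
    then have i: "i < d" using dP by simp
    show "degree (vec_index (P - h \<cdot>\<^sub>v Q) i) \<le> ?m - 1"
      using cP'[OF i] m0 by (metis Suc_pred' le_SucE le_zero_eq less_Suc_eq_le leading_coeff_0_iff degree_0 zero_le)
  qed
  then show "vdeg (P - h \<cdot>\<^sub>v Q) < ?m" using m0 by simp
qed

text \<open>If the leading coefficient vectors are dependent, the row of larger degree has leading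
  terms that are a monomial multiple of the other, or the other has zero leading vector, which is
  the case \<open>h = 0\<close>.\<close>

lemma lead_indep_if_irreducible:
  assumes PQ: "dual_pair d P Q" and h: "\<nexists>h. leading_terms P = h \<cdot>\<^sub>v leading_terms Q" "\<nexists>h. leading_terms Q = h \<cdot>\<^sub>v leading_terms P"
  shows "indep2 d (\<lambda>i. coeff (vec_index P i) (vdeg P)) (\<lambda>i. coeff (vec_index Q i) (vdeg Q))"
proof -
  have c: "P \<in> carrier_vec d" "Q \<in> carrier_vec d" using PQ unfolding dual_pair_def by auto
  let ?p = "\<lambda>i. coeff (vec_index P i) (vdeg P)" and ?q = "\<lambda>i. coeff (vec_index Q i) (vdeg Q)"
  have A: False if "\<forall>i<d. ?p i = k * ?q i" "vdeg Q \<le> vdeg P" for k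
  proof -
    have "leading_terms P = monom k (vdeg P - vdeg Q) \<cdot>\<^sub>v leading_terms Q"
      unfolding leading_terms_eq_iff[OF c] using that by (simp add: mult_monom)
    then show False using h(1) by blast
  qed
  have B: False if "\<forall>i<d. ?q i = k * ?p i" "vdeg P \<le> vdeg Q" for k
  proof -
    have "leading_terms Q = monom k (vdeg Q - vdeg P) \<cdot>\<^sub>v leading_terms P"
      unfolding leading_terms_eq_iff[OF c(2,1)] using that by (simp add: mult_monom)
    then show False using h(2) by blast
  qed
  show ?thesis
    unfolding indep2_def
  proof (intro allI impI)
    fix a b assume *: "\<forall>i<d. a * ?p i + b * ?q i = 0"
    have 1: "?p i = (- b / a) * ?q i" if "a \<noteq> 0" "i < d" for i
      using *[rule_format, OF that(2)] that(1) by (simp add: field_simps)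
    have 2: "?q i = (- a / b) * ?p i" if "b \<noteq> 0" "i < d" for i
      using *[rule_format, OF that(2)] that(1) by (simp add: field_simps)
    show "a = 0 \<and> b = 0"
    proof (cases "vdeg Q \<le> vdeg P")
      case True
      have a: "a = 0" using A[OF _ True] 1 by blast
      have "b = 0"
      proof (rule ccontr)
        assume "b \<noteq> 0"
        then have "\<forall>i<d. ?q i = 0" using 2 a by simp
        then have "leading_terms Q = 0 \<cdot>\<^sub>v leading_terms P" unfolding leading_terms_eq_iff[OF c(2,1)] by simp
        then show False using h(2) by blast
      qed
      then show ?thesis using a by simp
    next
      case False
      then have b: "b = 0" using B[of "- a / b"] 2 by force
      have "a = 0"
      proof (rule ccontr)
        assume "a \<noteq> 0"
        then have "\<forall>i<d. ?p i = 0" using 1 b by simp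
        then have "leading_terms P = 0 \<cdot>\<^sub>v leading_terms Q" unfolding leading_terms_eq_iff[OF c] by simp
        then show False using h(1) by blast
      qed
      then show ?thesis using b by simp
    qed
  qed
qed

text \<open>The sum of the row degrees decreases strictly in every round that changes the pair,
  while the generated module and the existence of dual vectors are invariant.\<close>

lemma mu_loop_correct:
  assumes PQ: "dual_pair d P Q" and M: "module2 d P Q = M"
  shows "\<exists>A' B'. mu_loop (P, Q) = Some (A', B') \<and> dual_pair d A' B' \<and> module2 d A' B' = M \<and>
    indep2 d (\<lambda>i. coeff (vec_index A' i) (vdeg A')) (\<lambda>i. coeff (vec_index B' i) (vdeg B'))"
proof -
  define I where "I = (\<lambda>(P, Q). dual_pair d P Q \<and> module2 d P Q = M)"
  define f where "f = (\<lambda>(P :: real poly vec, Q :: real poly vec). vdeg P + vdeg Q)"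
  have m2: "module2 d P Q = module2 d Q P" if "dual_pair d P Q" for P Q
  proof -
    have "P \<in> carrier_vec d" "Q \<in> carrier_vec d" using that unfolding dual_pair_def by auto
    then have c: "a \<cdot>\<^sub>v P + b \<cdot>\<^sub>v Q = b \<cdot>\<^sub>v Q + a \<cdot>\<^sub>v P" for a b by (intro eq_vecI) auto
    have "dual_pair d Q P" using that dual_pair_swap by blast
    then show ?thesis unfolding module2_dual_pair[OF that] module2_dual_pair[OF \<open>dual_pair d Q P\<close>] c by blast
  qed
  have r1: "I (reduce_first W) \<and>
      (if \<exists>h. leading_terms (fst W) = h \<cdot>\<^sub>v leading_terms (snd W) then f (reduce_first W) < f W else reduce_first W = W)"
    if W: "I W" for W
  proof -
    obtain P Q where W': "W = (P, Q)" by fastforce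
    have I: "dual_pair d P Q" "module2 d P Q = M" using W unfolding W' I_def by auto
    show ?thesis
    proof (cases "\<exists>h. leading_terms P = h \<cdot>\<^sub>v leading_terms Q")
      case True
      have "leading_terms P = (SOME h. leading_terms P = h \<cdot>\<^sub>v leading_terms Q) \<cdot>\<^sub>v leading_terms Q"
        using someI_ex[OF True] .
      from reduce_step[OF I(1) this] show ?thesis using True I(2) unfolding W' I_def f_def reduce_first_def by simp
    next
      case False
      then show ?thesis using I unfolding W' I_def f_def reduce_first_def by auto
    qed
  qed
  have r2: "I (reduce_second W) \<and>
      (if \<exists>h. leading_terms (snd W) = h \<cdot>\<^sub>v leading_terms (fst W) then f (reduce_second W) < f W else reduce_second W = W)"
    if W: "I W" for W
  proof -
    obtain P Q where W': "W = (P, Q)" by fastforce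
    have I: "dual_pair d P Q" "module2 d P Q = M" using W unfolding W' I_def by auto
    have I': "dual_pair d Q P" using I(1) dual_pair_swap by blast
    show ?thesis
    proof (cases "\<exists>h. leading_terms Q = h \<cdot>\<^sub>v leading_terms P")
      case True
      have "leading_terms Q = (SOME h. leading_terms Q = h \<cdot>\<^sub>v leading_terms P) \<cdot>\<^sub>v leading_terms P"
        using someI_ex[OF True] .
      note s = reduce_step[OF I' this]
      have "dual_pair d P (Q - (SOME h. leading_terms Q = h \<cdot>\<^sub>v leading_terms P) \<cdot>\<^sub>v P)"
        using s(1) dual_pair_swap by blast
      then show ?thesis using True I(2) s m2[OF s(1)] m2[OF I(1)] unfolding W' I_def f_def reduce_second_def by simp
    next
      case False
      then show ?thesis using I unfolding W' I_def f_def reduce_second_def by auto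
    qed
  qed
  have le1: "f (reduce_first W) \<le> f W" if "I W" for W using r1[OF that] by (auto split: if_splits)
  have le2: "f (reduce_second W) \<le> f W" if "I W" for W using r2[OF that] by (auto split: if_splits)
  have step: "I (reduce_second (reduce_first W)) \<and> f (reduce_second (reduce_first W)) < f W"
    if "I W" "reduce_second (reduce_first W) \<noteq> W" for W
  proof -
    have I1: "I (reduce_first W)" using r1[OF that(1)] by blast
    have I2: "I (reduce_second (reduce_first W))" using r2[OF I1] by blast
    have "f (reduce_second (reduce_first W)) < f W"
    proof (cases "\<exists>h. leading_terms (fst W) = h \<cdot>\<^sub>v leading_terms (snd W)")
      case True
      then have "f (reduce_first W) < f W" using r1[OF that(1)] by simp
      then show ?thesis using le2[OF I1] by simp
    next
      case False
      then have *: "reduce_first W = W" using r1[OF that(1)] by simp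
      then show ?thesis using r2[OF that(1)] that(2) by (auto split: if_splits)
    qed
    then show ?thesis using I2 by blast
  qed
  have I0: "I (P, Q)" unfolding I_def using PQ M by simp
  obtain W where W: "mu_loop (P, Q) = Some W"
    unfolding mu_loop_def
    using measure_while_option_Some[where P = I and f = f and s = "(P, Q)" and b = "\<lambda>W. reduce_second (reduce_first W) \<noteq> W"
        and c = "\<lambda>W. reduce_second (reduce_first W)"] step I0 by blast
  have IW: "I W"
    by (rule while_option_rule[where P = I, OF _ W[unfolded mu_loop_def] I0]) (use step in blast)
  have fixW: "reduce_second (reduce_first W) = W"
    using while_option_stop[OF W[unfolded mu_loop_def]] by simp
  \<comment> \<open>A fixed point of the composed step admits no first reduction: that would lower
    the measure, and the second step cannot raise it again.\<close>
  have n1: "\<nexists>h. leading_terms (fst W) = h \<cdot>\<^sub>v leading_terms (snd W)"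
  proof
    assume "\<exists>h. leading_terms (fst W) = h \<cdot>\<^sub>v leading_terms (snd W)"
    then have "f (reduce_first W) < f W" using r1[OF IW] by simp
    moreover have "f W \<le> f (reduce_first W)" using le2[of "reduce_first W"] r1[OF IW] fixW by simp
    ultimately show False by simp
  qed
  have "reduce_first W = W" using r1[OF IW] n1 by simp
  then have n2: "\<nexists>h. leading_terms (snd W) = h \<cdot>\<^sub>v leading_terms (fst W)"
    using r2[OF IW] fixW by (auto split: if_splits)
  obtain A' B' where AB: "W = (A', B')" by fastforce
  have "dual_pair d A' B'" "module2 d A' B' = M" using IW unfolding I_def AB by auto
  moreover have "indep2 d (\<lambda>i. coeff (vec_index A' i) (vdeg A')) (\<lambda>i. coeff (vec_index B' i) (vdeg B'))"
    by (rule lead_indep_if_irreducible) (use calculation n1 n2 AB in auto)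
  ultimately show ?thesis using W AB by blast
qed

section \<open>Smith forms\<close>

lemma index_mult_sum:
  assumes "A \<in> carrier_mat n m" "B \<in> carrier_mat m k" "i < n" "j < k"
  shows "(A * B) $$ (i, j) = (\<Sum>l<m. A $$ (i, l) * B $$ (l, j))"
  using assms by (simp add: scalar_prod_def atLeast0LessThan)

lemma lessThan_2: "{..<2} = {0, 1::nat}"
  by auto

lemma det_carrier_2: "A \<in> carrier_mat 2 2 \<Longrightarrow> det A = A $$ (0, 0) * A $$ (1, 1) - A $$ (0, 1) * A $$ (1, 0)"
  for A :: "'a::comm_ring_1 mat"
  by (subst laplace_expansion_row[of A 2 0])
    (auto simp: lessThan_2 cofactor_def mat_delete_def det_single)

lemma unimodular_mult: "unimodular n U \<Longrightarrow> unimodular n V \<Longrightarrow> unimodular n (U * V)"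
  unfolding unimodular_def by (metis det_mult is_unit_mult_iff mult_carrier_mat)

lemma unimodular_one: "unimodular n (1\<^sub>m n)"
  unfolding unimodular_def by simp

lemma unimodular_inverse:
  assumes "unimodular n U"
  obtains U' where "unimodular n U'" "U * U' = 1\<^sub>m n" "U' * U = 1\<^sub>m n"
proof -
  have U: "U \<in> carrier_mat n n" using assms unfolding unimodular_def by simp
  obtain u where u: "u * det U = 1" using assms unfolding unimodular_def by (metis dvd_def mult.commute)
  note adj = adj_mat[OF U]
  let ?U' = "u \<cdot>\<^sub>m adj_mat U"
  have 1: "U * ?U' = 1\<^sub>m n"
  proof -
    have "U * ?U' = u \<cdot>\<^sub>m (U * adj_mat U)" using U adj(1) by (simp add: mult_smult_distrib)
    also have "\<dots> = 1\<^sub>m n" unfolding adj(2) using u by (intro eq_matI) (auto simp: mult.assoc[symmetric])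
    finally show ?thesis .
  qed
  have 2: "?U' * U = 1\<^sub>m n"
  proof -
    have "?U' * U = u \<cdot>\<^sub>m (adj_mat U * U)" using U adj(1) by (simp add: mult_smult_assoc_mat)
    also have "\<dots> = 1\<^sub>m n" unfolding adj(3) using u by (intro eq_matI) (auto simp: mult.assoc[symmetric])
    finally show ?thesis .
  qed
  have "?U' \<in> carrier_mat n n" using adj(1) by simp
  moreover have "is_unit (det ?U')"
  proof -
    have "det ?U' * det U = 1" using arg_cong[OF 2, of det] det_mult[OF \<open>?U' \<in> carrier_mat n n\<close> U] by simp
    then show ?thesis by (metis dvdI)
  qed
  ultimately show ?thesis using that 1 2 unfolding unimodular_def by blast
qed

text \<open>The dual vectors are the first two columns of the inverse matrix.\<close>

lemma unimodular_rows_dual_pair: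
  assumes "unimodular d V" "2 \<le> d"
  shows "dual_pair d (row V 0) (row V 1)"
proof -
  obtain V' where V': "unimodular d V'" "V * V' = 1\<^sub>m d" using unimodular_inverse[OF assms(1)] by blast
  have c: "V \<in> carrier_mat d d" "V' \<in> carrier_mat d d" using assms(1) V'(1) unfolding unimodular_def by auto
  have *: "dotp d (vec_index (row V i)) (\<lambda>l. V' $$ (l, j)) = (if i = j then 1 else 0)" if "i < d" "j < d" for i j
  proof -
    have "dotp d (vec_index (row V i)) (\<lambda>l. V' $$ (l, j)) = (V * V') $$ (i, j)"
      unfolding index_mult_sum[OF c that] dotp_def using c that by (intro sum.cong) auto
    then show ?thesis using V'(2) that by simp
  qed
  show ?thesis
    unfolding dual_pair_def using *[of 0 0] *[of 0 1] *[of 1 0] *[of 1 1] assms(2) c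
    by (intro conjI exI[of _ "\<lambda>l. V' $$ (l, 0)"] exI[of _ "\<lambda>l. V' $$ (l, 1)"]) auto
qed

lemma smith_form_rows:
  assumes AB: "A \<in> carrier_vec d" "B \<in> carrier_vec d" and d: "2 \<le> d"
    and U: "U \<in> carrier_mat 2 2" and V: "V \<in> carrier_mat d d"
    and S: "S = mat 2 d (\<lambda>(i, j). if i = 0 \<and> j = 0 then s else if i = 1 \<and> j = 1 then t else 0)"
    and eq: "mat_of_rows d [A, B] = U * S * V"
  shows "A = (U $$ (0, 0) * s) \<cdot>\<^sub>v row V 0 + (U $$ (0, 1) * t) \<cdot>\<^sub>v row V 1"
    "B = (U $$ (1, 0) * s) \<cdot>\<^sub>v row V 0 + (U $$ (1, 1) * t) \<cdot>\<^sub>v row V 1"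
proof -
  have Sc: "S \<in> carrier_mat 2 d" unfolding S by simp
  then have USc: "U * S \<in> carrier_mat 2 d" using U by simp
  have US: "(U * S) $$ (i, l) = (if l = 0 then U $$ (i, 0) * s else if l = 1 then U $$ (i, 1) * t else 0)"
    if "i < 2" "l < d" for i l
    unfolding index_mult_sum[OF U Sc that] lessThan_2 using that by (auto simp: S)
  have USV: "(U * S * V) $$ (i, j) = U $$ (i, 0) * s * V $$ (0, j) + U $$ (i, 1) * t * V $$ (1, j)"
    if "i < 2" "j < d" for i j
  proof -
    have "(U * S * V) $$ (i, j) = (\<Sum>l<d. (U * S) $$ (i, l) * V $$ (l, j))"
      by (rule index_mult_sum[OF USc V that])
    also have "\<dots> = (\<Sum>l\<in>{0, 1}. (U * S) $$ (i, l) * V $$ (l, j))"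
      by (rule sum.mono_neutral_right) (use d that in \<open>auto simp: US\<close>)
    also have "\<dots> = U $$ (i, 0) * s * V $$ (0, j) + U $$ (i, 1) * t * V $$ (1, j)"
      using d that by (simp add: US)
    finally show ?thesis .
  qed
  have AB': "vec_index A j = mat_of_rows d [A, B] $$ (0, j)" "vec_index B j = mat_of_rows d [A, B] $$ (1, j)" if "j < d" for j
    using that by (simp_all add: mat_of_rows_index)
  show "A = (U $$ (0, 0) * s) \<cdot>\<^sub>v row V 0 + (U $$ (0, 1) * t) \<cdot>\<^sub>v row V 1"
    using AB d V by (intro eq_vecI) (simp_all add: AB' eq USV)
  show "B = (U $$ (1, 0) * s) \<cdot>\<^sub>v row V 0 + (U $$ (1, 1) * t) \<cdot>\<^sub>v row V 1"
    using AB d V by (intro eq_vecI) (simp_all add: AB' eq USV)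
qed

lemma module2_lincomb:
  assumes PQ: "P \<in> carrier_vec d" "Q \<in> carrier_vec d" and det: "a * e - b * c \<noteq> 0"
  shows "module2 d (a \<cdot>\<^sub>v P + b \<cdot>\<^sub>v Q) (c \<cdot>\<^sub>v P + e \<cdot>\<^sub>v Q) = module2 d P Q"
proof -
  let ?A = "a \<cdot>\<^sub>v P + b \<cdot>\<^sub>v Q" and ?B = "c \<cdot>\<^sub>v P + e \<cdot>\<^sub>v Q"
  have ABc: "?A \<in> carrier_vec d" "?B \<in> carrier_vec d" using PQ by auto
  let ?f = "to_fract :: real poly \<Rightarrow> _"
  have D: "?f a * ?f e - ?f b * ?f c \<noteq> 0" (is "?D \<noteq> 0")
    using det by (metis to_fract_diff to_fract_mult to_fract_eq_0_iff)
  have iA: "?f (vec_index ?A i) = ?f a * ?f (vec_index P i) + ?f b * ?f (vec_index Q i)"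
    and iB: "?f (vec_index ?B i) = ?f c * ?f (vec_index P i) + ?f e * ?f (vec_index Q i)" if "i < d" for i
    unfolding vec_lincomb_index[OF PQ that] by (simp_all add: to_fract_add to_fract_mult)
  show ?thesis
  proof (intro equalityI subsetI)
    fix C assume "C \<in> module2 d ?A ?B"
    then obtain x y where C: "C \<in> carrier_vec d"
      "\<And>i. i < d \<Longrightarrow> ?f (vec_index C i) = x * ?f (vec_index ?A i) + y * ?f (vec_index ?B i)"
      unfolding module2_iff[OF ABc] by blast
    have "\<forall>i<d. ?f (vec_index C i) = (x * ?f a + y * ?f c) * ?f (vec_index P i) + (x * ?f b + y * ?f e) * ?f (vec_index Q i)"
      using C(2) iA iB by (simp add: algebra_simps)
    then show "C \<in> module2 d P Q" unfolding module2_iff[OF PQ] using C(1) by blast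
  next
    fix C assume "C \<in> module2 d P Q"
    then obtain x y where C: "C \<in> carrier_vec d"
      "\<And>i. i < d \<Longrightarrow> ?f (vec_index C i) = x * ?f (vec_index P i) + y * ?f (vec_index Q i)"
      unfolding module2_iff[OF PQ] by blast
    have solve: "x * p + y * q = (x * e' - y * c') / (a' * e' - b' * c') * (a' * p + b' * q) +
        (y * a' - x * b') / (a' * e' - b' * c') * (c' * p + e' * q)"
      if "a' * e' - b' * c' \<noteq> 0" for p q a' b' c' e'
    proof -
      have "(x * e' - y * c') * (a' * p + b' * q) + (y * a' - x * b') * (c' * p + e' * q) =
          (x * p + y * q) * (a' * e' - b' * c')" by (simp add: algebra_simps)
      then have "x * p + y * q = ((x * e' - y * c') * (a' * p + b' * q) + (y * a' - x * b') * (c' * p + e' * q)) / (a' * e' - b' * c')"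
        using that by (simp add: field_simps)
      then show ?thesis by (simp add: add_divide_distrib)
    qed
    have "\<forall>i<d. ?f (vec_index C i) = (x * ?f e - y * ?f c) / ?D * ?f (vec_index ?A i) +
        (y * ?f a - x * ?f b) / ?D * ?f (vec_index ?B i)"
      using C(2) iA iB solve[OF D] by simp
    then show "C \<in> module2 d ?A ?B" unfolding module2_iff[OF ABc] using C(1) by blast
  qed
qed

text \<open>For determinant zero, the rows of the adjugate are coefficients of relations; if they
  vanish as well, both combinations are zero.\<close>

lemma indep_pair_det:
  assumes PQ: "P \<in> carrier_vec d" "Q \<in> carrier_vec d"
    and ind: "indep_pair d (a \<cdot>\<^sub>v P + b \<cdot>\<^sub>v Q) (c \<cdot>\<^sub>v P + e \<cdot>\<^sub>v Q)"
  shows "a * e - b * c \<noteq> (0 :: 'a::comm_ring_1)"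
proof
  assume 0: "a * e - b * c = 0"
  have eb: "e * a = b * c" "c * b = a * e" using 0 by (simp_all add: mult.commute)
  have "e \<cdot>\<^sub>v (a \<cdot>\<^sub>v P + b \<cdot>\<^sub>v Q) + (- b) \<cdot>\<^sub>v (c \<cdot>\<^sub>v P + e \<cdot>\<^sub>v Q) = 0\<^sub>v d"
    "(- c) \<cdot>\<^sub>v (a \<cdot>\<^sub>v P + b \<cdot>\<^sub>v Q) + a \<cdot>\<^sub>v (c \<cdot>\<^sub>v P + e \<cdot>\<^sub>v Q) = 0\<^sub>v d"
    using PQ eb by (intro eq_vecI; simp add: distrib_left mult.assoc[symmetric] mult.commute)+
  then have "e = 0 \<and> - b = 0" "- c = 0 \<and> a = 0" using ind unfolding indep_pair_def by blast+
  then have "(1::'a) \<cdot>\<^sub>v (a \<cdot>\<^sub>v P + b \<cdot>\<^sub>v Q) + 0 \<cdot>\<^sub>v (c \<cdot>\<^sub>v P + e \<cdot>\<^sub>v Q) = 0\<^sub>v d"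
    using PQ by (intro eq_vecI) auto
  then have "(1::'a) = 0" using ind unfolding indep_pair_def by blast
  then show False by simp
qed

section \<open>Elimination by unimodular matrices\<close>

definition reach :: "nat \<Rightarrow> real poly mat \<Rightarrow> real poly mat \<Rightarrow> bool" where
  "reach d M N \<longleftrightarrow> (\<exists>U V. unimodular 2 U \<and> unimodular d V \<and> N = U * M * V)"

text \<open>Right multiplication adds multiples of column \<open>p\<close> to the later columns. The
  \<open>2 \<times> 2\<close> instance and its transpose serve for the row operations.\<close>

definition elim_mat :: "nat \<Rightarrow> nat \<Rightarrow> (nat \<Rightarrow> real poly) \<Rightarrow> real poly mat" where
  "elim_mat d p c = mat d d (\<lambda>(i, j). if i = j then 1 else if i = p \<and> p < j then c j else 0)"

lemma unimodular_elim_mat: "unimodular d (elim_mat d p c)"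
proof -
  have c: "elim_mat d p c \<in> carrier_mat d d" by (simp add: elim_mat_def)
  have "upper_triangular (elim_mat d p c)" by (auto simp: elim_mat_def upper_triangular_def)
  then have "det (elim_mat d p c) = prod_list (diag_mat (elim_mat d p c))" using c by (rule det_upper_triangular)
  also have "diag_mat (elim_mat d p c) = replicate d 1"
    by (rule nth_equalityI) (auto simp: diag_mat_def elim_mat_def)
  finally show ?thesis using c unfolding unimodular_def by simp
qed

lemma unimodular_swaprows_mat: "k < d \<Longrightarrow> l < d \<Longrightarrow> unimodular d (swaprows_mat d k l)"
proof (cases "k = l")
  case True
  assume "k < d" "l < d"
  then have "(swaprows_mat d k l :: real poly mat) = 1\<^sub>m d" using True by (intro eq_matI) (auto simp: swaprows_mat_def)
  then show ?thesis using unimodular_one[of d] by (simp only:)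
next
  case False
  assume "k < d" "l < d"
  then have "det (swaprows_mat d k l :: real poly mat) = - 1" using det_swaprows_mat[of k d l] False by blast
  then show ?thesis unfolding unimodular_def by simp
qed

lemma unimodular_transpose: "unimodular d U \<Longrightarrow> unimodular d (transpose_mat U)"
  unfolding unimodular_def by (auto simp: det_transpose)

lemma reach_refl: "M \<in> carrier_mat 2 d \<Longrightarrow> reach d M M"
  unfolding reach_def by (intro exI[of _ "1\<^sub>m 2"] exI[of _ "1\<^sub>m d"]) (auto simp: unimodular_one)

lemma reach_carrier: "reach d M N \<Longrightarrow> M \<in> carrier_mat 2 d \<Longrightarrow> N \<in> carrier_mat 2 d"
  unfolding reach_def unimodular_def by auto

lemma reach_mult_right:
  assumes "M \<in> carrier_mat 2 d" "reach d M N" "unimodular d W"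
  shows "reach d M (N * W)"
proof -
  obtain U V where UV: "unimodular 2 U" "unimodular d V" "N = U * M * V" using assms(2) unfolding reach_def by blast
  have "N * W = U * M * (V * W)"
    unfolding UV(3) using UV(1,2) assms(1,3) unfolding unimodular_def by (intro assoc_mult_mat) auto
  then show ?thesis unfolding reach_def using UV(1) unimodular_mult[OF UV(2) assms(3)] by blast
qed

lemma reach_mult_left:
  assumes "M \<in> carrier_mat 2 d" "reach d M N" "unimodular 2 W"
  shows "reach d M (W * N)"
proof -
  obtain U V where UV: "unimodular 2 U" "unimodular d V" "N = U * M * V" using assms(2) unfolding reach_def by blast
  have c: "U \<in> carrier_mat 2 2" "V \<in> carrier_mat d d" "W \<in> carrier_mat 2 2"
    using UV assms(3) unfolding unimodular_def by auto
  have "W * N = (W * (U * M)) * V"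
    unfolding UV(3) using c assms(1) by (intro assoc_mult_mat[symmetric]) auto
  also have "W * (U * M) = (W * U) * M"
    using c assms(1) by (intro assoc_mult_mat[symmetric]) auto
  finally show ?thesis unfolding reach_def using UV(2) unimodular_mult[OF assms(3) UV(1)] by blast
qed

lemma index_elim_right:
  assumes "N \<in> carrier_mat n d" "i < n" "j < d" "p < d"
  shows "(N * elim_mat d p c) $$ (i, j) = N $$ (i, j) + (if p < j then N $$ (i, p) * c j else 0)"
proof -
  have "(N * elim_mat d p c) $$ (i, j) = (\<Sum>l<d. N $$ (i, l) * elim_mat d p c $$ (l, j))"
    by (rule index_mult_sum) (use assms in \<open>auto simp: elim_mat_def\<close>)
  also have "\<dots> = (\<Sum>l<d. (if l = j then N $$ (i, j) else 0) + (if l = p then (if p < j then N $$ (i, p) * c j else 0) else 0))"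
    by (rule sum.cong) (use assms in \<open>auto simp: elim_mat_def\<close>)
  also have "\<dots> = N $$ (i, j) + (if p < j then N $$ (i, p) * c j else 0)"
    using assms by (simp add: sum.distrib)
  finally show ?thesis .
qed

lemma index_elim_left:
  assumes "N \<in> carrier_mat 2 d" "j < d"
  shows "(elim_mat 2 0 c * N) $$ (0, j) = N $$ (0, j) + c 1 * N $$ (1, j)"
    "(elim_mat 2 0 c * N) $$ (1, j) = N $$ (1, j)"
    "(transpose_mat (elim_mat 2 0 c) * N) $$ (0, j) = N $$ (0, j)"
    "(transpose_mat (elim_mat 2 0 c) * N) $$ (1, j) = c 1 * N $$ (0, j) + N $$ (1, j)"
proof -
  have c: "elim_mat 2 0 c \<in> carrier_mat 2 2" "transpose_mat (elim_mat 2 0 c) \<in> carrier_mat 2 2"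
    by (simp_all add: elim_mat_def)
  show "(elim_mat 2 0 c * N) $$ (0, j) = N $$ (0, j) + c 1 * N $$ (1, j)"
    "(elim_mat 2 0 c * N) $$ (1, j) = N $$ (1, j)"
    "(transpose_mat (elim_mat 2 0 c) * N) $$ (0, j) = N $$ (0, j)"
    "(transpose_mat (elim_mat 2 0 c) * N) $$ (1, j) = c 1 * N $$ (0, j) + N $$ (1, j)"
    using index_mult_sum[OF c(1) assms(1) _ assms(2)] index_mult_sum[OF c(2) assms(1) _ assms(2)]
    by (simp_all add: lessThan_2, simp_all add: elim_mat_def)
qed

text \<open>No algorithm is run: an entry \<open>a\<close> of least degree among the nonzero entries
  of all equivalent matrices is moved to the corner. A remainder modulo \<open>a\<close> is an entry
  of another equivalent matrix and has smaller degree, so it vanishes.\<close>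

lemma smith_reduction:
  assumes M: "M \<in> carrier_mat 2 d" and d: "2 \<le> d" and nz: "\<exists>i<2. \<exists>j<d. M $$ (i, j) \<noteq> 0"
  shows "\<exists>a b. reach d M (mat 2 d (\<lambda>(i, j). if i = 0 \<and> j = 0 then a else if i = 1 \<and> j = 1 then b else 0)) \<and>
    a dvd b \<and> a \<noteq> 0"
proof -
  have carr: "N \<in> carrier_mat 2 d" if "reach d M N" for N using reach_carrier[OF that M] .
  define D where "D = {degree (N $$ (i, j)) | N i j. reach d M N \<and> i < 2 \<and> j < d \<and> N $$ (i, j) \<noteq> 0}"
  define \<delta> where "\<delta> = (LEAST n. n \<in> D)"
  have "D \<noteq> {}" unfolding D_def using nz reach_refl[OF M] by blast
  then have "\<delta> \<in> D" unfolding \<delta>_def by (metis LeastI ex_in_conv)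
  then obtain N0 i0 j0 where N0: "reach d M N0" "i0 < 2" "j0 < d" "N0 $$ (i0, j0) \<noteq> 0" "degree (N0 $$ (i0, j0)) = \<delta>"
    unfolding D_def by auto
  have min: "N $$ (i, j) = 0" if "reach d M N" "i < 2" "j < d" "degree (N $$ (i, j)) < \<delta>" for N i j
  proof (rule ccontr)
    assume "N $$ (i, j) \<noteq> 0"
    then have "degree (N $$ (i, j)) \<in> D" unfolding D_def using that by blast
    then have "\<delta> \<le> degree (N $$ (i, j))" unfolding \<delta>_def by (rule Least_le)
    then show False using that(4) by simp
  qed
  define N1 where "N1 = swaprows_mat 2 0 i0 * N0 * swaprows_mat d 0 j0"
  define a where "a = N0 $$ (i0, j0)"
  have a: "a \<noteq> 0" "degree a = \<delta>" using N0 unfolding a_def by auto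
  have N1: "reach d M N1" "N1 $$ (0, 0) = a"
  proof -
    have r: "reach d M (swaprows_mat 2 0 i0 * N0)"
      using reach_mult_left[OF M N0(1) unimodular_swaprows_mat] N0(2) by simp
    show "reach d M N1"
      unfolding N1_def using reach_mult_right[OF M r unimodular_swaprows_mat] N0(3) by simp
    have "N1 = swapcols 0 j0 (swaprows 0 i0 N0)"
      unfolding N1_def using N0(2,3) carr[OF N0(1)] carr[OF r] d
      by (simp add: swapcols_mat[symmetric] swaprows_mat[symmetric])
    then show "N1 $$ (0, 0) = a"
      unfolding a_def using N0(2,3) carr[OF N0(1)] d by auto
  qed
  have divides: "a dvd N $$ (0, j)" if N: "reach d M N" "N $$ (0, 0) = a" and j: "j < d" for N j
  proof (cases "j = 0")
    case False
    let ?c = "\<lambda>j. - (N $$ (0, j) div a)"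
    let ?N = "N * elim_mat d 0 ?c"
    have r: "reach d M ?N" by (rule reach_mult_right[OF M N(1) unimodular_elim_mat])
    have e: "?N $$ (0, j) = N $$ (0, j) mod a"
      using index_elim_right[OF carr[OF N(1)], of 0 j 0 ?c] d j False N(2)
      by (simp add: minus_div_mult_eq_mod[symmetric] mult.commute)
    have "N $$ (0, j) mod a = 0"
    proof (rule ccontr)
      assume n: "N $$ (0, j) mod a \<noteq> 0"
      then have "degree (N $$ (0, j) mod a) < \<delta>" using degree_mod_less[OF a(1), of "N $$ (0, j)"] a(2) by simp
      then show False using min[OF r, of 0 j] e j n by simp
    qed
    then show ?thesis by auto
  qed (use N in simp)
  define N2 where "N2 = N1 * elim_mat d 0 (\<lambda>j. - (N1 $$ (0, j) div a))"
  have N2: "reach d M N2" unfolding N2_def by (rule reach_mult_right[OF M N1(1) unimodular_elim_mat])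
  have N20: "N2 $$ (0, j) = (if j = 0 then a else 0)" if "j < d" for j
    unfolding N2_def using index_elim_right[OF carr[OF N1(1)], of 0 j 0] divides[OF N1 that] that d N1(2) by auto
  define N3 where "N3 = transpose_mat (elim_mat 2 0 (\<lambda>_. - (N2 $$ (1, 0) div a))) * N2"
  have N3: "reach d M N3"
    unfolding N3_def by (rule reach_mult_left[OF M N2 unimodular_transpose[OF unimodular_elim_mat]])
  have N30: "N3 $$ (0, j) = (if j = 0 then a else 0)" if "j < d" for j
    unfolding N3_def using index_elim_left(3)[OF carr[OF N2] that] N20[OF that] by simp
  have N310: "N3 $$ (1, 0) = 0"
  proof -
    have e: "N3 $$ (1, 0) = N2 $$ (1, 0) mod a"
      unfolding N3_def using index_elim_left(4)[OF carr[OF N2], of 0] d N20[of 0]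
      by (simp add: minus_div_mult_eq_mod[symmetric] add.commute)
    show ?thesis
    proof (rule ccontr)
      assume n: "N3 $$ (1, 0) \<noteq> 0"
      then have "degree (N3 $$ (1, 0)) < \<delta>" unfolding e using degree_mod_less[OF a(1), of "N2 $$ (1, 0)"] a(2) by simp
      then show False using min[OF N3, of 1 0] d n by simp
    qed
  qed
  \<comment> \<open>Equivalent matrices whose first row and column are already cleared; the same
    minimality argument is repeated for their second rows.\<close>
  define G where "G = {N. reach d M N \<and> (\<forall>j<d. N $$ (0, j) = (if j = 0 then a else 0)) \<and> N $$ (1, 0) = 0}"
  have N3G: "N3 \<in> G" unfolding G_def using N3 N30 N310 by simp
  have divG: "a dvd N $$ (1, j)" if N: "N \<in> G" and j: "j < d" for N j
  proof -
    have Nr: "reach d M N" using N unfolding G_def by simp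
    \<comment> \<open>Adding the second row to the first keeps the corner \<open>a\<close>, so
      divisibility along the first row applies to the entries of the second row.\<close>
    let ?N = "elim_mat 2 0 (\<lambda>_. 1) * N"
    have r: "reach d M ?N" by (rule reach_mult_left[OF M Nr unimodular_elim_mat])
    have e: "?N $$ (0, k) = (if k = 0 then a else N $$ (1, k))" if "k < d" for k
      using index_elim_left(1)[OF carr[OF Nr] that, of "\<lambda>_. 1"] N that unfolding G_def by auto
    have "a dvd ?N $$ (0, j)" by (rule divides[OF r _ j]) (use e d in simp)
    then show ?thesis using e[OF j] N unfolding G_def by (auto split: if_splits)
  qed
  have diag: "N = mat 2 d (\<lambda>(i, j). if i = 0 \<and> j = 0 then a else if i = 1 \<and> j = 1 then N $$ (1, 1) else 0)"
    if N: "N \<in> G" and z: "\<And>j. 2 \<le> j \<Longrightarrow> j < d \<Longrightarrow> N $$ (1, j) = 0" for N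
  proof (rule eq_matI)
    have c: "N \<in> carrier_mat 2 d" using N carr unfolding G_def by blast
    then show "dim_row N = dim_row (mat 2 d (\<lambda>(i, j). if i = 0 \<and> j = 0 then a else if i = 1 \<and> j = 1 then N $$ (1, 1) else 0))"
      "dim_col N = dim_col (mat 2 d (\<lambda>(i, j). if i = 0 \<and> j = 0 then a else if i = 1 \<and> j = 1 then N $$ (1, 1) else 0))"
      by auto
    fix i j
    assume "i < dim_row (mat 2 d (\<lambda>(i, j). if i = 0 \<and> j = 0 then a else if i = 1 \<and> j = 1 then N $$ (1, 1) else 0))"
      "j < dim_col (mat 2 d (\<lambda>(i, j). if i = 0 \<and> j = 0 then a else if i = 1 \<and> j = 1 then N $$ (1, 1) else 0))"
    then have ij: "i < 2" "j < d" by auto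
    then consider "i = 0" | "i = 1" "j = 0" | "i = 1" "j = 1" | "i = 1" "2 \<le> j" by linarith
    then show "N $$ (i, j) = mat 2 d (\<lambda>(i, j). if i = 0 \<and> j = 0 then a else if i = 1 \<and> j = 1 then N $$ (1, 1) else 0) $$ (i, j)"
      by cases (use N z ij in \<open>auto simp: G_def\<close>)
  qed
  show ?thesis
  proof (cases "\<exists>N\<in>G. \<exists>j<d. N $$ (1, j) \<noteq> 0")
    case False
    then have "N3 = mat 2 d (\<lambda>(i, j). if i = 0 \<and> j = 0 then a else if i = 1 \<and> j = 1 then N3 $$ (1, 1) else 0)"
      using diag[OF N3G] N3G by blast
    then show ?thesis using N3 divG[OF N3G, of 1] a(1) d by (intro exI[of _ a] exI[of _ "N3 $$ (1, 1)"]) auto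
  next
    case True
    define D' where "D' = {degree (N $$ (1, j)) | N j. N \<in> G \<and> j < d \<and> N $$ (1, j) \<noteq> 0}"
    define \<epsilon> where "\<epsilon> = (LEAST n. n \<in> D')"
    have "D' \<noteq> {}" unfolding D'_def using True by blast
    then have "\<epsilon> \<in> D'" unfolding \<epsilon>_def by (metis LeastI ex_in_conv)
    then obtain N4 j1 where N4: "N4 \<in> G" "j1 < d" "N4 $$ (1, j1) \<noteq> 0" "degree (N4 $$ (1, j1)) = \<epsilon>"
      unfolding D'_def by auto
    have min': "N $$ (1, j) = 0" if "N \<in> G" "j < d" "degree (N $$ (1, j)) < \<epsilon>" for N j
    proof (rule ccontr)
      assume "N $$ (1, j) \<noteq> 0"
      then have "degree (N $$ (1, j)) \<in> D'" unfolding D'_def using that by blast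
      then have "\<epsilon> \<le> degree (N $$ (1, j))" unfolding \<epsilon>_def by (rule Least_le)
      then show False using that(3) by simp
    qed
    \<comment> \<open>Column 0 stays fixed when the least entry is swapped into position
      \<open>(1, 1)\<close>, so the matrix remains in \<open>G\<close>.\<close>
    have j1: "j1 \<noteq> 0" using N4(1,3) unfolding G_def by (metis (mono_tags, lifting) mem_Collect_eq)
    define b where "b = N4 $$ (1, j1)"
    have b: "b \<noteq> 0" "degree b = \<epsilon>" using N4 unfolding b_def by auto
    have N4r: "reach d M N4" using N4(1) unfolding G_def by simp
    define N5 where "N5 = N4 * swaprows_mat d 1 j1"
    have N5: "reach d M N5"
      unfolding N5_def by (rule reach_mult_right[OF M N4r unimodular_swaprows_mat]) (use d N4(2) in auto)
    have "N5 = swapcols 1 j1 N4"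
      unfolding N5_def by (rule swapcols_mat[symmetric, OF carr[OF N4r]]) (use d N4(2) in auto)
    then have N5i: "N5 $$ (i, j) = N4 $$ (i, if j = 1 then j1 else if j = j1 then 1 else j)" if "i < 2" "j < d" for i j
      using that carr[OF N4r] by auto
    have N5G: "N5 \<in> G" unfolding G_def using N5 N5i N4(1) N4(2) j1 d by (auto simp: G_def)
    have N51: "N5 $$ (1, 1) = b" using N5i[of 1 1] d unfolding b_def by simp
    define N6 where "N6 = N5 * elim_mat d 1 (\<lambda>j. - (N5 $$ (1, j) div b))"
    have N6: "reach d M N6" unfolding N6_def by (rule reach_mult_right[OF M N5 unimodular_elim_mat])
    have N6i: "N6 $$ (i, j) = N5 $$ (i, j) + (if 1 < j then N5 $$ (i, 1) * (- (N5 $$ (1, j) div b)) else 0)"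
      if "i < 2" "j < d" for i j
      unfolding N6_def by (rule index_elim_right[OF carr[OF N5] that]) (use d in simp)
    have N6G: "N6 \<in> G" unfolding G_def using N6 N6i N5G d by (auto simp: G_def)
    have "N6 $$ (1, j) = 0" if "2 \<le> j" "j < d" for j
    proof (rule ccontr)
      assume n: "N6 $$ (1, j) \<noteq> 0"
      have e: "N6 $$ (1, j) = N5 $$ (1, j) mod b"
        using N6i[of 1 j] that N51 by (simp add: minus_div_mult_eq_mod[symmetric] mult.commute)
      then have "degree (N6 $$ (1, j)) < \<epsilon>"
        using n degree_mod_less[OF b(1), of "N5 $$ (1, j)"] b(2) by simp
      then show False using min'[OF N6G that(2)] n by simp
    qed
    then have "N6 = mat 2 d (\<lambda>(i, j). if i = 0 \<and> j = 0 then a else if i = 1 \<and> j = 1 then N6 $$ (1, 1) else 0)"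
      using diag[OF N6G] by blast
    then show ?thesis using N6 divG[OF N6G, of 1] a(1) d by (intro exI[of _ a] exI[of _ "N6 $$ (1, 1)"]) auto
  qed
qed

text \<open>The diagonal from the reduction is determined up to units. The entries of
  \<open>A\<close> and \<open>B\<close> generate the same ideal as \<open>a\<close>, and their
  brackets the same ideal as \<open>a * b\<close>, which identifies the normalised values with those
  in \<open>smith_diag\<close>.\<close>

lemma smith_form_exists:
  assumes AB: "A \<in> carrier_vec d" "B \<in> carrier_vec d" and ind: "indep_pair d A B" and d: "2 \<le> d"
  shows "\<exists>U V. smith_form d A B U V"
proof -
  define M where "M = mat_of_rows d [A, B]"
  have Mc: "M \<in> carrier_mat 2 d" unfolding M_def using mat_of_rows_carrier(1)[of d "[A, B]"] by (simp add: numeral_2_eq_2)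
  have M0: "M $$ (0, j) = vec_index A j" and M1: "M $$ (1, j) = vec_index B j" if "j < d" for j
    using that unfolding M_def by (simp_all add: mat_of_rows_index)
  have "\<exists>j<d. vec_index A j \<noteq> 0"
  proof (rule ccontr)
    assume "\<not> ?thesis"
    then have "1 \<cdot>\<^sub>v A + 0 \<cdot>\<^sub>v B = 0\<^sub>v d" using AB by (intro eq_vecI) auto
    then have "(1 :: real poly) = 0" using ind unfolding indep_pair_def by blast
    then show False by simp
  qed
  then obtain j0 where "j0 < d" "M $$ (0, j0) \<noteq> 0" using M0 by auto
  then have "\<exists>i<2. \<exists>j<d. M $$ (i, j) \<noteq> 0" by (intro exI[of _ 0]) auto
  from smith_reduction[OF Mc d this] obtain a b where
    r: "reach d M (mat 2 d (\<lambda>(i, j). if i = 0 \<and> j = 0 then a else if i = 1 \<and> j = 1 then b else 0))"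
    and ab: "a dvd b" "a \<noteq> 0" by blast
  define N where "N = mat 2 d (\<lambda>(i, j). if i = 0 \<and> j = 0 then a else if i = 1 \<and> j = 1 then b else 0)"
  have Nc: "N \<in> carrier_mat 2 d" by (simp add: N_def)
  obtain U V where UV: "unimodular 2 U" "unimodular d V" "N = U * M * V"
    using r unfolding reach_def N_def by blast
  obtain U' where U': "unimodular 2 U'" "U' * U = 1\<^sub>m 2" using unimodular_inverse[OF UV(1)] by blast
  obtain V' where V': "unimodular d V'" "V * V' = 1\<^sub>m d" using unimodular_inverse[OF UV(2)] by blast
  have c: "U \<in> carrier_mat 2 2" "U' \<in> carrier_mat 2 2" "V \<in> carrier_mat d d" "V' \<in> carrier_mat d d"
    using UV U' V' unfolding unimodular_def by auto
  have MN: "M = U' * N * V'"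
  proof -
    have "U' * N * V' = U' * (N * V')" using c Nc by (intro assoc_mult_mat) auto
    also have "N * V' = U * M * (V * V')" unfolding UV(3) using c Mc by (intro assoc_mult_mat) auto
    also have "\<dots> = U * M" unfolding V'(2) using c Mc by simp
    also have "U' * (U * M) = (U' * U) * M" using c Mc by (intro assoc_mult_mat[symmetric]) auto
    also have "\<dots> = M" unfolding U'(2) using Mc by simp
    finally show ?thesis ..
  qed
  define P where "P = row V' 0"
  define Q where "Q = row V' 1"
  have PQ: "dual_pair d P Q" unfolding P_def Q_def by (rule unimodular_rows_dual_pair[OF V'(1) d])
  then have PQc: "P \<in> carrier_vec d" "Q \<in> carrier_vec d" unfolding dual_pair_def by auto
  let ?u = "\<lambda>i j. U' $$ (i, j)"
  have A: "A = (?u 0 0 * a) \<cdot>\<^sub>v P + (?u 0 1 * b) \<cdot>\<^sub>v Q" and B: "B = (?u 1 0 * a) \<cdot>\<^sub>v P + (?u 1 1 * b) \<cdot>\<^sub>v Q"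
    using smith_form_rows[OF AB d c(2,4) N_def MN[unfolded M_def]] unfolding P_def Q_def by blast+
  let ?\<Delta> = "?u 0 0 * a * (?u 1 1 * b) - ?u 0 1 * b * (?u 1 0 * a)"
  have D: "?\<Delta> = det U' * (a * b)"
    unfolding det_carrier_2[OF c(2)] by (simp add: algebra_simps)
  have "?\<Delta> \<noteq> 0" by (rule indep_pair_det[OF PQc]) (use ind A B in simp)
  then have b0: "b \<noteq> 0" by auto
  have br: "bracket A B i j = ?\<Delta> * bracket P Q i j" if "i < d" "j < d" for i j
    by (subst A, subst B, rule bracket_lincomb[OF PQc that])
  have s: "Gcd (set\<^sub>v A \<union> set\<^sub>v B) = normalize a"
  proof (rule Gcd_eqI)
    fix x assume "x \<in> set\<^sub>v A \<union> set\<^sub>v B"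
    then obtain j where j: "j < d" "x = vec_index A j \<or> x = vec_index B j" using AB unfolding vec_set_def by auto
    have "vec_index A j = ?u 0 0 * a * vec_index P j + ?u 0 1 * b * vec_index Q j"
      "vec_index B j = ?u 1 0 * a * vec_index P j + ?u 1 1 * b * vec_index Q j"
      by (subst A, rule vec_lincomb_index[OF PQc j(1)]) (subst B, rule vec_lincomb_index[OF PQc j(1)])
    then have "a dvd x" using j(2) ab(1) by auto
    then show "normalize a dvd x" by simp
  next
    fix x assume x: "\<And>y. y \<in> set\<^sub>v A \<union> set\<^sub>v B \<Longrightarrow> x dvd y"
    have xAB: "x dvd vec_index A j" "x dvd vec_index B j" if "j < d" for j
      using x[of "vec_index A j"] x[of "vec_index B j"] AB that unfolding vec_set_def by auto
    \<comment> \<open>The converse divisibility: \<open>a\<close> is an entry of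
      \<open>U * M * V\<close>, hence a combination of the entries of \<open>A\<close> and
      \<open>B\<close>.\<close>
    have UM: "U * M \<in> carrier_mat 2 d" using c Mc by simp
    have "a = N $$ (0, 0)" using d unfolding N_def by simp
    also have "\<dots> = (\<Sum>l<d. (U * M) $$ (0, l) * V $$ (l, 0))"
      unfolding UV(3) by (rule index_mult_sum[OF UM c(3)]) (use d in auto)
    also have "x dvd \<dots>"
    proof (rule dvd_sum)
      fix l assume "l \<in> {..<d}"
      then have l: "l < d" by simp
      have "(U * M) $$ (0, l) = U $$ (0, 0) * vec_index A l + U $$ (0, 1) * vec_index B l"
        using index_mult_sum[OF c(1) Mc _ l, of 0] M0[OF l] M1[OF l] by (simp add: lessThan_2)
      then show "x dvd (U * M) $$ (0, l) * V $$ (l, 0)" using xAB[OF l] by simp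
    qed
    finally show "x dvd normalize a" by simp
  qed simp
  have q: "wedge_gcd A B = normalize (a * b)"
    unfolding wedge_gcd_def set_wedge[OF AB(1)]
  proof (rule Gcd_eqI)
    fix x assume "x \<in> {bracket A B i j | i j. i < j \<and> j < d}"
    then obtain i j where "i < j" "j < d" "x = bracket A B i j" by blast
    then have ij: "i < d" "j < d" "x = bracket A B i j" by auto
    have "a * b dvd x" unfolding ij(3) br[OF ij(1,2)] D by simp
    then show "normalize (a * b) dvd x" by simp
  next
    fix x assume x: "\<And>y. y \<in> {bracket A B i j | i j. i < j \<and> j < d} \<Longrightarrow> x dvd y"
    have xb: "x dvd bracket A B i j" if "i < d" "j < d" for i j
    proof (cases i j rule: linorder_cases)
      case less
      then show ?thesis using x that by blast
    next
      case equal
      then show ?thesis by (simp add: bracket_def)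
    next
      case greater
      then have "x dvd - bracket A B j i" using x that by (metis (mono_tags, lifting) dvd_minus_iff mem_Collect_eq)
      then show ?thesis by (simp add: bracket_def)
    qed
    \<comment> \<open>As the brackets of \<open>P\<close>, \<open>Q\<close> combine to 1, the same
      combination of the brackets of \<open>A\<close>, \<open>B\<close> is the determinant of the
      change of basis.\<close>
    obtain X Y where XY: "(\<Sum>i<d. \<Sum>j<d. bracket P Q i j * (X i * Y j)) = 1" using dual_pair_bracket[OF PQ] .
    have "?\<Delta> = (\<Sum>i<d. \<Sum>j<d. ?\<Delta> * (bracket P Q i j * (X i * Y j)))"
      unfolding sum_distrib_left[symmetric] XY by simp
    also have "\<dots> = (\<Sum>i<d. \<Sum>j<d. bracket A B i j * (X i * Y j))"
      by (intro sum.cong refl) (simp add: br mult.assoc)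
    also have "x dvd \<dots>" using xb by (intro dvd_sum) (auto intro: dvd_mult2)
    finally have "x dvd det U' * (a * b)" unfolding D .
    moreover have "is_unit (det U')" using U'(1) unfolding unimodular_def by simp
    ultimately have "x dvd a * b" using dvd_mult_unit_iff' by blast
    then show "x dvd normalize (a * b)" by simp
  qed simp
  have t: "normalize (a * b) div normalize a = normalize b"
    using ab(2) by (simp add: normalize_mult)
  define S where "S = smith_diag d A B"
  have S: "S = mat 2 d (\<lambda>(i, j). if i = 0 \<and> j = 0 then normalize a else if i = 1 \<and> j = 1 then normalize b else 0)"
    unfolding S_def smith_diag_def Let_def s q t ..
  \<comment> \<open>The unit factors that \<open>Gcd\<close> normalises away are absorbed into the
    left factor.\<close>
  define W where "W = mat 2 2 (\<lambda>(i, j). if i = j then unit_factor (if i = 0 then a else b) else 0)"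
  have Wc: "W \<in> carrier_mat 2 2" by (simp add: W_def)
  have "unimodular 2 W"
  proof -
    have "det W = unit_factor a * unit_factor b" unfolding det_carrier_2[OF Wc] by (simp add: W_def)
    moreover have "is_unit (unit_factor a * unit_factor b)"
      using ab(2) b0 unit_factor_is_unit is_unit_mult_iff by blast
    ultimately show ?thesis unfolding unimodular_def using Wc by simp
  qed
  have NW: "N = W * S"
  proof (rule eq_matI)
    have Sc: "S \<in> carrier_mat 2 d" by (simp add: S)
    show "dim_row N = dim_row (W * S)" "dim_col N = dim_col (W * S)" using Wc Sc Nc by auto
    fix i j assume "i < dim_row (W * S)" "j < dim_col (W * S)"
    then have ij: "i < 2" "j < d" using Wc Sc by auto
    then have "i = 0 \<or> i = 1" by auto
    then show "N $$ (i, j) = (W * S) $$ (i, j)"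
      unfolding index_mult_sum[OF Wc Sc ij] lessThan_2 using ij by (auto simp: N_def W_def S)
  qed
  have "M = (U' * W) * S * V'"
    unfolding MN NW using c Wc by (subst assoc_mult_mat[of U' 2 2 W 2 S d]) (auto simp: S)
  then have "smith_form d A B (U' * W) V'"
    unfolding smith_form_def using unimodular_mult[OF U'(1) \<open>unimodular 2 W\<close>] V'(1) unfolding M_def S_def by blast
  then show ?thesis by blast
qed

section \<open>Pairwise meeting planes\<close>

definition cpx :: "real poly \<Rightarrow> complex poly" where
  "cpx p = map_poly complex_of_real p"

lemma coeff_cpx: "coeff (cpx p) i = complex_of_real (coeff p i)"
  unfolding cpx_def by (rule coeff_map_poly) simp

lemma cpx_simps [simp]: "cpx 0 = 0" "cpx 1 = 1" "cpx (p + q) = cpx p + cpx q" "cpx (p - q) = cpx p - cpx q"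
  "cpx (p * q) = cpx p * cpx q"
  by (auto intro!: poly_eqI simp: coeff_cpx coeff_mult)

lemma cpx_sum: "cpx (sum f A) = (\<Sum>i\<in>A. cpx (f i))"
  by (induction A rule: infinite_finite_induct) auto

lemma degree_cpx [simp]: "degree (cpx p) = degree p"
  unfolding cpx_def by (rule degree_map_poly) simp

lemma cpx_eq_0_iff [simp]: "cpx p = 0 \<longleftrightarrow> p = 0"
  by (auto simp: poly_eq_iff coeff_cpx)

lemma cpx_smult: "cpx (Polynomial.smult c p) = Polynomial.smult (complex_of_real c) (cpx p)"
  by (rule poly_eqI) (simp add: coeff_cpx)

lemma poly_cpx_of_real: "poly (cpx p) (complex_of_real t) = complex_of_real (poly p t)"
  unfolding cpx_def by (simp add: poly_altdef coeff_map_poly degree_map_poly)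

lemma indep2_complex:
  assumes "indep2 d u v"
  shows "indep2 d (\<lambda>i. complex_of_real (u i)) (\<lambda>i. complex_of_real (v i))"
  unfolding indep2_def
proof (intro allI impI)
  fix a b assume *: "\<forall>i<d. a * complex_of_real (u i) + b * complex_of_real (v i) = 0"
  have "Re a * u i + Re b * v i = 0 \<and> Im a * u i + Im b * v i = 0" if "i < d" for i
    using *[rule_format, OF that] by (simp add: complex_eq_iff)
  then have "Re a = 0 \<and> Re b = 0" "Im a = 0 \<and> Im b = 0" using assms unfolding indep2_def by blast+
  then show "a = 0 \<and> b = 0" by (simp add: complex_eq_iff)
qed

lemma indep4_complex:
  assumes "indep4 d u v w s"
  shows "indep4 d (\<lambda>i. complex_of_real (u i)) (\<lambda>i. complex_of_real (v i))
    (\<lambda>i. complex_of_real (w i)) (\<lambda>i. complex_of_real (s i))"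
  unfolding indep4_def
proof (intro allI impI)
  fix a b c e assume *: "\<forall>i<d. a * complex_of_real (u i) + b * complex_of_real (v i) +
      c * complex_of_real (w i) + e * complex_of_real (s i) = 0"
  have "Re a * u i + Re b * v i + Re c * w i + Re e * s i = 0 \<and>
      Im a * u i + Im b * v i + Im c * w i + Im e * s i = 0" if "i < d" for i
    using *[rule_format, OF that] by (simp add: complex_eq_iff)
  then have "Re a = 0 \<and> Re b = 0 \<and> Re c = 0 \<and> Re e = 0" "Im a = 0 \<and> Im b = 0 \<and> Im c = 0 \<and> Im e = 0"
    using assms unfolding indep4_def by blast+
  then show "a = 0 \<and> b = 0 \<and> c = 0 \<and> e = 0" by (simp add: complex_eq_iff)
qed

lemma solve_pair:
  fixes P Q x y :: "'a::field"
  assumes "a * b' - a' * b \<noteq> 0" "x = a * P + b * Q" "y = a' * P + b' * Q"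
  shows "P = (b' / (a * b' - a' * b)) * x + (- b / (a * b' - a' * b)) * y"
    "Q = (- a' / (a * b' - a' * b)) * x + (a / (a * b' - a' * b)) * y"
proof -
  let ?D = "a * b' - a' * b"
  have "P * ?D = b' * x - b * y" "Q * ?D = a * y - a' * x"
    unfolding assms(2,3) by (simp_all add: algebra_simps)
  moreover have "s = t / ?D" if "s * ?D = t" for s t
    unfolding that[symmetric] using assms(1) by simp
  ultimately have "P = (b' * x - b * y) / ?D" "Q = (a * y - a' * x) / ?D" by blast+
  then show "P = (b' / ?D) * x + (- b / ?D) * y" "Q = (- a' / ?D) * x + (a / ?D) * y"
    by (simp_all add: diff_divide_distrib)
qed

text \<open>The classical fact that pairwise meeting lines are concurrent or coplanar: two lines of the
  family span a plane and meet in a point \<open>p\<close>, and every further line passes through \<open>p\<close> or lies in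
  that plane.\<close>

lemma pairwise_meeting_planes:
  fixes P Q :: "real \<Rightarrow> nat \<Rightarrow> real"
  assumes ind: "\<And>t. indep2 d (P t) (Q t)"
    and meet: "\<And>t t'. \<not> indep4 d (P t) (Q t) (P t') (Q t')"
    and distinct: "\<not> (\<exists>a b a' b'. \<forall>i<d. P t2 i = a * P t1 i + b * Q t1 i \<and> Q t2 i = a' * P t1 i + b' * Q t1 i)"
  shows "\<exists>p u v w. (\<exists>i<d. p i \<noteq> 0) \<and> indep3 d u v w \<and>
    (\<forall>t. (\<exists>a b. \<forall>i<d. p i = a * P t i + b * Q t i) \<or>
         (\<exists>a b c a' b' c'. \<forall>i<d. P t i = a * u i + b * v i + c * w i \<and> Q t i = a' * u i + b' * v i + c' * w i))"
proof -
  define u v where "u = P t1" and "v = Q t1"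
  have uv: "indep2 d u v" unfolding u_def v_def by (rule ind)
  \<comment> \<open>A basis \<open>w\<close>, \<open>w'\<close> of the plane at \<open>t2\<close>
    with \<open>w\<close> outside the plane at \<open>t1\<close>; it exists since the planes are
    different, after a swap of the two generators if necessary.\<close>
  have "\<exists>w w'. indep2 d w w' \<and> \<not> (\<exists>a b. \<forall>i<d. w i = a * u i + b * v i) \<and>
      (\<exists>\<sigma> \<tau> \<sigma>' \<tau>'. \<sigma> * \<tau>' - \<sigma>' * \<tau> \<noteq> 0 \<and> (\<forall>i. w i = \<sigma> * P t2 i + \<tau> * Q t2 i \<and> w' i = \<sigma>' * P t2 i + \<tau>' * Q t2 i))"
  proof (cases "\<exists>a b. \<forall>i<d. P t2 i = a * u i + b * v i")
    case False
    moreover have "\<exists>\<sigma> \<tau> \<sigma>' \<tau>'. \<sigma> * \<tau>' - \<sigma>' * \<tau> \<noteq> 0 \<and> (\<forall>i. P t2 i = \<sigma> * P t2 i + \<tau> * Q t2 i \<and> Q t2 i = \<sigma>' * P t2 i + \<tau>' * Q t2 i)"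
      by (rule exI[of _ 1], rule exI[of _ 0], rule exI[of _ 0], rule exI[of _ 1]) simp
    ultimately show ?thesis using ind[of t2] by blast
  next
    case True
    then have "\<not> (\<exists>a b. \<forall>i<d. Q t2 i = a * u i + b * v i)" using distinct unfolding u_def v_def by blast
    moreover have "indep2 d (Q t2) (P t2)" using ind[of t2] unfolding indep2_def by (metis add.commute)
    moreover have "\<exists>\<sigma> \<tau> \<sigma>' \<tau>'. \<sigma> * \<tau>' - \<sigma>' * \<tau> \<noteq> 0 \<and> (\<forall>i. Q t2 i = \<sigma> * P t2 i + \<tau> * Q t2 i \<and> P t2 i = \<sigma>' * P t2 i + \<tau>' * Q t2 i)"
      by (rule exI[of _ 0], rule exI[of _ 1], rule exI[of _ 1], rule exI[of _ 0]) simp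
    ultimately show ?thesis by blast
  qed
  then obtain w w' \<sigma> \<tau> \<sigma>' \<tau>' where ww: "indep2 d w w'" and wn: "\<not> (\<exists>a b. \<forall>i<d. w i = a * u i + b * v i)"
    and st: "\<sigma> * \<tau>' - \<sigma>' * \<tau> \<noteq> 0" "\<And>i. w i = \<sigma> * P t2 i + \<tau> * Q t2 i" "\<And>i. w' i = \<sigma>' * P t2 i + \<tau>' * Q t2 i" by blast
  have uvw: "indep3 d u v w"
    unfolding indep3_def
  proof (intro allI impI)
    fix a b c assume *: "\<forall>i<d. a * u i + b * v i + c * w i = 0"
    have c: "c = 0"
    proof (rule ccontr)
      assume c: "c \<noteq> 0"
      have "w i = (- a / c) * u i + (- b / c) * v i" if "i < d" for i
      proof -
        have "c * w i = - a * u i - b * v i" using *[rule_format, OF that] by simp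
        then show ?thesis using c by (simp add: field_simps)
      qed
      then show False using wn by blast
    qed
    then have "\<forall>i<d. a * u i + b * v i = 0" using * by simp
    then show "a = 0 \<and> b = 0 \<and> c = 0" using c uv unfolding indep2_def by blast
  qed
  have "\<not> indep4 d u v w w'"
  proof
    assume i4: "indep4 d u v w w'"
    have "indep4 d (P t1) (Q t1) (P t2) (Q t2)"
      unfolding indep4_def
    proof (intro allI impI)
      fix a b c e assume *: "\<forall>i<d. a * P t1 i + b * Q t1 i + c * P t2 i + e * Q t2 i = 0"
      let ?D = "\<sigma> * \<tau>' - \<sigma>' * \<tau>"
      have PQ2: "P t2 i = (\<tau>' / ?D) * w i + (- \<tau> / ?D) * w' i" "Q t2 i = (- \<sigma>' / ?D) * w i + (\<sigma> / ?D) * w' i" if "i < d" for i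
        using solve_pair[OF st(1) st(2)[of i] st(3)[of i]] by blast+
      have "a * u i + b * v i + (c * (\<tau>' / ?D) + e * (- \<sigma>' / ?D)) * w i + (c * (- \<tau> / ?D) + e * (\<sigma> / ?D)) * w' i = 0"
        if "i < d" for i
      proof -
        have "a * u i + b * v i + (c * (\<tau>' / ?D) + e * (- \<sigma>' / ?D)) * w i + (c * (- \<tau> / ?D) + e * (\<sigma> / ?D)) * w' i =
            a * u i + b * v i + c * ((\<tau>' / ?D) * w i + (- \<tau> / ?D) * w' i) + e * ((- \<sigma>' / ?D) * w i + (\<sigma> / ?D) * w' i)"
          by (simp add: algebra_simps)
        then show ?thesis using *[rule_format, OF that] PQ2[OF that] unfolding u_def v_def by simp
      qed
      then have 0: "a = 0 \<and> b = 0" using i4 unfolding indep4_def by blast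
      then have "\<forall>i<d. c * P t2 i + e * Q t2 i = 0" using * by simp
      then show "a = 0 \<and> b = 0 \<and> c = 0 \<and> e = 0" using 0 ind[of t2] unfolding indep2_def by blast
    qed
    then show False using meet by blast
  qed
  then obtain a b c e where rel: "\<forall>i<d. a * u i + b * v i + c * w i + e * w' i = 0" "\<not> (a = 0 \<and> b = 0 \<and> c = 0 \<and> e = 0)"
    unfolding indep4_def by blast
  have e0: "e \<noteq> 0"
  proof
    assume "e = 0"
    then have "\<forall>i<d. a * u i + b * v i + c * w i = 0" using rel(1) by simp
    then show False using uvw rel(2) \<open>e = 0\<close> unfolding indep3_def by blast
  qed
  define \<alpha> \<beta> \<gamma> where "\<alpha> = - a / e" and "\<beta> = - b / e" and "\<gamma> = - c / e"
  have w': "w' i = \<alpha> * u i + \<beta> * v i + \<gamma> * w i" if "i < d" for i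
  proof -
    have "e * w' i = - a * u i - b * v i - c * w i" using rel(1)[rule_format, OF that] by simp
    then show ?thesis using e0 unfolding \<alpha>_def \<beta>_def \<gamma>_def by (simp add: field_simps)
  qed
  \<comment> \<open>The common vector of the two planes: by \<open>w'\<close> it equals
    \<open>w' - \<gamma> * w\<close>, which lies in the plane at \<open>t2\<close>.\<close>
  define p where "p i = \<alpha> * u i + \<beta> * v i" for i
  have p0: "\<exists>i<d. p i \<noteq> 0"
  proof (rule ccontr)
    assume "\<not> ?thesis"
    then have "\<forall>i<d. (- \<gamma>) * w i + 1 * w' i = 0" using w' unfolding p_def by simp
    then have "(1::real) = 0" using ww unfolding indep2_def by blast
    then show False by simp
  qed
  have "(\<exists>a b. \<forall>i<d. p i = a * P t i + b * Q t i) \<or>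
      (\<exists>a b c a' b' c'. \<forall>i<d. P t i = a * u i + b * v i + c * w i \<and> Q t i = a' * u i + b' * v i + c' * w i)" for t
  proof -
    obtain a1 b1 c1 e1 where r1: "\<forall>i<d. a1 * P t1 i + b1 * Q t1 i + c1 * P t i + e1 * Q t i = 0"
      "\<not> (a1 = 0 \<and> b1 = 0 \<and> c1 = 0 \<and> e1 = 0)" using meet[of t1 t] unfolding indep4_def by blast
    obtain a2 b2 c2 e2 where r2: "\<forall>i<d. a2 * P t2 i + b2 * Q t2 i + c2 * P t i + e2 * Q t i = 0"
      "\<not> (a2 = 0 \<and> b2 = 0 \<and> c2 = 0 \<and> e2 = 0)" using meet[of t2 t] unfolding indep4_def by blast
    have n1: "c1 \<noteq> 0 \<or> e1 \<noteq> 0"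
    proof (rule ccontr)
      assume n: "\<not> (c1 \<noteq> 0 \<or> e1 \<noteq> 0)"
      then have "\<forall>i<d. a1 * P t1 i + b1 * Q t1 i = 0" using r1(1) by simp
      then show False using r1(2) n ind[of t1] unfolding indep2_def by blast
    qed
    have n2: "c2 \<noteq> 0 \<or> e2 \<noteq> 0"
    proof (rule ccontr)
      assume n: "\<not> (c2 \<noteq> 0 \<or> e2 \<noteq> 0)"
      then have "\<forall>i<d. a2 * P t2 i + b2 * Q t2 i = 0" using r2(1) by simp
      then show False using r2(2) n ind[of t2] unfolding indep2_def by blast
    qed
    \<comment> \<open>Common vectors of the plane at \<open>t\<close> with the planes at
      \<open>t1\<close> and \<open>t2\<close>. If they are not proportional, they span the plane at
      \<open>t\<close> inside the span of \<open>u\<close>, \<open>v\<close>, \<open>w\<close>; if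
      they are, they lie on the common line spanned by \<open>p\<close>.\<close>
    define p1 where "p1 i = c1 * P t i + e1 * Q t i" for i
    define p2 where "p2 i = c2 * P t i + e2 * Q t i" for i
    have p1: "p1 i = (- a1) * u i + (- b1) * v i" if "i < d" for i
      using r1(1)[rule_format, OF that] unfolding p1_def u_def v_def by simp
    let ?D = "\<sigma> * \<tau>' - \<sigma>' * \<tau>"
    define r where "r = - a2 * (\<tau>' / ?D) + (- b2) * (- \<sigma>' / ?D)"
    define s where "s = - a2 * (- \<tau> / ?D) + (- b2) * (\<sigma> / ?D)"
    have p2: "p2 i = r * w i + s * w' i" if "i < d" for i
    proof -
      have "p2 i = - a2 * P t2 i + (- b2) * Q t2 i"
        using r2(1)[rule_format, OF that] unfolding p2_def by simp
      also have "\<dots> = - a2 * ((\<tau>' / ?D) * w i + (- \<tau> / ?D) * w' i) + (- b2) * ((- \<sigma>' / ?D) * w i + (\<sigma> / ?D) * w' i)"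
        using solve_pair[OF st(1) st(2)[of i] st(3)[of i]] by simp
      also have "\<dots> = r * w i + s * w' i" unfolding r_def s_def by (simp add: algebra_simps)
      finally show ?thesis .
    qed
    have p2': "p2 i = (s * \<alpha>) * u i + (s * \<beta>) * v i + (r + s * \<gamma>) * w i" if "i < d" for i
      unfolding p2[OF that] w'[OF that] by (simp add: algebra_simps)
    show ?thesis
    proof (cases "c1 * e2 - c2 * e1 = 0")
      case False
      have PQ: "P t i = (e2 / (c1 * e2 - c2 * e1)) * p1 i + (- e1 / (c1 * e2 - c2 * e1)) * p2 i"
        "Q t i = (- c2 / (c1 * e2 - c2 * e1)) * p1 i + (c1 / (c1 * e2 - c2 * e1)) * p2 i" if "i < d" for i
        using solve_pair[OF False p1_def[of i] p2_def[of i]] by blast+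
      have comb: "x * p1 i + y * p2 i = (x * (- a1) + y * (s * \<alpha>)) * u i + (x * (- b1) + y * (s * \<beta>)) * v i + (y * (r + s * \<gamma>)) * w i"
        if "i < d" for x y i
        unfolding p1[OF that] p2'[OF that] by (simp add: algebra_simps)
      show ?thesis
      proof (rule disjI2)
        show "\<exists>a b c a' b' c'. \<forall>i<d. P t i = a * u i + b * v i + c * w i \<and> Q t i = a' * u i + b' * v i + c' * w i"
          using PQ comb by (metis (no_types))
      qed
    next
      case True
      then obtain k where k: "k \<noteq> 0" "c2 = k * c1" "e2 = k * e1"
        using proportional_pair[of c1 e2 c2 e1] n1 n2 by auto
      have p21: "p2 i = k * p1 i" for i unfolding p1_def p2_def k(2,3) by (simp add: algebra_simps)
      \<comment> \<open>Comparing coefficients in the independent \<open>u\<close>,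
        \<open>v\<close>, \<open>w\<close> shows that \<open>p2\<close> is a multiple of
        \<open>p\<close>.\<close>
      have "\<forall>i<d. (s * \<alpha> + k * a1) * u i + (s * \<beta> + k * b1) * v i + (r + s * \<gamma>) * w i = 0"
      proof (intro allI impI)
        fix i assume "i < d"
        then have "(s * \<alpha>) * u i + (s * \<beta>) * v i + (r + s * \<gamma>) * w i = k * ((- a1) * u i + (- b1) * v i)"
          using p2' p1 p21 by metis
        then show "(s * \<alpha> + k * a1) * u i + (s * \<beta> + k * b1) * v i + (r + s * \<gamma>) * w i = 0"
          by (simp add: algebra_simps)
      qed
      then have rs: "r + s * \<gamma> = 0" using uvw unfolding indep3_def by blast
      have sp: "p2 i = s * p i" if "i < d" for i
        unfolding p2'[OF that] rs p_def by (simp add: algebra_simps)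
      have "s \<noteq> 0"
      proof
        assume "s = 0"
        then have "\<forall>i<d. c2 * P t i + e2 * Q t i = 0" using sp unfolding p2_def by simp
        then show False using n2 ind[of t] unfolding indep2_def by blast
      qed
      then have "p i = (c2 / s) * P t i + (e2 / s) * Q t i" if "i < d" for i
        using sp[OF that] unfolding p2_def by (simp add: field_simps)
      then show ?thesis by blast
    qed
  qed
  then show ?thesis using p0 uvw by blast
qed

section \<open>The Pluecker degree\<close>

lemma indep2_cong:
  assumes "\<And>i. i < d \<Longrightarrow> u i = u' i" "\<And>i. i < d \<Longrightarrow> v i = v' i"
  shows "indep2 d u v \<longleftrightarrow> indep2 d u' v'"
proof -
  have "(\<forall>i<d. a * u i + b * v i = 0) \<longleftrightarrow> (\<forall>i<d. a * u' i + b * v' i = 0)" for a b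
    using assms by auto
  then show ?thesis unfolding indep2_def by simp
qed

lemma indep4_cong:
  assumes "\<And>i. i < d \<Longrightarrow> u i = u' i" "\<And>i. i < d \<Longrightarrow> v i = v' i"
    "\<And>i. i < d \<Longrightarrow> w i = w' i" "\<And>i. i < d \<Longrightarrow> s i = s' i"
  shows "indep4 d u v w s \<longleftrightarrow> indep4 d u' v' w' s'"
proof -
  have "(\<forall>i<d. a * u i + b * v i + c * w i + e * s i = 0) \<longleftrightarrow>
      (\<forall>i<d. a * u' i + b * v' i + c * w' i + e * s' i = 0)" for a b c e
    using assms by auto
  then show ?thesis unfolding indep4_def by simp
qed

lemma indep2_by_dual:
  fixes u v :: "nat \<Rightarrow> 'a::comm_ring_1"
  assumes "dotp d u X = 1" "dotp d u Y = 0" "dotp d v X = 0" "dotp d v Y = 1"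
  shows "indep2 d u v"
  unfolding indep2_def
proof (intro allI impI)
  fix a b assume *: "\<forall>i<d. a * u i + b * v i = 0"
  have "a * dotp d u Z + b * dotp d v Z = 0" for Z
    unfolding dotp_lincomb_left[symmetric] unfolding dotp_def using * by simp
  from this[of X] this[of Y] show "a = 0 \<and> b = 0" using assms by simp
qed

lemma proj_pt_eq_iff:
  assumes "v \<in> carrier_vec N" "w \<in> carrier_vec N" "v \<noteq> 0\<^sub>v N" "w \<noteq> 0\<^sub>v N"
  shows "proj_pt w = proj_pt v \<longleftrightarrow> (\<forall>i<N. \<forall>j<N. vec_index w i * vec_index v j = vec_index w j * vec_index v i)"
proof
  assume "proj_pt w = proj_pt v"
  then obtain c where c: "w = c \<cdot>\<^sub>v v" using proj_pt_eqD by blast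
  show "\<forall>i<N. \<forall>j<N. vec_index w i * vec_index v j = vec_index w j * vec_index v i"
    using assms(1) unfolding c by simp
next
  assume *: "\<forall>i<N. \<forall>j<N. vec_index w i * vec_index v j = vec_index w j * vec_index v i"
  obtain l where l: "l < N" "vec_index v l \<noteq> 0"
    using assms(1,3) by (metis eq_vecI carrier_vecD index_zero_vec)
  define c where "c = vec_index w l / vec_index v l"
  have "vec_index w i = c * vec_index v i" if "i < N" for i
    using *[rule_format, OF that l(1)] l(2) unfolding c_def by (simp add: field_simps)
  then have w: "w = c \<cdot>\<^sub>v v" using assms(1,2) by (intro eq_vecI) auto
  have "c \<noteq> 0"
  proof
    assume "c = 0"
    then have "w = 0\<^sub>v N" unfolding w using assms(1) by (intro eq_vecI) auto
    then show False using assms(4) by simp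
  qed
  then show "proj_pt w = proj_pt v" unfolding w by (rule proj_pt_scale)
qed

lemma heval_affine:
  assumes "i < dim_vec C"
  shows "vec_index (heval C (z, 1)) i = poly (cpx (vec_index C i)) z"
proof -
  have "poly (cpx (vec_index C i)) z = (\<Sum>k\<le>vdeg C. complex_of_real (coeff (vec_index C i) k) * z ^ k)"
    unfolding poly_altdef coeff_cpx degree_cpx
    by (rule sum.mono_neutral_left) (use vdeg_ge[OF assms] in \<open>auto simp: coeff_eq_0\<close>)
  then show ?thesis using assms unfolding heval_def by simp
qed

lemma heval_infinity:
  assumes "i < dim_vec C"
  shows "vec_index (heval C (1, 0)) i = complex_of_real (coeff (vec_index C i) (vdeg C))"
proof -
  have "(\<Sum>k\<le>vdeg C. complex_of_real (coeff (vec_index C i) k) * 1 ^ k * 0 ^ (vdeg C - k)) =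
      (\<Sum>k\<le>vdeg C. if k = vdeg C then complex_of_real (coeff (vec_index C i) k) else 0)"
    by (rule sum.cong) auto
  then show ?thesis using assms unfolding heval_def by simp
qed

lemma dim_heval [simp]: "dim_vec (heval C t) = dim_vec C"
  unfolding heval_def by (simp split: prod.split)

lemma infinite_params:
  assumes "finite B"
  shows "infinite ((\<lambda>z. (z, 1)) ` (- B) :: (complex \<times> complex) set)"
proof -
  have "infinite (- B)" using assms infinite_UNIV_char_0[where 'a = complex] by (metis Compl_eq_Diff_UNIV finite_Diff2)
  then show ?thesis by (simp add: finite_image_iff inj_on_def)
qed

lemma pluecker_degree_eqI:
  assumes fin: "finite {t \<in> params. heval (wedge A B) t \<noteq> 0\<^sub>v (dim_vec (wedge A B)) \<and>
      card (pluecker_fibre A B (proj_pt (heval (wedge A B) t))) \<noteq> k}"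
    and inf: "infinite {t \<in> params. heval (wedge A B) t \<noteq> 0\<^sub>v (dim_vec (wedge A B))}"
  shows "pluecker_degree A B = k"
  unfolding pluecker_degree_def
proof (rule the_equality[where P = "\<lambda>k. finite {t \<in> params. heval (wedge A B) t \<noteq> 0\<^sub>v (dim_vec (wedge A B)) \<and>
      card (pluecker_fibre A B (proj_pt (heval (wedge A B) t))) \<noteq> k}", OF fin])
  fix k' assume fin': "finite {t \<in> params. heval (wedge A B) t \<noteq> 0\<^sub>v (dim_vec (wedge A B)) \<and>
      card (pluecker_fibre A B (proj_pt (heval (wedge A B) t))) \<noteq> k'}"
  show "k' = k"
  proof (rule ccontr)
    assume "k' \<noteq> k"
    then have "{t \<in> params. heval (wedge A B) t \<noteq> 0\<^sub>v (dim_vec (wedge A B))} \<subseteq>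
      {t \<in> params. heval (wedge A B) t \<noteq> 0\<^sub>v (dim_vec (wedge A B)) \<and>
        card (pluecker_fibre A B (proj_pt (heval (wedge A B) t))) \<noteq> k} \<union>
      {t \<in> params. heval (wedge A B) t \<noteq> 0\<^sub>v (dim_vec (wedge A B)) \<and>
        card (pluecker_fibre A B (proj_pt (heval (wedge A B) t))) \<noteq> k'}" by auto
    then show False using fin fin' inf finite_subset by blast
  qed
qed

text \<open>Zero beyond the dimension, so that degree bounds hold at all indices.\<close>

definition cpx_vec :: "nat \<Rightarrow> real poly vec \<Rightarrow> nat \<Rightarrow> complex poly" where
  "cpx_vec d P i = (if i < d then cpx (vec_index P i) else 0)"

text \<open>The shape of the outcome of the algorithm. The dual vectors make the pair independent at
  every finite parameter, and \<open>lead\<close> does so at infinity.\<close>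

locale reduced_pair =
  fixes d :: nat and P Q :: "real poly vec"
  assumes dual: "dual_pair d P Q"
    and lead: "indep2 d (\<lambda>i. coeff (vec_index P i) (vdeg P)) (\<lambda>i. coeff (vec_index Q i) (vdeg Q))"
begin

abbreviation n where "n \<equiv> vdeg P + vdeg Q"

abbreviation p where "p \<equiv> cpx_vec d P"

abbreviation q where "q \<equiv> cpx_vec d Q"

abbreviation N where "N \<equiv> dim_vec (wedge P Q)"

abbreviation W :: "nat \<Rightarrow> complex poly" where "W l \<equiv> cpx (vec_index (wedge P Q) l)"

abbreviation E where "E \<equiv> para {..<N} W"

lemma carriers: "P \<in> carrier_vec d" "Q \<in> carrier_vec d"
  using dual unfolding dual_pair_def by auto

lemma vdeg_wedge: "vdeg (wedge P Q) = n"
  by (rule vdeg_wedge_lead_indep[OF carriers lead])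

lemma evp_p: "i < d \<Longrightarrow> evp p z i = poly (cpx (vec_index P i)) z"
  and evp_q: "i < d \<Longrightarrow> evp q z i = poly (cpx (vec_index Q i)) z"
  by (simp_all add: evp_def cpx_vec_def)

lemma indep_complex: "indep2 d (evp p z) (evp q z)"
proof -
  obtain X Y where XY: "dotp d (vec_index P) X = 1" "dotp d (vec_index P) Y = 0"
    "dotp d (vec_index Q) X = 0" "dotp d (vec_index Q) Y = 1" using dual unfolding dual_pair_def by blast
  have "dotp d (evp (cpx_vec d C) z) (\<lambda>i. poly (cpx (Z i)) z) = poly (cpx (dotp d (vec_index C) Z)) z" for C Z
    unfolding dotp_def cpx_sum poly_sum by (rule sum.cong) (auto simp: evp_def cpx_vec_def)
  then show ?thesis using XY
    by (intro indep2_by_dual[of _ _ "\<lambda>i. poly (cpx (X i)) z" "\<lambda>i. poly (cpx (Y i)) z"]) simp_all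
qed

lemma indep_real: "indep2 d (evp (vec_index P) t) (evp (vec_index Q) t)"
proof -
  obtain X Y where XY: "dotp d (vec_index P) X = 1" "dotp d (vec_index P) Y = 0"
    "dotp d (vec_index Q) X = 0" "dotp d (vec_index Q) Y = 1" using dual unfolding dual_pair_def by blast
  have "dotp d (evp (vec_index C) t) (\<lambda>i. poly (Z i) t) = poly (dotp d (vec_index C) Z) t" for C Z
    unfolding dotp_def poly_sum evp_def by simp
  then show ?thesis using XY
    by (intro indep2_by_dual[of _ _ "\<lambda>i. poly (X i) t" "\<lambda>i. poly (Y i) t"]) simp_all
qed

lemma indep_infinity: "indep2 d (cfp p (vdeg P)) (cfp q (vdeg Q))"
proof -
  have "indep2 d (cfp p (vdeg P)) (cfp q (vdeg Q)) \<longleftrightarrow>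
      indep2 d (\<lambda>i. complex_of_real (coeff (vec_index P i) (vdeg P))) (\<lambda>i. complex_of_real (coeff (vec_index Q i) (vdeg Q)))"
    by (rule indep2_cong) (simp_all add: cfp_def cpx_vec_def coeff_cpx)
  then show ?thesis using indep2_complex[OF lead] by blast
qed

lemma degree_p: "degree (p i) \<le> vdeg P" and degree_q: "degree (q i) \<le> vdeg Q"
  using vdeg_ge[of i P] vdeg_ge[of i Q] carriers by (auto simp: cpx_vec_def)

lemma W_bracket:
  assumes "i < j" "j < d"
  obtains l where "l < N" "\<And>z. poly (W l) z = evp p z i * evp q z j - evp p z j * evp q z i"
proof -
  obtain l where "l < N" "vec_index (wedge P Q) l = bracket P Q i j" using wedge_entry[OF carriers(1) assms] .
  then show ?thesis using that[of l] assms by (simp add: bracket_def evp_p evp_q)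
qed

lemma W_entry:
  assumes "l < N"
  shows "\<exists>i j. i < j \<and> j < d \<and> (\<forall>z. poly (W l) z = evp p z i * evp q z j - evp p z j * evp q z i)"
proof -
  obtain i j where ij: "i < j" "j < d" "vec_index (wedge P Q) l = bracket P Q i j"
    using wedge_entry_bracket[OF carriers(1) assms] .
  then have "\<forall>z. poly (W l) z = evp p z i * evp q z j - evp p z j * evp q z i"
    by (simp add: bracket_def evp_p evp_q)
  then show ?thesis using ij(1,2) by blast
qed

lemma W_nonzero: "\<exists>l\<in>{..<N}. poly (W l) z \<noteq> 0"
proof -
  obtain i j where ij: "i < j" "j < d" "evp p z i * evp q z j - evp p z j * evp q z i \<noteq> 0"
    using indep2_minor[OF indep_complex] .
  then show ?thesis using W_bracket[OF ij(1,2)] by (metis lessThan_iff)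
qed

lemma W_lead: "\<exists>l<N. coeff (W l) n \<noteq> 0"
proof -
  obtain i j where ij: "i < j" "j < d" "bracket P Q i j \<noteq> 0" using bracket_nonzero[OF dual] .
  obtain l where "l < N" "vec_index (wedge P Q) l = bracket P Q i j" using wedge_entry[OF carriers(1) ij(1,2)] .
  then show ?thesis using lead_vec_nonzero[of l "wedge P Q"] ij(3) unfolding vdeg_wedge coeff_cpx by simp
qed

lemma para_scalar:
  assumes "E u z"
  obtains c where "c \<noteq> 0" "\<And>l. l < N \<Longrightarrow> poly (W l) z = c * poly (W l) u"
proof -
  obtain l0 where l0: "l0 < N" "poly (W l0) u \<noteq> 0" using W_nonzero by blast
  define c where "c = poly (W l0) z / poly (W l0) u"
  have eq: "poly (W l) z = c * poly (W l) u" if "l < N" for l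
    using assms that l0 unfolding para_def c_def by (auto simp: field_simps)
  obtain l1 where "l1 < N" "poly (W l1) z \<noteq> 0" using W_nonzero by blast
  then have "c \<noteq> 0" using eq by auto
  then show ?thesis using that eq by blast
qed

text \<open>A plane is recovered from its Pluecker coordinates: if the brackets at \<open>z\<close>
  are a nonzero multiple of those at \<open>u\<close>, a nonzero bracket serves as the denominator
  of Cramer's rule.\<close>

lemma para_iff_same_plane: "E u z \<longleftrightarrow> same_plane d p q u z"
proof
  define br where "br w i j = evp p w i * evp q w j - evp p w j * evp q w i" for w i j
  assume uz: "E u z"
  obtain c where c: "c \<noteq> 0" "\<And>l. l < N \<Longrightarrow> poly (W l) z = c * poly (W l) u"
    using para_scalar[OF uz] by blast
  have less: "br z i j = c * br u i j" if "i < j" "j < d" for i j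
    using W_bracket[OF that] c(2) unfolding br_def by metis
  have anti: "br w i j = - br w j i" for w i j unfolding br_def by simp
  have brc: "br z i j = c * br u i j" if "i < d" "j < d" for i j
  proof (cases i j rule: linorder_cases)
    case equal
    then show ?thesis by (simp add: br_def)
  next
    case greater
    then show ?thesis using less[of j i] that anti[of z i j] anti[of u i j] by simp
  qed (use less that in simp)
  obtain i j where ij: "i < j" "j < d" "br u i j \<noteq> 0" unfolding br_def using indep2_minor[OF indep_complex] .
  let ?g = "br u i j"
  \<comment> \<open>The hypothesis \<open>pl\<close> is the vanishing of a
    \<open>3 \<times> 3\<close> determinant with a repeated row, so it holds for
    \<open>evp p\<close> and \<open>evp q\<close>.\<close>
  have rep: "r z m = (r z i * evp q u j - r z j * evp q u i) / ?g * evp p u m +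
      (r z j * evp p u i - r z i * evp p u j) / ?g * evp q u m"
    if m: "m < d" and pl: "r z m * br z i j = r z i * br z m j + r z j * br z i m" for r :: "complex \<Rightarrow> nat \<Rightarrow> complex" and m
  proof -
    have "r z m * (c * ?g) = c * (r z i * br u m j + r z j * br u i m)"
      using pl brc[of i j] brc[of m j] brc[of i m] ij m by (simp add: algebra_simps)
    then have "r z m * ?g = r z i * br u m j + r z j * br u i m" using c(1) by simp
    also have "\<dots> = (r z i * evp q u j - r z j * evp q u i) * evp p u m + (r z j * evp p u i - r z i * evp p u j) * evp q u m"
      unfolding br_def by (simp add: algebra_simps)
    finally have "r z m = ((r z i * evp q u j - r z j * evp q u i) * evp p u m + (r z j * evp p u i - r z i * evp p u j) * evp q u m) / ?g"
      using ij(3) by (simp add: field_simps)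
    then show ?thesis by (simp add: add_divide_distrib)
  qed
  have "evp p z m * br z i j = evp p z i * br z m j + evp p z j * br z i m"
    "evp q z m * br z i j = evp q z i * br z m j + evp q z j * br z i m" for m
    unfolding br_def by (simp_all add: algebra_simps)
  then show "same_plane d p q u z"
    unfolding same_plane_def using rep[of _ "evp p"] rep[of _ "evp q"] by blast
next
  assume "same_plane d p q u z"
  then obtain a b a' b' where s: "\<And>i. i < d \<Longrightarrow> evp p z i = a * evp p u i + b * evp q u i"
    "\<And>i. i < d \<Longrightarrow> evp q z i = a' * evp p u i + b' * evp q u i" unfolding same_plane_def by blast
  have "poly (W l) z = (a * b' - a' * b) * poly (W l) u" if l: "l < N" for l
  proof -
    obtain i j where ij: "i < j" "j < d" "\<And>z. poly (W l) z = evp p z i * evp q z j - evp p z j * evp q z i"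
      using W_entry[OF l] by blast
    show ?thesis unfolding ij(3) using s[of i] s[of j] ij(1,2) by (simp add: algebra_simps)
  qed
  then show "E u z" unfolding para_def by simp
qed

lemma equivp_para: "equivp E"
proof (rule equivpI)
  show "reflp E" by (rule reflpI) (simp add: para_def mult.commute)
  show "symp E" by (rule sympI) (metis para_def mult.commute)
  show "transp E"
  proof (rule transpI)
    fix u z y assume uz: "E u z" and zy: "E z y"
    obtain c where "\<And>l. l < N \<Longrightarrow> poly (W l) z = c * poly (W l) u" using para_scalar[OF uz] by blast
    moreover obtain c' where "\<And>l. l < N \<Longrightarrow> poly (W l) y = c' * poly (W l) z" using para_scalar[OF zy] by blast
    ultimately show "E u y" unfolding para_def by simp
  qed
qed

lemma finite_proportional:
  assumes "n > 0" "j < N" "c j \<noteq> (0::complex)"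
  shows "finite {z. \<forall>i\<in>{..<N}. \<forall>j\<in>{..<N}. poly (W i) z * c j = poly (W j) z * c i}"
proof -
  obtain l where l: "l < N" "coeff (W l) n \<noteq> 0" using W_lead by blast
  have "degree (W l) > 0" using le_degree[OF l(2)] assms(1) by linarith
  then show ?thesis
    using proportional_finite[of "{..<N}" W l j c] W_nonzero l(1) assms(2,3) by blast
qed

lemma finite_para:
  assumes "n > 0"
  shows "finite {z. E u z}"
proof -
  obtain j where "j < N" "poly (W j) u \<noteq> 0" using W_nonzero by blast
  then show ?thesis unfolding para_def by (rule finite_proportional[OF assms])
qed

text \<open>For \<open>d = 2\<close> there is a single bracket. It would be a polynomial of positive
  degree without a complex root.\<close>

lemma three_le_d:
  assumes "n > 0"
  shows "3 \<le> d"
proof (rule ccontr)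
  assume "\<not> 3 \<le> d"
  obtain i j where ij: "i < j" "j < d" "bracket P Q i j \<noteq> 0" using bracket_nonzero[OF dual] .
  then have d: "d = 2" using \<open>\<not> 3 \<le> d\<close> by linarith
  obtain l where l: "l < N" "coeff (W l) n \<noteq> 0" using W_lead by blast
  have "degree (W l) > 0" using le_degree[OF l(2)] assms by linarith
  then have "\<not> constant (poly (W l))" by (simp add: constant_degree)
  then obtain z where z: "poly (W l) z = 0" using fundamental_theorem_of_algebra by blast
  obtain l' where l': "l' < N" "poly (W l') z \<noteq> 0" using W_nonzero by blast
  obtain i j where ij: "i < j" "j < d" "\<And>z. poly (W l) z = evp p z i * evp q z j - evp p z j * evp q z i"
    using W_entry[OF l(1)] by blast
  obtain i' j' where ij': "i' < j'" "j' < d" "\<And>z. poly (W l') z = evp p z i' * evp q z j' - evp p z j' * evp q z i'"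
    using W_entry[OF l'(1)] by blast
  have "i = i'" "j = j'" using ij(1,2) ij'(1,2) d by linarith+
  then show False using z l'(2) ij(3) ij'(3) by simp
qed

text \<open>If the planes at any two real parameters meet, infinitely many of them pass through a
  fixed point or lie in a fixed three-dimensional space, and a polynomial identity extends this to
  all. The first alternative puts a constant vector into the module, the second gives the required
  representation.\<close>

lemma nondegenerate_cases:
  assumes n: "n > 0" and nd: "\<not> degenerate_hyperplane d (module2 d P Q)"
  shows "(\<exists>t t'. indep4 d (evp (vec_index P) t) (evp (vec_index Q) t) (evp (vec_index P) t') (evp (vec_index Q) t')) \<or>
    (\<exists>u v w f g. \<forall>i<d.
       vec_index P i = Polynomial.smult (u i) (f 0) + Polynomial.smult (v i) (f 1) + Polynomial.smult (w i) (f (2::nat)) \<and>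
       vec_index Q i = Polynomial.smult (u i) (g 0) + Polynomial.smult (v i) (g 1) + Polynomial.smult (w i) (g (2::nat)))"
    (is "?A \<or> ?B")
proof (rule disjCI)
  assume nB: "\<not> ?B"
  let ?M = "module2 d P Q"
  let ?P = "evp (vec_index P)" and ?Q = "evp (vec_index Q)"
  have noconst: "\<not> (\<exists>c \<in> carrier_vec d. c \<noteq> 0\<^sub>v d \<and> const_vec c \<in> ?M)"
  proof
    assume "\<exists>c \<in> carrier_vec d. c \<noteq> 0\<^sub>v d \<and> const_vec c \<in> ?M"
    then obtain u v w where uvw: "u \<in> carrier_vec d" "v \<in> carrier_vec d" "w \<in> carrier_vec d"
      "\<forall>C\<in>?M. \<exists>f g h. C = f \<cdot>\<^sub>v const_vec u + g \<cdot>\<^sub>v const_vec v + h \<cdot>\<^sub>v const_vec w"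
      using nd unfolding degenerate_hyperplane_def by blast
    obtain f g h where f: "P = f \<cdot>\<^sub>v const_vec u + g \<cdot>\<^sub>v const_vec v + h \<cdot>\<^sub>v const_vec w"
      using uvw(4) module2_generator(1)[OF carriers] by blast
    obtain f' g' h' where f': "Q = f' \<cdot>\<^sub>v const_vec u + g' \<cdot>\<^sub>v const_vec v + h' \<cdot>\<^sub>v const_vec w"
      using uvw(4) module2_generator(2)[OF carriers] by blast
    have idx: "vec_index (f \<cdot>\<^sub>v const_vec u + g \<cdot>\<^sub>v const_vec v + h \<cdot>\<^sub>v const_vec w) i =
        Polynomial.smult (vec_index u i) f + Polynomial.smult (vec_index v i) g + Polynomial.smult (vec_index w i) h"
      if "i < d" for f g h i
      using that uvw(1-3) unfolding const_vec_def by simp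
    have "\<forall>i<d. vec_index P i = Polynomial.smult (vec_index u i) ([f, g, h] ! 0) +
          Polynomial.smult (vec_index v i) ([f, g, h] ! 1) + Polynomial.smult (vec_index w i) ([f, g, h] ! 2) \<and>
        vec_index Q i = Polynomial.smult (vec_index u i) ([f', g', h'] ! 0) +
          Polynomial.smult (vec_index v i) ([f', g', h'] ! 1) + Polynomial.smult (vec_index w i) ([f', g', h'] ! 2)"
      using idx[of _ f g h] idx[of _ f' g' h'] f f' by simp
    then show False using nB by blast
  qed
  show ?A
  proof (rule ccontr)
    assume nA: "\<not> ?A"
    have "infinite (range complex_of_real)"
      by (simp add: finite_image_iff inj_on_def infinite_UNIV_char_0)
    \<comment> \<open>A second plane different from the one at 0 exists because the class of 0 is
      finite.\<close>
    then obtain t2 where t2: "\<not> E (complex_of_real 0) (complex_of_real t2)"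
      using finite_para[OF n, of "complex_of_real 0"] by (metis (mono_tags, lifting) finite_subset imageE mem_Collect_eq subsetI)
    have evc: "evp p (complex_of_real t) i = complex_of_real (?P t i)"
      "evp q (complex_of_real t) i = complex_of_real (?Q t i)" if "i < d" for t i
      using that by (simp_all add: evp_p evp_q poly_cpx_of_real) (simp_all add: evp_def)
    have dist: "\<not> (\<exists>a b a' b'. \<forall>i<d. ?P t2 i = a * ?P 0 i + b * ?Q 0 i \<and> ?Q t2 i = a' * ?P 0 i + b' * ?Q 0 i)"
    proof
      assume "\<exists>a b a' b'. \<forall>i<d. ?P t2 i = a * ?P 0 i + b * ?Q 0 i \<and> ?Q t2 i = a' * ?P 0 i + b' * ?Q 0 i"
      then obtain a b a' b' where *: "\<forall>i<d. ?P t2 i = a * ?P 0 i + b * ?Q 0 i \<and> ?Q t2 i = a' * ?P 0 i + b' * ?Q 0 i" by blast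
      have "\<forall>i<d. evp p (complex_of_real t2) i = of_real a * evp p (complex_of_real 0) i + of_real b * evp q (complex_of_real 0) i \<and>
          evp q (complex_of_real t2) i = of_real a' * evp p (complex_of_real 0) i + of_real b' * evp q (complex_of_real 0) i"
      proof (intro allI impI)
        fix i assume i: "i < d"
        show "evp p (complex_of_real t2) i = of_real a * evp p (complex_of_real 0) i + of_real b * evp q (complex_of_real 0) i \<and>
          evp q (complex_of_real t2) i = of_real a' * evp p (complex_of_real 0) i + of_real b' * evp q (complex_of_real 0) i"
          unfolding evc[OF i] using *[rule_format, OF i] by (simp only: of_real_add of_real_mult)
      qed
      then have "same_plane d p q (complex_of_real 0) (complex_of_real t2)" unfolding same_plane_def by blast
      then show False using t2 para_iff_same_plane by blast
    qed
    obtain pt u v w where pt: "\<exists>i<d. pt i \<noteq> 0" and uvw: "indep3 d u v w" and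
      alt: "\<And>t. (\<exists>a b. \<forall>i<d. pt i = a * ?P t i + b * ?Q t i) \<or>
         (\<exists>a b c a' b' c'. \<forall>i<d. ?P t i = a * u i + b * v i + c * w i \<and> ?Q t i = a' * u i + b' * v i + c' * w i)"
      using pairwise_meeting_planes[of d ?P ?Q t2 0] indep_real nA dist by blast
    define S1 where "S1 = {t. \<exists>a b. \<forall>i<d. pt i = a * ?P t i + b * ?Q t i}"
    define S2 where "S2 = {t. \<exists>a b c a' b' c'. \<forall>i<d. ?P t i = a * u i + b * v i + c * w i \<and>
        ?Q t i = a' * u i + b' * v i + c' * w i}"
    have "S1 \<union> S2 = UNIV" using alt unfolding S1_def S2_def by blast
    then have "infinite S1 \<or> infinite S2" using infinite_UNIV_char_0[where 'a = real] by (metis finite_UnI)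
    moreover have zero: "f = 0" if "infinite S" "\<And>t. t \<in> S \<Longrightarrow> poly f t = 0" for S and f :: "real poly"
      using that poly_roots_finite[of f] by (metis (mono_tags, lifting) finite_subset mem_Collect_eq subsetI)
    have "finite S1"
    proof (rule ccontr)
      assume inf: "infinite S1"
      \<comment> \<open>The \<open>3 \<times> 3\<close> minors of \<open>P\<close>, \<open>Q\<close>
        and the constant vector \<open>pt\<close> vanish at infinitely many parameters, hence
        identically. Cramer's rule over the fractions then expresses \<open>pt\<close> by
        \<open>P\<close> and \<open>Q\<close>.\<close>
      have minor: "bracket P Q i j * [:pt m:] + bracket P Q j m * [:pt i:] + bracket P Q m i * [:pt j:] = 0"
        if "i < d" "j < d" "m < d" for i j m
      proof (rule zero[OF inf])
        fix t assume "t \<in> S1"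
        then obtain a b where ab: "\<And>i. i < d \<Longrightarrow> pt i = a * ?P t i + b * ?Q t i" unfolding S1_def by blast
        show "poly (bracket P Q i j * [:pt m:] + bracket P Q j m * [:pt i:] + bracket P Q m i * [:pt j:]) t = 0"
          using ab[OF that(1)] ab[OF that(2)] ab[OF that(3)] unfolding bracket_def evp_def by (simp add: algebra_simps)
      qed
      obtain i j where ij: "i < j" "j < d" "bracket P Q i j \<noteq> 0" using bracket_nonzero[OF dual] .
      let ?f = "to_fract :: real poly \<Rightarrow> _"
      let ?g = "?f (bracket P Q i j)"
      have g: "?g \<noteq> 0" using ij(3) by simp
      have "?f (vec_index (const_vec (vec d pt)) m) =
          ?f (vec_index Q j * [:pt i:] - vec_index Q i * [:pt j:]) / ?g * ?f (vec_index P m) +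
          ?f (vec_index P i * [:pt j:] - vec_index P j * [:pt i:]) / ?g * ?f (vec_index Q m)" if m: "m < d" for m
      proof -
        have "[:pt m:] * bracket P Q i j = (vec_index Q j * [:pt i:] - vec_index Q i * [:pt j:]) * vec_index P m +
            (vec_index P i * [:pt j:] - vec_index P j * [:pt i:]) * vec_index Q m"
        proof -
          have "[:pt m:] * bracket P Q i j - ((vec_index Q j * [:pt i:] - vec_index Q i * [:pt j:]) * vec_index P m +
            (vec_index P i * [:pt j:] - vec_index P j * [:pt i:]) * vec_index Q m) =
            bracket P Q i j * [:pt m:] + bracket P Q j m * [:pt i:] + bracket P Q m i * [:pt j:]"
            unfolding bracket_def by (simp only: algebra_simps)
          also have "\<dots> = 0" by (rule minor) (use ij m in auto)
          finally show ?thesis by simp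
        qed
        then have "?f [:pt m:] * ?g = ?f (vec_index Q j * [:pt i:] - vec_index Q i * [:pt j:]) * ?f (vec_index P m) +
            ?f (vec_index P i * [:pt j:] - vec_index P j * [:pt i:]) * ?f (vec_index Q m)"
          unfolding to_fract_mult[symmetric] to_fract_add[symmetric] by (simp only: to_fract_eq_iff)
        then have "?f [:pt m:] = (?f (vec_index Q j * [:pt i:] - vec_index Q i * [:pt j:]) * ?f (vec_index P m) +
            ?f (vec_index P i * [:pt j:] - vec_index P j * [:pt i:]) * ?f (vec_index Q m)) / ?g"
          using g by (simp add: eq_divide_eq)
        then show ?thesis using m unfolding const_vec_def by (simp add: add_divide_distrib)
      qed
      moreover have "const_vec (vec d pt) \<in> carrier_vec d" by (simp add: const_vec_def)
      ultimately have "const_vec (vec d pt) \<in> ?M" unfolding module2_iff[OF carriers] by blast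
      moreover have "vec d pt \<noteq> 0\<^sub>v d" using pt by (metis index_vec index_zero_vec(1))
      ultimately show False using noconst by (metis vec_carrier)
    qed
    moreover have "finite S2"
    proof (rule ccontr)
      assume inf: "infinite S2"
      obtain x where x: "\<forall>i<3. \<forall>j<3. dotp d ([u, v, w] ! i) (x j) = (if i = j then 1 else 0)"
        using dual_vectors uvw unfolding indep3_lin_indep by blast
      have x': "dotp d u (x 0) = 1" "dotp d v (x 0) = 0" "dotp d w (x 0) = 0"
        "dotp d u (x 1) = 0" "dotp d v (x 1) = 1" "dotp d w (x 1) = 0"
        "dotp d u (x 2) = 0" "dotp d v (x 2) = 0" "dotp d w (x 2) = 1"
        using x[rule_format, of 0 0] x[rule_format, of 1 0] x[rule_format, of 2 0]
          x[rule_format, of 0 1] x[rule_format, of 1 1] x[rule_format, of 2 1]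
          x[rule_format, of 0 2] x[rule_format, of 1 2] x[rule_format, of 2 2] by simp_all
      \<comment> \<open>The coordinates with respect to \<open>u\<close>, \<open>v\<close>,
        \<open>w\<close> are read off by the dual vectors \<open>x\<close>, which turns a pointwise
        statement into polynomial coefficients.\<close>
      have expand: "vec_index R i = Polynomial.smult (u i) (pdot d (vec_index R) (x 0)) +
          Polynomial.smult (v i) (pdot d (vec_index R) (x 1)) + Polynomial.smult (w i) (pdot d (vec_index R) (x 2))"
        if i: "i < d" and R: "\<And>t. t \<in> S2 \<Longrightarrow> \<exists>a b c. \<forall>i<d. evp (vec_index R) t i = a * u i + b * v i + c * w i" for R i
      proof -
        have "vec_index R i - (Polynomial.smult (u i) (pdot d (vec_index R) (x 0)) +
          Polynomial.smult (v i) (pdot d (vec_index R) (x 1)) + Polynomial.smult (w i) (pdot d (vec_index R) (x 2))) = 0"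
        proof (rule zero[OF inf])
          fix t assume "t \<in> S2"
          then obtain a b c where abc: "\<And>i. i < d \<Longrightarrow> evp (vec_index R) t i = a * u i + b * v i + c * w i" using R by blast
          have "dotp d (evp (vec_index R) t) y = a * dotp d u y + b * dotp d v y + c * dotp d w y" for y
            unfolding dotp_def sum_distrib_left sum.distrib[symmetric]
            by (rule sum.cong) (auto simp: abc algebra_simps)
          then show "poly (vec_index R i - (Polynomial.smult (u i) (pdot d (vec_index R) (x 0)) +
            Polynomial.smult (v i) (pdot d (vec_index R) (x 1)) + Polynomial.smult (w i) (pdot d (vec_index R) (x 2)))) t = 0"
            using abc[OF i] by (simp add: poly_pdot x' x'[unfolded One_nat_def] evp_def mult.commute)
        qed
        then show ?thesis by simp
      qed
      have "\<exists>a b c. \<forall>i<d. ?P t i = a * u i + b * v i + c * w i" "\<exists>a b c. \<forall>i<d. ?Q t i = a * u i + b * v i + c * w i"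
        if "t \<in> S2" for t using that unfolding S2_def by blast+
      then have "\<forall>i<d.
         vec_index P i = Polynomial.smult (u i) (pdot d (vec_index P) (x 0)) +
          Polynomial.smult (v i) (pdot d (vec_index P) (x 1)) + Polynomial.smult (w i) (pdot d (vec_index P) (x 2)) \<and>
         vec_index Q i = Polynomial.smult (u i) (pdot d (vec_index Q) (x 0)) +
          Polynomial.smult (v i) (pdot d (vec_index Q) (x 1)) + Polynomial.smult (w i) (pdot d (vec_index Q) (x 2))"
        using expand[of _ P] expand[of _ Q] by blast
      then have ?B
        by (intro exI[of _ u] exI[of _ v] exI[of _ w] exI[of _ "\<lambda>k. pdot d (vec_index P) (x k)"]
            exI[of _ "\<lambda>k. pdot d (vec_index Q) (x k)"])
      then show False using nB by blast
    qed
    ultimately show False by blast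
  qed
qed

lemma good_line_nondegenerate:
  assumes n: "n > 0" and nd: "\<not> degenerate_hyperplane d (module2 d P Q)"
    and B: "finite B" "\<And>z. z \<notin> B \<Longrightarrow> card {z'. E z z'} = k"
  shows "\<exists>x y. good_line d p q n B E x y"
  using nondegenerate_cases[OF n nd]
proof
  assume "\<exists>t t'. indep4 d (evp (vec_index P) t) (evp (vec_index Q) t) (evp (vec_index P) t') (evp (vec_index Q) t')"
  then obtain t t' where "indep4 d (evp (vec_index P) t) (evp (vec_index Q) t) (evp (vec_index P) t') (evp (vec_index Q) t')" by blast
  note i4r = indep4_complex[OF this]
  have i4: "indep4 d (evp p (of_real t)) (evp q (of_real t)) (evp p (of_real t')) (evp q (of_real t'))"
    by (rule iffD1[OF indep4_cong i4r]) (simp_all add: evp_p evp_q poly_cpx_of_real, simp_all add: evp_def)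
  define Bad where "Bad = {z. \<not> indep4 d (evp p z) (evp q z) (evp p (of_real t')) (evp q (of_real t'))}"
  have "finite Bad"
    unfolding Bad_def indep4_lin_indep
    by (rule lin_dep_finite[of _ _ _ "of_real t"])
      (use i4 in \<open>auto simp: indep4_lin_indep evp_def eval_nat_numeral less_Suc_eq\<close>)
  \<comment> \<open>A countable infinite set with the planes complementary to the one at
    \<open>t'\<close>; only finitely many natural numbers are lost.\<close>
  define T where "T = (\<nat> :: complex set) - Bad"
  have "infinite (\<nat> :: complex set)" unfolding Nats_def by (simp add: finite_image_iff inj_on_def)
  then have T: "infinite T" "countable T" unfolding T_def Nats_def using \<open>finite Bad\<close> by auto
  show ?thesis
  proof (rule good_line_exists[where T = T and B = B and ?B0.0 = B and k = k and E = E and ?t0.0 = "of_real t'"])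
    show "same_plane d p q z z'" if "E z z'" for z z' using that para_iff_same_plane by blast
    show "E z z'" if "same_plane d p q z z'" for z z' using that para_iff_same_plane by blast
    show "indep4 d (evp p z) (evp q z) (evp p (of_real t')) (evp q (of_real t'))" if "z \<in> T" for z
      using that unfolding T_def Bad_def by blast
  qed (use three_le_d n indep_complex indep_infinity degree_p degree_q B T in auto)
next
  assume "\<exists>u v w f g. \<forall>i<d.
       vec_index P i = Polynomial.smult (u i) (f 0) + Polynomial.smult (v i) (f 1) + Polynomial.smult (w i) (f (2::nat)) \<and>
       vec_index Q i = Polynomial.smult (u i) (g 0) + Polynomial.smult (v i) (g 1) + Polynomial.smult (w i) (g (2::nat))"
  then obtain u v w f g where fg: "\<And>i. i < d \<Longrightarrow>
       vec_index P i = Polynomial.smult (u i) (f 0) + Polynomial.smult (v i) (f 1) + Polynomial.smult (w i) (f (2::nat)) \<and>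
       vec_index Q i = Polynomial.smult (u i) (g 0) + Polynomial.smult (v i) (g 1) + Polynomial.smult (w i) (g (2::nat))" by blast
  show ?thesis
  proof (rule good_line_coplanar[where B = B and ?B0.0 = B and k = k and E = E and u = "\<lambda>i. of_real (u i)"
        and v = "\<lambda>i. of_real (v i)" and w = "\<lambda>i. of_real (w i)" and p = "\<lambda>k. cpx (f k)" and q = "\<lambda>k. cpx (g k)"])
    show "p i = Polynomial.smult (of_real (u i)) (cpx (f 0)) + Polynomial.smult (of_real (v i)) (cpx (f 1)) +
        Polynomial.smult (of_real (w i)) (cpx (f 2))" if "i < d" for i
      using fg[OF that] that by (simp add: cpx_vec_def cpx_smult)
    show "q i = Polynomial.smult (of_real (u i)) (cpx (g 0)) + Polynomial.smult (of_real (v i)) (cpx (g 1)) +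
        Polynomial.smult (of_real (w i)) (cpx (g 2))" if "i < d" for i
      using fg[OF that] that by (simp add: cpx_vec_def cpx_smult)
    show "E z z' \<longleftrightarrow> same_plane d p q z z'" for z z' by (rule para_iff_same_plane)
  qed (use three_le_d n indep_complex indep_infinity degree_p degree_q B in auto)
qed

section \<open>Rulings and the degree of the hypersurface\<close>

lemma heval_scalar_prod:
  assumes "C \<in> carrier_vec d" "x \<in> carrier_vec d"
  shows "heval C t \<bullet> x = dotp d (vec_index (heval C t)) (vec_index x)"
  using assms unfolding scalar_prod_def dotp_def by (simp add: atLeast0LessThan)

lemma heval_affine_dotp:
  assumes "C \<in> carrier_vec d" "x \<in> carrier_vec d"
  shows "heval C (z, 1) \<bullet> x = dotp d (evp (cpx_vec d C) z) (vec_index x)"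
  unfolding heval_scalar_prod[OF assms] dotp_def
  by (rule sum.cong) (use assms in \<open>auto simp: heval_affine evp_def cpx_vec_def\<close>)

lemma heval_infinity_dotp:
  assumes "C \<in> carrier_vec d" "x \<in> carrier_vec d"
  shows "heval C (1, 0) \<bullet> x = dotp d (cfp (cpx_vec d C) (vdeg C)) (vec_index x)"
  unfolding heval_scalar_prod[OF assms] dotp_def
  by (rule sum.cong) (use assms in \<open>auto simp: heval_infinity cfp_def cpx_vec_def coeff_cpx\<close>)

lemma ruling_affine:
  "ruling d (module2 d P Q) (z, 1) =
    {x \<in> carrier_vec d. dotp d (evp p z) (vec_index x) = 0 \<and> dotp d (evp q z) (vec_index x) = 0}"
proof (intro equalityI subsetI)
  fix x assume "x \<in> ruling d (module2 d P Q) (z, 1)"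
  then show "x \<in> {x \<in> carrier_vec d. dotp d (evp p z) (vec_index x) = 0 \<and> dotp d (evp q z) (vec_index x) = 0}"
    using module2_generator[OF carriers] heval_affine_dotp[OF carriers(1)] heval_affine_dotp[OF carriers(2)]
    unfolding ruling_def by auto
next
  fix x assume "x \<in> {x \<in> carrier_vec d. dotp d (evp p z) (vec_index x) = 0 \<and> dotp d (evp q z) (vec_index x) = 0}"
  then have x: "x \<in> carrier_vec d" "dotp d (evp p z) (vec_index x) = 0" "dotp d (evp q z) (vec_index x) = 0" by auto
  have "heval C (z, 1) \<bullet> x = 0" if C: "C \<in> module2 d P Q" for C
  proof -
    obtain a b where ab: "C = a \<cdot>\<^sub>v P + b \<cdot>\<^sub>v Q" using C unfolding module2_dual_pair[OF dual] by blast
    have Cc: "C \<in> carrier_vec d" unfolding ab using carriers by simp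
    have "dotp d (evp (cpx_vec d C) z) (vec_index x) =
        dotp d (\<lambda>i. poly (cpx a) z * evp p z i + poly (cpx b) z * evp q z i) (vec_index x)"
      unfolding dotp_def
      by (rule sum.cong) (auto simp: evp_def cpx_vec_def ab vec_lincomb_index[OF carriers])
    then show ?thesis unfolding heval_affine_dotp[OF Cc x(1)] dotp_lincomb_left x(2,3) by simp
  qed
  then show "x \<in> ruling d (module2 d P Q) (z, 1)" unfolding ruling_def using x(1) by blast
qed

lemma ruling_infinity:
  "ruling d (module2 d P Q) (1, 0) \<subseteq>
    {x \<in> carrier_vec d. dotp d (cfp p (vdeg P)) (vec_index x) = 0 \<and> dotp d (cfp q (vdeg Q)) (vec_index x) = 0}"
  using module2_generator[OF carriers] heval_infinity_dotp[OF carriers(1)] heval_infinity_dotp[OF carriers(2)]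
  unfolding ruling_def by auto

lemma implicit_degree_formula:
  assumes n: "n > 0" and nd: "\<not> degenerate_hyperplane d (module2 d P Q)"
    and B: "finite B" "\<And>z. z \<notin> B \<Longrightarrow> card {z'. E z z'} = k"
  shows "k * implicit_degree d (hypersurface d (module2 d P Q)) = n"
proof -
  obtain x y where good: "good_line d p q n B E x y" using good_line_nondegenerate[OF n nd B] by blast
  show ?thesis
    unfolding hypersurface_def
  proof (rule degree_formula[where P = p and Q = q and B = B and E = E and ?m1.0 = "vdeg P" and ?m2.0 = "vdeg Q"])
    show "same_plane d p q z z'" if "E z z'" for z z' using that para_iff_same_plane by blast
  qed (use three_le_d[OF n] degree_p degree_q n good equivp_para B ruling_affine ruling_infinity in auto)
qed

section \<open>The Pluecker map given by arbitrary generators\<close>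

context
  fixes A B :: "real poly vec" and s :: "real poly"
  assumes wedge_AB: "wedge A B = s \<cdot>\<^sub>v wedge P Q" and s: "s \<noteq> 0"
begin

lemma dim_wedge_AB: "dim_vec (wedge A B) = N"
  unfolding wedge_AB by simp

lemma heval_wedge_affine: "heval (wedge A B) (z, 1) = poly (cpx s) z \<cdot>\<^sub>v vec N (\<lambda>l. poly (W l) z)"
  by (rule eq_vecI) (auto simp: heval_affine dim_wedge_AB wedge_AB)

lemma heval_wedge_infinity:
  "heval (wedge A B) (1, 0) = complex_of_real (lead_coeff s) \<cdot>\<^sub>v vec N (\<lambda>l. coeff (W l) n)"
proof (rule eq_vecI)
  fix l assume "l < dim_vec (complex_of_real (lead_coeff s) \<cdot>\<^sub>v vec N (\<lambda>l. coeff (W l) n))"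
  then have l: "l < N" by simp
  obtain l' where "l' < N" "coeff (W l') n \<noteq> 0" using W_lead by blast
  then have l': "l' < N" "vec_index (wedge P Q) l' \<noteq> 0" by auto
  have vd: "vdeg (wedge A B) = degree s + n"
    unfolding wedge_AB vdeg_wedge[symmetric] by (rule vdeg_smult[OF s l'])
  have "coeff (s * vec_index (wedge P Q) l) (degree s + n) = lead_coeff s * coeff (vec_index (wedge P Q) l) n"
    by (rule coeff_mult_degree_le) (use vdeg_ge[OF l] vdeg_wedge in auto)
  then show "vec_index (heval (wedge A B) (1, 0)) l =
      vec_index (complex_of_real (lead_coeff s) \<cdot>\<^sub>v vec N (\<lambda>l. coeff (W l) n)) l"
    using l by (simp add: heval_infinity dim_wedge_AB vd) (simp add: wedge_AB coeff_cpx)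
qed (simp add: dim_wedge_AB)

lemma W_vec_nonzero: "vec N (\<lambda>l. poly (W l) z) \<noteq> 0\<^sub>v N" "vec N (\<lambda>l. coeff (W l) n) \<noteq> 0\<^sub>v N"
  using W_nonzero[of z] W_lead by (metis index_vec index_zero_vec(1) lessThan_iff)+

lemma heval_wedge_affine_eq_0: "heval (wedge A B) (z, 1) = 0\<^sub>v N \<longleftrightarrow> poly (cpx s) z = 0"
proof
  assume *: "heval (wedge A B) (z, 1) = 0\<^sub>v N"
  obtain l where l: "l < N" "poly (W l) z \<noteq> 0" using W_nonzero by blast
  have "poly (cpx s) z * poly (W l) z = 0"
    using arg_cong[OF *[unfolded heval_wedge_affine], of "\<lambda>v. vec_index v l"] l(1) by simp
  then show "poly (cpx s) z = 0" using l(2) by simp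
next
  assume "poly (cpx s) z = 0"
  then show "heval (wedge A B) (z, 1) = 0\<^sub>v N" unfolding heval_wedge_affine by (intro eq_vecI) auto
qed

lemma finite_roots_s: "finite {z. poly (cpx s) z = 0}"
  using s by (intro poly_roots_finite) simp

lemma proj_affine: "poly (cpx s) z \<noteq> 0 \<Longrightarrow> proj_pt (heval (wedge A B) (z, 1)) = proj_pt (vec N (\<lambda>l. poly (W l) z))"
  unfolding heval_wedge_affine by (rule proj_pt_scale)

lemma proj_infinity: "proj_pt (heval (wedge A B) (1, 0)) = proj_pt (vec N (\<lambda>l. coeff (W l) n))"
  unfolding heval_wedge_infinity using s by (intro proj_pt_scale) simp

lemma infinite_domain: "infinite {t \<in> params. heval (wedge A B) t \<noteq> 0\<^sub>v (dim_vec (wedge A B))}"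
proof -
  have "(\<lambda>z. (z, 1)) ` (- {z. poly (cpx s) z = 0}) \<subseteq> {t \<in> params. heval (wedge A B) t \<noteq> 0\<^sub>v (dim_vec (wedge A B))}"
    unfolding params_def dim_wedge_AB by (auto simp: heval_wedge_affine_eq_0)
  then show ?thesis using infinite_params[OF finite_roots_s] finite_subset by blast
qed

text \<open>Every fibre is the whole infinite domain, and the \<open>card\<close> of an infinite set
  is 0.\<close>

lemma pluecker_degree_constant:
  assumes n: "n = 0"
  shows "pluecker_degree A B = 0"
proof (rule pluecker_degree_eqI[OF _ infinite_domain])
  have const: "poly (W l) z = coeff (W l) n" if "l < N" for l z
  proof -
    have "degree (W l) = 0" using vdeg_ge[OF that] vdeg_wedge n by simp
    then show ?thesis using n by (metis degree_0_id poly_const_conv coeff_pCons_0 degree_eq_zeroE)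
  qed
  let ?c = "vec N (\<lambda>l. coeff (W l) n)"
  have c: "vec N (\<lambda>l. poly (W l) z) = ?c" for z using const by (intro eq_vecI) auto
  have same: "proj_pt (heval (wedge A B) t) = proj_pt ?c" if t: "t \<in> params" "heval (wedge A B) t \<noteq> 0\<^sub>v N" for t
  proof -
    consider "t = (1, 0)" | z where "t = (z, 1)" using t(1) unfolding params_def by blast
    then show ?thesis
    proof cases
      case 1
      then show ?thesis using proj_infinity by simp
    next
      case 2
      then show ?thesis using t(2) proj_affine[of z] heval_wedge_affine_eq_0 c by simp
    qed
  qed
  have card0: "card (pluecker_fibre A B (proj_pt (heval (wedge A B) t))) = 0"
    if t: "t \<in> params" "heval (wedge A B) t \<noteq> 0\<^sub>v (dim_vec (wedge A B))" for t
  proof -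
    have "pluecker_fibre A B (proj_pt (heval (wedge A B) t)) =
        {t \<in> params. heval (wedge A B) t \<noteq> 0\<^sub>v (dim_vec (wedge A B))}"
      unfolding pluecker_fibre_def using same t unfolding dim_wedge_AB by auto
    then show ?thesis using infinite_domain by simp
  qed
  have "{t \<in> params. heval (wedge A B) t \<noteq> 0\<^sub>v (dim_vec (wedge A B)) \<and>
      card (pluecker_fibre A B (proj_pt (heval (wedge A B) t))) \<noteq> 0} = {}"
  proof (rule equals0I)
    fix t assume "t \<in> {t \<in> params. heval (wedge A B) t \<noteq> 0\<^sub>v (dim_vec (wedge A B)) \<and>
      card (pluecker_fibre A B (proj_pt (heval (wedge A B) t))) \<noteq> 0}"
    then show False using card0[of t] by simp
  qed
  then show "finite {t \<in> params. heval (wedge A B) t \<noteq> 0\<^sub>v (dim_vec (wedge A B)) \<and>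
      card (pluecker_fibre A B (proj_pt (heval (wedge A B) t))) \<noteq> 0}"
    by (simp only: finite.emptyI)
qed

text \<open>Away from finitely many parameters the fibre is a full class of \<open>E\<close>. Such a
  class could differ from the fibre by the point at infinity or by roots of the common factor
  \<open>s\<close>, where the chosen generators leave the map undefined.\<close>

lemma pluecker_degree_eq:
  assumes n: "n > 0" and B0: "finite B0" "\<And>z. z \<notin> B0 \<Longrightarrow> card {z'. E z z'} = k"
  shows "pluecker_degree A B = k"
proof (rule pluecker_degree_eqI[OF _ infinite_domain])
  \<comment> \<open>Parameters with the same Pluecker point as the parameter at infinity.\<close>
  define Binf where "Binf = {z. \<forall>i\<in>{..<N}. \<forall>j\<in>{..<N}. poly (W i) z * coeff (W j) n = poly (W j) z * coeff (W i) n}"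
  have "finite Binf"
    unfolding Binf_def using W_lead finite_proportional[OF n, where c = "\<lambda>l. coeff (W l) n"] by blast
  \<comment> \<open>The whole classes of the roots of \<open>s\<close> are removed, so that the map
    is defined on every remaining class.\<close>
  define Bs where "Bs = (\<Union>r\<in>{z. poly (cpx s) z = 0}. {z. E r z})"
  have "finite Bs" unfolding Bs_def using finite_roots_s finite_para[OF n] by blast
  have card: "card (pluecker_fibre A B (proj_pt (heval (wedge A B) (z, 1)))) = k"
    if z: "z \<notin> B0" "z \<notin> Binf" "z \<notin> Bs" for z
  proof -
    have sz: "poly (cpx s) z \<noteq> 0" using z(3) equivp_reflp[OF equivp_para] unfolding Bs_def by blast
    have iff: "proj_pt (vec N (\<lambda>l. poly (W l) z')) = proj_pt (vec N (\<lambda>l. poly (W l) z)) \<longleftrightarrow> E z z'" for z'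
      using proj_pt_eq_iff[OF _ _ W_vec_nonzero(1)[of z] W_vec_nonzero(1)[of z']] unfolding para_def by auto
    have ninf: "proj_pt (vec N (\<lambda>l. coeff (W l) n)) \<noteq> proj_pt (vec N (\<lambda>l. poly (W l) z))"
    proof
      assume "proj_pt (vec N (\<lambda>l. coeff (W l) n)) = proj_pt (vec N (\<lambda>l. poly (W l) z))"
      then have "z \<in> Binf"
        using proj_pt_eq_iff[OF _ _ W_vec_nonzero(2) W_vec_nonzero(1)[of z]] unfolding Binf_def by auto
      then show False using z(2) by simp
    qed
    have "pluecker_fibre A B (proj_pt (heval (wedge A B) (z, 1))) = (\<lambda>z'. (z', 1 :: complex)) ` {z'. E z z'}"
    proof (intro equalityI subsetI)
      fix t assume t: "t \<in> pluecker_fibre A B (proj_pt (heval (wedge A B) (z, 1)))"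
      then consider "t = (1, 0)" | z' where "t = (z', 1)" unfolding pluecker_fibre_def params_def by blast
      then show "t \<in> (\<lambda>z'. (z', 1 :: complex)) ` {z'. E z z'}"
      proof cases
        case 1
        then show ?thesis using t proj_infinity proj_affine[OF sz] ninf unfolding pluecker_fibre_def by simp
      next
        case 2
        then have "poly (cpx s) z' \<noteq> 0" using t heval_wedge_affine_eq_0 unfolding pluecker_fibre_def dim_wedge_AB by blast
        then have "E z z'" using t 2 proj_affine[OF sz] proj_affine[of z'] iff unfolding pluecker_fibre_def by simp
        then show ?thesis using 2 by blast
      qed
    next
      fix t assume "t \<in> (\<lambda>z'. (z', 1 :: complex)) ` {z'. E z z'}"
      then obtain z' where z': "t = (z', 1)" "E z z'" by blast
      have sz': "poly (cpx s) z' \<noteq> 0"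
        using z(3) z'(2) equivp_symp[OF equivp_para] unfolding Bs_def by blast
      then show "t \<in> pluecker_fibre A B (proj_pt (heval (wedge A B) (z, 1)))"
        using z' heval_wedge_affine_eq_0 proj_affine[OF sz] proj_affine[OF sz'] iff
        unfolding pluecker_fibre_def dim_wedge_AB params_def by auto
    qed
    moreover have "card ((\<lambda>z'. (z', 1 :: complex)) ` {z'. E z z'}) = card {z'. E z z'}"
      by (rule card_image) (simp add: inj_on_def)
    ultimately show ?thesis using B0(2)[OF z(1)] by simp
  qed
  have "{t \<in> params. heval (wedge A B) t \<noteq> 0\<^sub>v (dim_vec (wedge A B)) \<and>
      card (pluecker_fibre A B (proj_pt (heval (wedge A B) t))) \<noteq> k} \<subseteq>
      insert (1, 0) ((\<lambda>z. (z, 1 :: complex)) ` (B0 \<union> Binf \<union> Bs))"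
    unfolding params_def using card by auto
  moreover have "finite (insert (1, 0) ((\<lambda>z. (z, 1 :: complex)) ` (B0 \<union> Binf \<union> Bs)))"
    using B0(1) \<open>finite Binf\<close> \<open>finite Bs\<close> by simp
  ultimately show "finite {t \<in> params. heval (wedge A B) t \<noteq> 0\<^sub>v (dim_vec (wedge A B)) \<and>
      card (pluecker_fibre A B (proj_pt (heval (wedge A B) t))) \<noteq> k}"
    by (rule finite_subset)
qed

end

text \<open>Arbitrary generators change the wedge product by a nonzero polynomial factor only. For
  \<open>n = 0\<close> the product is 0 because its first factor is.\<close>

lemma pluecker_implicit_degree:
  assumes AB: "A \<in> carrier_vec d" "B \<in> carrier_vec d" "module2 d A B = module2 d P Q"
    and nd: "\<not> degenerate_hyperplane d (module2 d P Q)"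
  shows "pluecker_degree A B * implicit_degree d (hypersurface d (module2 d P Q)) = n"
proof -
  obtain a b c e where A: "A = a \<cdot>\<^sub>v P + b \<cdot>\<^sub>v Q" and B: "B = c \<cdot>\<^sub>v P + e \<cdot>\<^sub>v Q" and det: "a * e - b * c \<noteq> 0"
    using module2_generators[OF dual AB] .
  have w: "wedge A B = (a * e - b * c) \<cdot>\<^sub>v wedge P Q" unfolding A B by (rule wedge_lincomb[OF carriers])
  show ?thesis
  proof (cases "n = 0")
    case True
    then show ?thesis using pluecker_degree_constant[OF w det] by simp
  next
    case False
    then have n: "n > 0" by simp
    obtain k B0 where B0: "finite B0" "\<And>u. u \<notin> B0 \<Longrightarrow> card {z. E u z} = k"
      using para_generic_card[of "{..<N}" W] by blast
    show ?thesis using pluecker_degree_eq[OF w det n B0] implicit_degree_formula[OF n nd B0] by simp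
  qed
qed

end

lemma indep_pair_two_le:
  assumes "A \<in> carrier_vec d" "B \<in> carrier_vec d" "indep_pair d A (B :: 'a::comm_ring_1 vec)"
  shows "2 \<le> d"
proof (rule ccontr)
  assume "\<not> 2 \<le> d"
  then have d: "i = 0" if "i < d" for i using that by linarith
  have "vec_index B 0 \<cdot>\<^sub>v A + (- vec_index A 0) \<cdot>\<^sub>v B = 0\<^sub>v d"
    using assms(1,2) d by (intro eq_vecI) (auto simp: mult.commute)
  then have "vec_index B 0 = 0" "vec_index A 0 = 0" using assms(3) unfolding indep_pair_def by (metis neg_equal_0_iff_equal)+
  then have "1 \<cdot>\<^sub>v A + 0 \<cdot>\<^sub>v B = 0\<^sub>v d" using assms(1,2) d by (intro eq_vecI) auto
  then have "(1::'a) = 0" using assms(3) unfolding indep_pair_def by blast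
  then show False by simp
qed

text \<open>Over the fractions, the rows of \<open>V\<close> and the input differ by a
  \<open>2 \<times> 2\<close> matrix whose determinant is nonzero by the independence of
  \<open>A\<close> and \<open>B\<close>; so the loop starts with generators of
  \<open>M\<close>.\<close>

lemma mu_basis_algorithm_correct:
  assumes gen: "quasi_generators d M A B" and r: "r \<in> mu_basis_algorithm d A B"
  shows "\<exists>A' B'. r = Some (A', B') \<and> reduced_pair d A' B' \<and> module2 d A' B' = M"
proof -
  have AB: "A \<in> carrier_vec d" "B \<in> carrier_vec d" "indep_pair d A B" and M: "module2 d A B = M"
    using gen unfolding quasi_generators_def by auto
  have d: "2 \<le> d" by (rule indep_pair_two_le[OF AB])
  obtain U V where UV: "smith_form d A B U V" and r': "r = mu_loop (row V 0, row V 1)"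
    using r unfolding mu_basis_algorithm_def by blast
  have U: "U \<in> carrier_mat 2 2" and V: "unimodular d V" "V \<in> carrier_mat d d"
    and eq: "mat_of_rows d [A, B] = U * smith_diag d A B * V"
    using UV unfolding smith_form_def unimodular_def by auto
  note rows = smith_form_rows[OF AB(1,2) d U V(2) smith_diag_def[unfolded Let_def] eq]
  have PQ: "dual_pair d (row V 0) (row V 1)" by (rule unimodular_rows_dual_pair[OF V(1) d])
  then have PQc: "row V 0 \<in> carrier_vec d" "row V 1 \<in> carrier_vec d" unfolding dual_pair_def by auto
  have "module2 d (row V 0) (row V 1) = M"
  proof -
    let ?s = "Gcd (set\<^sub>v A \<union> set\<^sub>v B)"
    let ?t = "wedge_gcd A B div ?s"
    have "U $$ (0, 0) * ?s * (U $$ (1, 1) * ?t) - U $$ (0, 1) * ?t * (U $$ (1, 0) * ?s) \<noteq> 0"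
      by (rule indep_pair_det[OF PQc]) (use AB(3) rows in simp)
    from module2_lincomb[OF PQc this] show ?thesis using rows M by simp
  qed
  then show ?thesis using mu_loop_correct[OF PQ] r' unfolding reduced_pair_def by metis
qed

theorem lemma5:
  fixes d :: nat and A B :: "real poly vec" and M :: "real poly vec set"
  assumes "quasi_generators d M A B"
  shows "mu_basis_algorithm d A B \<noteq> {} \<and>
         (\<forall>r \<in> mu_basis_algorithm d A B. \<exists>A' B'. r = Some (A', B') \<and> mu_basis d M A' B') \<and>
         (\<not> degenerate_hyperplane d M \<longrightarrow>
           pluecker_degree A B * implicit_degree d (hypersurface d M) = module_degree d M)"
proof (intro conjI ballI impI)
  have AB: "A \<in> carrier_vec d" "B \<in> carrier_vec d" "indep_pair d A B" and M: "module2 d A B = M"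
    using assms unfolding quasi_generators_def by auto
  have d: "2 \<le> d" by (rule indep_pair_two_le[OF AB])
  show ne: "mu_basis_algorithm d A B \<noteq> {}"
    using smith_form_exists[OF AB d] unfolding mu_basis_algorithm_def by blast
  have red: "module_degree d M = vdeg A' + vdeg B'" if "reduced_pair d A' B'" "module2 d A' B' = M" for A' B'
    using module_degree_dual_pair[OF reduced_pair.dual[OF that(1)] that(2)] reduced_pair.vdeg_wedge[OF that(1)] by simp
  show "\<exists>A' B'. r = Some (A', B') \<and> mu_basis d M A' B'" if r: "r \<in> mu_basis_algorithm d A B" for r
  proof -
    obtain A' B' where AB': "r = Some (A', B')" "reduced_pair d A' B'" "module2 d A' B' = M"
      using mu_basis_algorithm_correct[OF assms r] by blast
    have "mu_basis d M A' B'"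
      unfolding mu_basis_def quasi_generators_def
      using red[OF AB'(2,3)] AB'(3) reduced_pair.carriers[OF AB'(2)] dual_pair_indep[OF reduced_pair.dual[OF AB'(2)]] by blast
    then show ?thesis using AB'(1) by blast
  qed
  assume nd: "\<not> degenerate_hyperplane d M"
  obtain A' B' where AB': "reduced_pair d A' B'" "module2 d A' B' = M"
    using mu_basis_algorithm_correct[OF assms] ne by blast
  show "pluecker_degree A B * implicit_degree d (hypersurface d M) = module_degree d M"
    using reduced_pair.pluecker_implicit_degree[OF AB'(1) AB(1,2)] AB'(2) M nd red[OF AB'] by simp
qed

end
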